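(* Let $p\ge 3$ be an integer and let $k$ be a positive odd integer. (a) Suppose $q$ is a rational period function (RPF) of weight $2k$ on the Hecke group $G_p$ all of whose irreducible systems of poles $P(q;\alpha)$ (for $\alpha$ a nonzero pole of $q$) are Hecke $\lambda_p$-symmetric. Then $q$ is of the form $$q(z)=\sum_{\ell=1}^{L} d_\ell \sum_{\alpha\in Z_{\mathcal{A}_\ell}} Q_\alpha(z,1)^{-k} + c_0\,q_{k,0}(z), \qquad ( * )$$ where each $\mathcal{A}_\ell$ is a hyperbolic $G_p$-equivalence class of $\lambda_p$-BQFs satisfying $-\mathcal{A}_\ell=\mathcal{A}_\ell$, the $d_\ell$ ($1\le \ell\le L$) and $c_0$ are constants, and $q_{k,0}$ is a function of the form $$q_{k,0}(z)=\begin{cases} a_0(1-z^{-2k}), & 2k\ne 2,\\ a_0(1-z^{-2})+b_1z^{-1}, & 2k=2,\end{cases}$$ with constants $a_0,b_1$. (b) Conversely, any rational function of the form $( * )$ (with $\mathcal{A}_\ell$, $d_\ell$, $c_0$, $q_{k,0}$ as in (a)) is an RPF of weight $2k$ on $G_p$ with Hecke $\lambda_p$-symmetric irreducible systems of poles.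
   Context: Hecke groups. For an integer $p\ge 3$ put $\lambda=\lambda_p=2\cos(\pi/p)$, $S=\begin{pmatrix}1&\lambda\\0&1\end{pmatrix}$, $T=\begin{pmatrix}0&-1\\1&0\end{pmatrix}$, $U=ST$, and $G_p=\langle S,T\rangle/\{\pm I\}$, acting on the Riemann sphere by linear fractional transformations. In $G_p$ one has $T^2=U^p=I$. An element $\begin{pmatrix}a&b\\c&d\end{pmatrix}\in G_p$ is hyperbolic if $|a+d|>2$; a hyperbolic fixed point of $G_p$ is a fixed point of a hyperbolic element of $G_p$. Rational period functions. For $M=\begin{pmatrix}*&*\\c&d\end{pmatrix}\in \mathrm{SL}(2,\mathbb{R})$, $(f\mid M)(z)=(cz+d)^{-2k}f(Mz)$. For $k\in\mathbb{Z}^+$, a rational period function (RPF) of weight $2k$ on $G_p$ is a rational function $q$ with $q+q\mid T=0$ and $q+q\mid U+q\mid U^2+\dots+q\mid U^{p-1}=0$. $P(q)\subset\mathbb{C}$ is its set of poles and $P^*(q)=P(q)\setminus\{0\}$. Irreducible systems of poles. For $\alpha\in P^*(q)$, $P(q;\alpha)$ (the irreducible system of poles, or irreducible pole set, containing $\alpha$) is the minimal set of poles containing $\alpha$ that are forced to occur together by the two defining relations; precisely, it is the smallest subset $R\subseteq P(q)$ with $\alpha\in R$ such that $\beta\in R$ implies $T\beta\in R$, and such that $\beta\in R$, $1\le j\le p-1$, $U^j\beta\in P(q)$ imply $U^j\beta\in R$. Binary quadratic forms. A $\lambda_p$-BQF is a form $Q=[A,B,C]$, $Q(x,y)=Ax^2+Bxy+Cy^2$,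 with $A,B,C\in\mathbb{Z}[\lambda_p]$ and discriminant $D=B^2-4AC>0$; if $\mathbb{Z}[\lambda_p]$ is a PID it is also required to be primitive, i.e. $A,B,C$ generate the unit ideal. To a hyperbolic fixed point $\alpha$ of $G_p$ a form $Q_\alpha$ is attached as follows. Let $M_\alpha=\begin{pmatrix}a&b\\c&d\end{pmatrix}$ be a generator of the (cyclic) stabilizer of $\alpha$ in $G_p$. If $\mathbb{Z}[\lambda_p]$ is a PID, let $g>0$ be the positive generator of the ideal generated by $c,d-a,-b$ (for each nonzero ideal one positive generator is fixed once and for all); otherwise let $g=1$. Then $Q_\alpha=\frac1g[c,d-a,-b]$ if $\alpha=\frac{a-d+\sqrt{(a+d)^2-4}}{2c}$, and $Q_\alpha=-\frac1g[c,d-a,-b]$ if $\alpha=\frac{a-d-\sqrt{(a+d)^2-4}}{2c}$. Thus $\alpha=\frac{-B+\sqrt D}{2A}$ when $Q_\alpha=[A,B,C]$. The forms $Q_\alpha$ are called hyperbolic. The Hecke ($\lambda_p$-)conjugate of $\alpha$ is $\alpha'=\frac{-B-\sqrt D}{2A}$, and $Q_{\alpha'}=-Q_\alpha$. A set $R$ of hyperbolic fixed points is Hecke ($\lambda_p$-)symmetric if $R=R'$, where $R'=\{x':x\in R\}$. (Nonzero poles of RPFs on $G_p$ are hyperbolic fixed points of $G_p$, so this notion applies to $P(q;\alpha)$.) Equivalence. $M=\begin{pmatrix}a&b\\c&d\end{pmatrix}\in G_p$ acts by $(Q\circ M)(x,y)=Q(ax+by,cx+dy)$; forms $Q_1,Q_2$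 are $G_p$-equivalent if $Q_2=Q_1\circ V$ for some $V\in G_p$. A $G_p$-equivalence class consists either entirely of hyperbolic forms (a hyperbolic class) or contains none. For a class $\mathcal{A}$, $-\mathcal{A}=\{-Q:Q\in\mathcal{A}\}$. A hyperbolic form $[A,B,C]$ is simple if $A>0>C$. For a hyperbolic class $\mathcal{A}$, $Z_{\mathcal{A}}=\{x: Q_x\in\mathcal{A},\ Q_x\text{ simple}\}$, a finite nonempty set of positive numbers. *)

theory Defs
  imports
    "HOL-Complex_Analysis.Complex_Analysis"
    "HOL-Algebra.Generated_Groups"
    "HOL-Algebra.Ring_Divisibility"
begin

definition SL2R :: "(real^2^2) monoid" where
  "SL2R = \<lparr>carrier = {M. det M = 1}, mult = (**), one = mat 1\<rparr>"

definition hecke_lambda :: "nat \<Rightarrow> real" where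
  "hecke_lambda p = 2 * cos (pi / real p)"

definition hecke_S :: "nat \<Rightarrow> real^2^2" where
  "hecke_S p = vector [vector [1, hecke_lambda p], vector [0, 1]]"

definition hecke_T :: "real^2^2" where
  "hecke_T = vector [vector [0, -1], vector [1, 0]]"

definition hecke_U :: "nat \<Rightarrow> real^2^2" where
  "hecke_U p = hecke_S p ** hecke_T"

text \<open>
  The group \<open>G\<^sub>p\<close> is represented by its preimage in \<open>SL(2,\<real>)\<close>: an element of \<open>G\<^sub>p\<close> is a pair
  of matrices \<open>M\<close>, \<open>-M\<close> of this set. It contains \<open>-I\<close>, the square of \<open>hecke_T\<close>.
  All notions below are invariant under a change of sign of \<open>M\<close>.
\<close>

definition hecke_group :: "nat \<Rightarrow> (real^2^2) set" where
  "hecke_group p = generate SL2R {hecke_S p, hecke_T}"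

text \<open>
  On the Riemann sphere, \<open>M z = \<infinity>\<close> for a point \<open>z\<close> of the plane exactly when \<open>lft_denom M z = 0\<close>;
  there the value of \<open>lft M z\<close> is meaningless, and where it matters this case is excluded.
\<close>

definition lft_denom :: "real^2^2 \<Rightarrow> complex \<Rightarrow> complex" where
  "lft_denom M z = of_real (M$2$1) * z + of_real (M$2$2)"

definition lft :: "real^2^2 \<Rightarrow> complex \<Rightarrow> complex" where
  "lft M = moebius (of_real (M$1$1)) (of_real (M$1$2)) (of_real (M$2$1)) (of_real (M$2$2))"

definition lft_fixes :: "real^2^2 \<Rightarrow> complex \<Rightarrow> bool" where
  "lft_fixes M \<alpha> \<longleftrightarrow> lft_denom M \<alpha> \<noteq> 0 \<and> lft M \<alpha> = \<alpha>"

definition hyperbolic_matrix :: "real^2^2 \<Rightarrow> bool" where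
  "hyperbolic_matrix M \<longleftrightarrow> \<bar>trace M\<bar> > 2"

text \<open>
  The point \<open>\<infinity>\<close> is fixed by the parabolic element \<open>S\<close> of the discrete group \<open>G\<^sub>p\<close>, so it is
  not a hyperbolic fixed point, and only points of the plane are considered.
\<close>

definition hyperbolic_fixed_points :: "nat \<Rightarrow> complex set" where
  "hyperbolic_fixed_points p =
     {\<alpha>. \<exists>M \<in> hecke_group p. hyperbolic_matrix M \<and> lft_fixes M \<alpha>}"

text \<open>
  A rational function is represented by a function on the plane that agrees with a quotient of
  polynomials away from the zeros of the denominator. Its values at finitely many points are
  irrelevant, so identities between rational functions are stated for all but finitely many points.
\<close>

definition rational_function :: "(complex \<Rightarrow> complex) \<Rightarrow> bool" where
  "rational_function f \<longleftrightarrow>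
     (\<exists>P Q. Q \<noteq> 0 \<and> (\<forall>z. poly Q z \<noteq> 0 \<longrightarrow> f z = poly P z / poly Q z))"

definition slash :: "nat \<Rightarrow> (complex \<Rightarrow> complex) \<Rightarrow> real^2^2 \<Rightarrow> complex \<Rightarrow> complex" where
  "slash k f M z = lft_denom M z powi (- (2 * int k)) * f (lft M z)"

definition rational_period_function :: "nat \<Rightarrow> nat \<Rightarrow> (complex \<Rightarrow> complex) \<Rightarrow> bool" where
  "rational_period_function p k q \<longleftrightarrow>
     k > 0 \<and> rational_function q \<and>
     (\<forall>\<^sub>F z in cofinite. q z + slash k q hecke_T z = 0) \<and>
     (\<forall>\<^sub>F z in cofinite. q z + (\<Sum>j=1..p-1. slash k q (hecke_U p [^]\<^bsub>SL2R\<^esub> j) z) = 0)"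

definition poles :: "(complex \<Rightarrow> complex) \<Rightarrow> complex set" where
  "poles q = {z. is_pole q z}"

text \<open>
  The poles are points of the plane, so closure under \<open>T\<close> entails \<open>T \<beta> \<noteq> \<infinity>\<close>, and the condition
  \<open>U\<^sup>j \<beta> \<in> P(q)\<close> entails \<open>U\<^sup>j \<beta> \<noteq> \<infinity>\<close>.
\<close>

definition forced_pole_set :: "nat \<Rightarrow> (complex \<Rightarrow> complex) \<Rightarrow> complex set \<Rightarrow> bool" where
  "forced_pole_set p q R \<longleftrightarrow>
     R \<subseteq> poles q \<and>
     (\<forall>\<beta>\<in>R. lft_denom hecke_T \<beta> \<noteq> 0 \<and> lft hecke_T \<beta> \<in> R) \<and>
     (\<forall>\<beta>\<in>R. \<forall>j\<in>{1..p-1}.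
        lft_denom (hecke_U p [^]\<^bsub>SL2R\<^esub> j) \<beta> \<noteq> 0 \<and> lft (hecke_U p [^]\<^bsub>SL2R\<^esub> j) \<beta> \<in> poles q
          \<longrightarrow> lft (hecke_U p [^]\<^bsub>SL2R\<^esub> j) \<beta> \<in> R)"

definition irreducible_poles :: "nat \<Rightarrow> (complex \<Rightarrow> complex) \<Rightarrow> complex \<Rightarrow> complex set" where
  "irreducible_poles p q \<alpha> = \<Inter>{R. forced_pole_set p q R \<and> \<alpha> \<in> R}"

definition Z_lambda :: "nat \<Rightarrow> real ring" where
  "Z_lambda p = \<lparr>carrier = range (\<lambda>P::int poly. poly (map_poly of_int P) (hecke_lambda p)),
                 mult = (*), one = 1, zero = 0, add = (+)\<rparr>"

text \<open>The triple \<open>(A, B, C)\<close> stands for the form \<open>[A, B, C] = A x\<^sup>2 + B x y + C y\<^sup>2\<close>.\<close>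

type_synonym bqf = "real \<times> real \<times> real"

fun bqf_eval :: "bqf \<Rightarrow> complex \<Rightarrow> complex \<Rightarrow> complex" where
  "bqf_eval (A, B, C) x y = of_real A * x^2 + of_real B * x * y + of_real C * y^2"

fun bqf_disc :: "bqf \<Rightarrow> real" where
  "bqf_disc (A, B, C) = B^2 - 4 * A * C"

text \<open>\<open>bqf_act Q M\<close> is \<open>Q \<circ> M\<close>; its coefficients result from expanding \<open>Q (a x + b y, c x + d y)\<close>.\<close>

fun bqf_act :: "bqf \<Rightarrow> real^2^2 \<Rightarrow> bqf" where
  "bqf_act (A, B, C) M =
     (let a = M$1$1; b = M$1$2; c = M$2$1; d = M$2$2
      in (A * a^2 + B * a * c + C * c^2,
          2 * A * a * b + B * (a * d + b * c) + 2 * C * c * d,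
          A * b^2 + B * b * d + C * d^2))"

lemma bqf_eval_act:
  "bqf_eval (bqf_act Q M) x y =
     bqf_eval Q (of_real (M$1$1) * x + of_real (M$1$2) * y) (of_real (M$2$1) * x + of_real (M$2$2) * y)"
  by (cases Q) (simp add: Let_def algebra_simps power2_eq_square)

definition lambda_bqfs :: "nat \<Rightarrow> bqf set" where
  "lambda_bqfs p =
     {(A, B, C). {A, B, C} \<subseteq> carrier (Z_lambda p) \<and> bqf_disc (A, B, C) > 0 \<and>
        (principal_domain (Z_lambda p) \<longrightarrow>
           Idl\<^bsub>Z_lambda p\<^esub> {A, B, C} = carrier (Z_lambda p))}"

definition hecke_equiv :: "nat \<Rightarrow> (bqf \<times> bqf) set" where
  "hecke_equiv p =
     {(Q\<^sub>1, Q\<^sub>2). Q\<^sub>1 \<in> lambda_bqfs p \<and> Q\<^sub>2 \<in> lambda_bqfs p \<and> (\<exists>V \<in> hecke_group p. Q\<^sub>2 = bqf_act Q\<^sub>1 V)}"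

definition stabilizer :: "nat \<Rightarrow> complex \<Rightarrow> (real^2^2) set" where
  "stabilizer p \<alpha> = {M \<in> hecke_group p. lft_fixes M \<alpha>}"

text \<open>
  Adjoining \<open>-I\<close> makes this say that \<open>M\<close> generates the stabilizer in \<open>G\<^sub>p\<close>, that is, modulo
  \<open>{I, -I}\<close>. The generator is unique up to sign and inversion; both negate \<open>(c, d - a, -b)\<close> and
  exchange the two cases in the definition of \<open>hyperbolic_form\<close>, which is thus independent of
  the choice of \<open>M\<close>.
\<close>

definition stabilizer_generator :: "nat \<Rightarrow> complex \<Rightarrow> real^2^2 \<Rightarrow> bool" where
  "stabilizer_generator p \<alpha> M \<longleftrightarrow> generate SL2R {M, - mat 1} = stabilizer p \<alpha>"

text \<open>The generator of each nonzero ideal is fixed by an arbitrary choice.\<close>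

definition positive_generator :: "nat \<Rightarrow> real set \<Rightarrow> real" where
  "positive_generator p I =
     (SOME g. g \<in> carrier (Z_lambda p) \<and> g > 0 \<and> PIdl\<^bsub>Z_lambda p\<^esub> g = I)"

definition hyperbolic_form :: "nat \<Rightarrow> complex \<Rightarrow> bqf" where
  "hyperbolic_form p \<alpha> =
     (let M = (SOME M. stabilizer_generator p \<alpha> M);
          a = M$1$1; b = M$1$2; c = M$2$1; d = M$2$2;
          g = (if principal_domain (Z_lambda p)
               then positive_generator p (Idl\<^bsub>Z_lambda p\<^esub> {c, d - a, - b}) else 1);
          Q = (1 / g) *\<^sub>R (c, d - a, - b)
      in if \<alpha> = of_real ((a - d + sqrt ((a + d)^2 - 4)) / (2 * c)) then Q else - Q)"

definition hyperbolic_forms :: "nat \<Rightarrow> bqf set" where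
  "hyperbolic_forms p = hyperbolic_form p ` hyperbolic_fixed_points p"

definition hecke_conjugate :: "nat \<Rightarrow> complex \<Rightarrow> complex" where
  "hecke_conjugate p \<alpha> =
     (case hyperbolic_form p \<alpha> of (A, B, C) \<Rightarrow>
        of_real ((- B - sqrt (bqf_disc (A, B, C))) / (2 * A)))"

text \<open>
  The conjugate of \<open>\<alpha>\<close> is only meaningful if \<open>\<alpha>\<close> is a hyperbolic fixed point, hence symmetry is a
  notion for sets of such points. Nonzero poles of rational period functions always are of this kind.
\<close>

definition hecke_symmetric :: "nat \<Rightarrow> complex set \<Rightarrow> bool" where
  "hecke_symmetric p R \<longleftrightarrow>
     R \<subseteq> hyperbolic_fixed_points p \<and> R = hecke_conjugate p ` R"

definition hyperbolic_classes :: "nat \<Rightarrow> bqf set set" where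
  "hyperbolic_classes p = {\<A> \<in> lambda_bqfs p // hecke_equiv p. \<A> \<subseteq> hyperbolic_forms p}"

fun simple_form :: "bqf \<Rightarrow> bool" where
  "simple_form (A, B, C) \<longleftrightarrow> A > 0 \<and> C < 0"

definition Z_set :: "nat \<Rightarrow> bqf set \<Rightarrow> complex set" where
  "Z_set p \<A> =
     {x \<in> hyperbolic_fixed_points p. hyperbolic_form p x \<in> \<A> \<and> simple_form (hyperbolic_form p x)}"

definition is_q_k0 :: "nat \<Rightarrow> (complex \<Rightarrow> complex) \<Rightarrow> bool" where
  "is_q_k0 k f \<longleftrightarrow>
     (\<exists>a\<^sub>0 b\<^sub>1. \<forall>z. f z =
        (if 2 * k \<noteq> 2 then a\<^sub>0 * (1 - z powi (- (2 * int k)))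
         else a\<^sub>0 * (1 - z powi (- 2)) + b\<^sub>1 * z powi (- 1)))"

definition explicit_form :: "nat \<Rightarrow> nat \<Rightarrow> (complex \<Rightarrow> complex) \<Rightarrow> bool" where
  "explicit_form p k q \<longleftrightarrow>
     (\<exists>(L::nat) (\<A> :: nat \<Rightarrow> bqf set) (d :: nat \<Rightarrow> complex) (c\<^sub>0 :: complex) q\<^sub>0.
        (\<forall>l\<in>{1..L}. \<A> l \<in> hyperbolic_classes p \<and> uminus ` \<A> l = \<A> l) \<and>
        is_q_k0 k q\<^sub>0 \<and>
        (\<forall>\<^sub>F z in cofinite.
           q z = (\<Sum>l=1..L. d l * (\<Sum>\<alpha>\<in>Z_set p (\<A> l).
                    bqf_eval (hyperbolic_form p \<alpha>) z 1 powi (- int k))) + c\<^sub>0 * q\<^sub>0 z))"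

end

theory Submission
  imports Defs
begin

text \<open>
  Put \<open>V j = - U\<^sup>j T\<close> for \<open>1 \<le> j < p\<close>. The entries of \<open>V j\<close> are quotients
  \<open>s i = sin (i \<pi> / p) / sin (\<pi> / p)\<close>, each 0 or at least 1, and every element of the group is, up to sign,
  \<open>W\<close>, \<open>T W\<close>, \<open>W T\<close> or \<open>T W T\<close> for a product \<open>W\<close> of matrices \<open>V j\<close>. Hence matrix entries are
  discrete, stabilizers of hyperbolic fixed points are cyclic modulo sign, and the form of \<open>x\<close> is a
  positive or negative multiple of \<open>(z - x) (z - x')\<close>, simple iff \<open>x' < 0 < x\<close>. The factorization
  also shows that the simple points of one class are connected by steps \<open>x \<mapsto> V j x\<close> between simple points.

  Each orbit of \<open>U\<close> on hyperbolic fixed points contains exactly one negative point. For (b) this makes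
  the sum over \<open>j\<close> of \<open>F | U\<^sup>j\<close>, with \<open>F\<close> the sum over a symmetric class, run over a set closed under
  conjugation, where terms cancel as \<open>k\<close> is odd. For (a) let \<open>g\<close> be a positive pole of \<open>q\<close>. Since
  \<open>T g\<close> is the only negative point of its \<open>U\<close>-orbit, the second relation forces another pole \<open>V j g\<close>;
  the map \<open>g \<mapsto> V j g\<close> is injective, hence a permutation of the finite set of positive poles, and
  \<open>q | V j - q\<close> is regular at \<open>g\<close>. Going around a cycle, \<open>g\<close> is fixed by a nonnegative hyperbolic matrix
  \<open>W\<close> with \<open>q | W - q\<close> regular at \<open>g\<close>. So \<open>g\<close> is simple, comparing leading terms shows that the pole has
  order \<open>k\<close>, and \<open>q\<close> minus a multiple of \<open>Q\<^sub>g(z,1)\<^sup>-\<^sup>k\<close> is regular at \<open>g\<close>. The multiple is constant on the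
  simple points of a class by connectedness. What remains is a rational period function whose only pole
  is 0; the relations, expanded at 0, leave only the functions \<open>q\<^sub>k\<^sub>,\<^sub>0\<close>.
\<close>

text \<open>Positivity drives the analysis. A negative pole is the image under \<open>T\<close> of a
  positive one, and the second relation, slashed by \<open>T\<close>, becomes a relation between the
  \<open>q | V j\<close> with \<open>V 0 = - T\<close>. Since the \<open>V j\<close> have
  nonnegative entries, poles can be followed inside the positive axis. The obstacle is that
  \<open>hyperbolic_form\<close> rests on an arbitrary choice of a stabilizer generator. It is met
  by the homomorphism sending M to c x + d, from the stabilizer of a hyperbolic fixed point x to the
  nonzero reals. Discreteness of the entries makes its kernel trivial and keeps its absolute values
  away from 1. So the stabilizer is commutative, its hyperbolic elements share the second fixed
  point x', and a generator is a hyperbolic element of least absolute trace, a property visibly kept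
  by conjugation. This makes the form equivariant in x. The symmetry hypothesis of (a) enters twice:
  it makes the nonzero poles real hyperbolic fixed points, and it puts the conjugate of a pole into
  the class of that pole, so that the class equals its negative.\<close>

no_notation fps_nth (infixl "$" 75)

subsection \<open>The Hecke group\<close>

text \<open>The determinant written out in the entries, so that rewriting can expand it;
  \<open>det2_det\<close> links it to \<open>det\<close>.\<close>

definition det2 :: "real^2^2 \<Rightarrow> real" where
  "det2 M = M$1$1 * M$2$2 - M$1$2 * M$2$1"

definition mtx :: "real \<Rightarrow> real \<Rightarrow> real \<Rightarrow> real \<Rightarrow> real^2^2" where
  "mtx a b c d = vector [vector [a, b], vector [c, d]]"

text \<open>The adjugate. It is the inverse for determinant 1, and identities with inverses stay
  polynomial in the entries.\<close>

definition madj :: "real^2^2 \<Rightarrow> real^2^2" where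
  "madj M = mtx (M$2$2) (- (M$1$2)) (- (M$2$1)) (M$1$1)"

lemma mtx_entries [simp]:
  "mtx a b c d $1$1 = a" "mtx a b c d $1$2 = b" "mtx a b c d $2$1 = c" "mtx a b c d $2$2 = d"
  by (simp_all add: mtx_def vector_2)

lemma mtx_eqI:
  fixes M N :: "real^2^2"
  assumes "M$1$1 = N$1$1" "M$1$2 = N$1$2" "M$2$1 = N$2$1" "M$2$2 = N$2$2"
  shows "M = N"
  using assms by (simp add: vec_eq_iff forall_2)

lemma mult_entries [simp]:
  fixes M N :: "real^2^2"
  shows "(M ** N)$1$1 = M$1$1 * N$1$1 + M$1$2 * N$2$1" "(M ** N)$1$2 = M$1$1 * N$1$2 + M$1$2 * N$2$2"
    "(M ** N)$2$1 = M$2$1 * N$1$1 + M$2$2 * N$2$1" "(M ** N)$2$2 = M$2$1 * N$1$2 + M$2$2 * N$2$2"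
  by (simp_all add: matrix_matrix_mult_def sum_2)

lemma one_entries [simp]:
  "(mat 1 :: real^2^2)$1$1 = 1" "(mat 1 :: real^2^2)$1$2 = 0"
  "(mat 1 :: real^2^2)$2$1 = 0" "(mat 1 :: real^2^2)$2$2 = 1"
  by (simp_all add: mat_def)

lemma det2_det: "det (M :: real^2^2) = det2 M"
  by (simp add: det_2 det2_def)

lemma det2_mult: "det2 (M ** N) = det2 M * det2 N"
  by (simp add: det2_det [symmetric] det_mul)

lemma trace_entries: "trace (M :: real^2^2) = M$1$1 + M$2$2"
  by (simp add: trace_def sum_2)

lemma madj_entries [simp]:
  "madj M$1$1 = M$2$2" "madj M$1$2 = - (M$1$2)" "madj M$2$1 = - (M$2$1)" "madj M$2$2 = M$1$1"
  by (simp_all add: madj_def)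

lemma madj_mult:
  assumes "det2 M = 1" shows "madj M ** M = mat 1" "M ** madj M = mat 1"
  using assms by (auto intro!: mtx_eqI simp: det2_def algebra_simps)

lemma det2_madj [simp]: "det2 (madj M) = det2 M"
  by (simp add: det2_def algebra_simps)

lemma madj_madj [simp]: "madj (madj M) = M"
  by (rule mtx_eqI) simp_all

lemma neg_mult [simp]:
  fixes M N :: "real^2^2"
  shows "(- M) ** N = - (M ** N)" "M ** (- N) = - (M ** N)"
  by (auto intro!: mtx_eqI)

lemma det2_neg [simp]: "det2 (- M) = det2 M"
  by (simp add: det2_def)

lemma SL2R_simps [simp]: "x \<otimes>\<^bsub>SL2R\<^esub> y = x ** y" "\<one>\<^bsub>SL2R\<^esub> = mat 1" "x \<in> carrier SL2R \<longleftrightarrow> det2 x = 1"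
  by (simp_all add: SL2R_def det2_det)

lemma det2_one [simp]: "det2 (mat 1) = 1"
  by (simp add: det2_def)

lemma group_SL2R: "group SL2R"
  by (rule groupI)
     (auto simp: det2_mult matrix_mul_assoc intro!: bexI[where x="madj x" for x] madj_mult)

interpretation SL2R: group SL2R
  by (rule group_SL2R)

lemma inv_SL2R:
  assumes "det2 M = 1" shows "inv\<^bsub>SL2R\<^esub> M = madj M"
  using SL2R.inv_equality[of "madj M" M] assms madj_mult[of M] by simp

locale hecke =
  fixes p :: nat
  assumes p3: "3 \<le> p"
begin

section \<open>Sine quotients and the powers of U\<close>

definition \<theta> :: real where "\<theta> = pi / real p"

text \<open>Values of Chebyshev polynomials of the second kind: \<open>s j\<close> is the one of
  index j - 1 at cos \<theta>. They are the entries of the powers of \<open>U\<close>.\<close>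

definition s :: "int \<Rightarrow> real" where "s j = sin (of_int j * \<theta>) / sin \<theta>"

lemma theta: "0 < \<theta>" "\<theta> \<le> pi / 3" "real p * \<theta> = pi"
  using p3 by (auto simp: \<theta>_def field_simps)

lemma sin_theta: "sin \<theta> > 0"
proof -
  have "\<theta> < pi" using theta pi_gt_zero by linarith
  then show ?thesis using theta(1) sin_gt_zero by blast
qed

lemma s_simps [simp]: "s 0 = 0" "s 1 = 1" "s (-1) = -1" "s (- j) = - s j" "s (int p) = 0"
  using sin_theta theta by (auto simp: s_def)

text \<open>The lower left entry of the product rule for powers of \<open>U\<close>; the other three
  entries are shifts of it.\<close>

lemma s_add: "s (i + j) = s i * s (j + 1) - s (i - 1) * s j"
proof -
  define a where "a = of_int i * \<theta>"
  define b where "b = of_int j * \<theta>"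
  have "sin (a + b) * sin \<theta> = sin a * sin (b + \<theta>) - sin (a - \<theta>) * sin b"
    by (simp add: sin_add sin_diff algebra_simps)
  then have "sin (a + b) / sin \<theta> = (sin a / sin \<theta>) * (sin (b + \<theta>) / sin \<theta>) - (sin (a - \<theta>) / sin \<theta>) * (sin b / sin \<theta>)"
    using sin_theta by (simp add: field_simps power2_eq_square)
  then show ?thesis by (simp add: s_def a_def b_def algebra_simps)
qed

lemma s_add_p [simp]: "s (j + int p) = - s j"
  by (simp add: s_def distrib_right theta(3) sin_add)

lemma s_diff_p: "s (int p - j) = s j"
  by (simp add: s_def left_diff_distrib theta(3))

lemma s_two: "s 2 = hecke_lambda p"
  using sin_theta by (simp add: s_def hecke_lambda_def sin_double flip: \<theta>_def)

text \<open>Sine increases up to \<pi>/2, which settles 2 j \<le> p; the reflection of j to p - j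
  covers the rest. All discreteness below comes from this bound.\<close>

lemma s_ge_one:
  assumes "1 \<le> j" "j < int p" shows "s j \<ge> 1"
proof -
  have *: "sin (of_int j * \<theta>) \<ge> sin \<theta>" if "1 \<le> j" "2 * j \<le> int p" for j :: int
  proof (rule sin_monotone_2pi_le)
    show "of_int j * \<theta> \<le> pi / 2"
    proof -
      have "real_of_int (2 * j) \<le> real p" using that(2) by linarith
      then have "real_of_int (2 * j) * \<theta> \<le> real p * \<theta>" using theta by (intro mult_right_mono) auto
      then show ?thesis using theta by simp
    qed
    have "1 * \<theta> \<le> of_int j * \<theta>" using that theta by (intro mult_right_mono) auto
    then show "\<theta> \<le> of_int j * \<theta>" by simp
    show "- (pi / 2) \<le> \<theta>" using theta pi_gt_zero by linarith
  qed
  have "sin (of_int j * \<theta>) \<ge> sin \<theta>"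
  proof (cases "2 * j \<le> int p")
    case True then show ?thesis using * assms by blast
  next
    case False
    have "sin (of_int (int p - j) * \<theta>) \<ge> sin \<theta>" using * [of "int p - j"] False assms by auto
    then show ?thesis by (simp add: left_diff_distrib theta(3))
  qed
  then show ?thesis using sin_theta by (simp add: s_def)
qed

lemma s_nonneg: "0 \<le> j \<Longrightarrow> j \<le> int p \<Longrightarrow> 0 \<le> s j"
proof -
  assume "0 \<le> j" "j \<le> int p"
  then consider "j = 0" | "j = int p" | "1 \<le> j" "j < int p" by linarith
  then show ?thesis using s_ge_one[of j] by cases auto
qed

text \<open>The addition rule for j and -(j + 1); it is the determinant of
  \<open>Um j\<close>.\<close>

lemma s_det: "s j * s j - s (j - 1) * s (j + 1) = 1"
proof -
  have "s (-1) = s j * s (- j) - s (j - 1) * s (- (j + 1))" using s_add[of j "- (j + 1)"] by simp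
  then show ?thesis unfolding s_simps by simp
qed

text \<open>Closed form of the j-th power of \<open>U\<close>, for negative j too; see
  \<open>hecke_U_power\<close> and \<open>madj_Um\<close>.\<close>

definition Um :: "int \<Rightarrow> real^2^2" where "Um j = mtx (s (j + 1)) (- s j) (s j) (- s (j - 1))"
text \<open>The sign in front of \<open>Um j ** Tm\<close> makes the entries nonnegative for 1 \<le>
  j < p. The extreme letters are parabolic: \<open>V 1\<close> is \<open>S\<close>, and
  \<open>V (int p - 1)\<close> is its transpose. \<open>V 0\<close> is \<open>- Tm\<close>.\<close>

definition V :: "int \<Rightarrow> real^2^2" where "V j = mtx (s j) (s (j + 1)) (s (j - 1)) (s j)"
definition Tm :: "real^2^2" where "Tm = mtx 0 (-1) 1 0"

abbreviation G :: "(real^2^2) set" where "G \<equiv> hecke_group p"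

lemma Um_entries [simp]: "Um j$1$1 = s (j + 1)" "Um j$1$2 = - s j" "Um j$2$1 = s j" "Um j$2$2 = - s (j - 1)"
  by (simp_all add: Um_def)

lemma V_entries [simp]: "V j$1$1 = s j" "V j$1$2 = s (j + 1)" "V j$2$1 = s (j - 1)" "V j$2$2 = s j"
  by (simp_all add: V_def)

lemma Tm_entries [simp]: "Tm$1$1 = 0" "Tm$1$2 = -1" "Tm$2$1 = 1" "Tm$2$2 = 0"
  by (simp_all add: Tm_def)

lemma hecke_T_eq: "hecke_T = Tm"
  by (simp add: hecke_T_def Tm_def mtx_def)

lemma hecke_S_eq: "hecke_S p = V 1"
  by (simp add: hecke_S_def V_def mtx_def s_two)

lemma Um_add: "Um i ** Um j = Um (i + j)"
proof (rule mtx_eqI)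
  have e: "s (i + j) = s i * s (j + 1) - s (i - 1) * s j" by (rule s_add)
  show "(Um i ** Um j)$2$1 = Um (i + j)$2$1" using e by simp
  show "(Um i ** Um j)$1$1 = Um (i + j)$1$1" using s_add[of "i + 1" j] by (simp add: algebra_simps)
  show "(Um i ** Um j)$1$2 = Um (i + j)$1$2" using s_add[of "i + 1" "j - 1"] by (simp add: algebra_simps)
  show "(Um i ** Um j)$2$2 = Um (i + j)$2$2" using s_add[of "i" "j - 1"] by (simp add: algebra_simps)
qed

lemma Um_0 [simp]: "Um 0 = mat 1"
  by (rule mtx_eqI) auto

lemma Um_p [simp]: "Um (int p) = - mat 1"
  using s_add_p[of 1] s_add_p[of "-1"] by (intro mtx_eqI) (auto simp: add.commute)

lemma Um_add_p: "Um (j + int p) = - Um j"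
  by (simp flip: Um_add)

lemma Tm_sq [simp]: "Tm ** Tm = - mat 1"
  by (rule mtx_eqI) auto

lemma V_Um: "V j = - (Um j ** Tm)" "Um j = V j ** Tm"
  by (auto intro!: mtx_eqI)

lemma hecke_U_eq: "hecke_U p = Um 1"
  by (simp add: hecke_U_def hecke_S_eq hecke_T_eq V_Um(2))

lemma hecke_U_power: "hecke_U p [^]\<^bsub>SL2R\<^esub> (j::nat) = Um (int j)"
  by (induction j) (simp_all add: hecke_U_eq Um_add add.commute)

lemma det2_Um [simp]: "det2 (Um j) = 1"
  using s_det[of j] by (simp add: det2_def algebra_simps)

lemma det2_V [simp]: "det2 (V j) = 1"
  using s_det[of j] by (simp add: det2_def algebra_simps)

lemma det2_Tm [simp]: "det2 Tm = 1"
  by (simp add: det2_def)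

lemma madj_Um: "madj (Um j) = Um (- j)"
  using s_simps(4)[of "j - 1"] s_simps(4)[of "j + 1"] by (intro mtx_eqI) simp_all

lemma madj_Tm [simp]: "madj Tm = - Tm"
  by (rule mtx_eqI) auto

lemma subgroup_G: "subgroup G SL2R"
  unfolding hecke_group_def
  by (rule SL2R.generate_is_subgroup) (auto simp: hecke_S_eq hecke_T_eq)

lemma G_det [simp]: "M \<in> G \<Longrightarrow> det2 M = 1"
  using subgroup.mem_carrier[OF subgroup_G] by simp

lemma G_one [simp, intro]: "mat 1 \<in> G"
  using subgroup.one_closed[OF subgroup_G] by simp

lemma G_mult [simp, intro]: "M \<in> G \<Longrightarrow> N \<in> G \<Longrightarrow> M ** N \<in> G"
  using subgroup.m_closed[OF subgroup_G] by simp

lemma G_madj [simp, intro]: "M \<in> G \<Longrightarrow> madj M \<in> G"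
  using subgroup.m_inv_closed[OF subgroup_G] by (metis G_det inv_SL2R)

lemma G_T [simp, intro]: "Tm \<in> G"
  by (simp add: hecke_group_def generate.incl flip: hecke_T_eq)

lemma G_neg_one: "- mat 1 \<in> G"
  using G_mult[OF G_T G_T] by simp

lemma G_neg [simp, intro]: "M \<in> G \<Longrightarrow> - M \<in> G"
  using G_mult[OF G_neg_one, of M] by simp

lemma G_Um [simp, intro]: "Um j \<in> G"
proof -
  have "Um 1 \<in> G"
  proof -
    have "V 1 \<in> G" by (simp add: hecke_group_def generate.incl flip: hecke_S_eq)
    then show ?thesis using G_mult G_T V_Um(2) by metis
  qed
  then have *: "Um (int n) \<in> G" for n
    by (induction n) (simp_all add: Um_add[symmetric])
  show ?thesis
  proof (cases "j \<ge> 0")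
    case True then show ?thesis using *[of "nat j"] by simp
  next
    case False
    then show ?thesis using G_madj[OF *[of "nat (- j)"]] by (simp add: madj_Um)
  qed
qed

lemma G_V [simp, intro]: "V j \<in> G"
  by (simp add: V_Um(1))

section \<open>Words in the V j and normal forms of group elements\<close>

inductive_set Mon :: "(real^2^2) set" where
  Mon_one: "mat 1 \<in> Mon"
| Mon_step: "W \<in> Mon \<Longrightarrow> 1 \<le> j \<Longrightarrow> j < int p \<Longrightarrow> V j ** W \<in> Mon"

lemma Mon_G [simp, intro]: "W \<in> Mon \<Longrightarrow> W \<in> G"
  by (induction rule: Mon.induct) auto

lemma Mon_V: "1 \<le> j \<Longrightarrow> j < int p \<Longrightarrow> V j \<in> Mon"
  using Mon_step[OF Mon_one] by simp

lemma Mon_mult: "W \<in> Mon \<Longrightarrow> W' \<in> Mon \<Longrightarrow> W ** W' \<in> Mon"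
  by (induction rule: Mon.induct) (auto simp: Mon_step simp flip: matrix_mul_assoc)

text \<open>These numbers are closed under sums and products, hence the matrices with such entries
  are closed under products. The predicate records nonnegativity and discreteness at once.\<close>

definition nn_discrete :: "real \<Rightarrow> bool" where "nn_discrete x \<longleftrightarrow> x = 0 \<or> x \<ge> 1"

lemma nn_discrete_mult: "nn_discrete x \<Longrightarrow> nn_discrete y \<Longrightarrow> nn_discrete (x * y)"
  using mult_mono[of 1 x 1 y] by (auto simp: nn_discrete_def)

lemma nn_discrete_add: "nn_discrete x \<Longrightarrow> nn_discrete y \<Longrightarrow> nn_discrete (x + y)"
  by (auto simp: nn_discrete_def)

lemma nn_discrete_s: "0 \<le> j \<Longrightarrow> j \<le> int p \<Longrightarrow> nn_discrete (s j)"
proof -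
  assume "0 \<le> j" "j \<le> int p"
  then consider "j = 0" | "j = int p" | "1 \<le> j" "j < int p" by linarith
  then show ?thesis using s_ge_one[of j] unfolding nn_discrete_def by cases auto
qed

lemma Mon_entries:
  assumes "W \<in> Mon"
  shows "nn_discrete (W$1$1) \<and> nn_discrete (W$1$2) \<and> nn_discrete (W$2$1) \<and> nn_discrete (W$2$2)"
  using assms
proof (induction rule: Mon.induct)
  case Mon_one then show ?case by (simp add: nn_discrete_def)
next
  case (Mon_step W j)
  then show ?case by (simp add: nn_discrete_add nn_discrete_mult nn_discrete_s)
qed

text \<open>The candidate normal forms up to sign. They are shown to be closed under products and to
  contain the generators with their inverses, so they exhaust the group.\<close>

definition GE :: "(real^2^2) set" where
  "GE = {M. \<exists>W\<in>Mon. M \<in> {W, Tm ** W, W ** Tm, Tm ** W ** Tm} \<or> - M \<in> {W, Tm ** W, W ** Tm, Tm ** W ** Tm}}"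

lemma GE_Mon: "W \<in> Mon \<Longrightarrow> W \<in> GE" "W \<in> Mon \<Longrightarrow> Tm ** W \<in> GE"
  by (auto simp: GE_def)

lemma GE_neg: "M \<in> GE \<Longrightarrow> - M \<in> GE"
  by (force simp: GE_def)

lemma GE_neg_iff: "- M \<in> GE \<longleftrightarrow> M \<in> GE"
  using GE_neg[of M] GE_neg[of "- M"] by auto

lemma T_T_mult [simp]: "Tm ** (Tm ** M) = - M" "M ** Tm ** Tm = - M"
  by (simp add: matrix_mul_assoc, simp flip: matrix_mul_assoc)

lemma GE_T_right: "M \<in> GE \<Longrightarrow> M ** Tm \<in> GE"
proof -
  have 0: "M ** Tm \<in> GE" if "W \<in> Mon" "M \<in> {W, Tm ** W, W ** Tm, Tm ** W ** Tm}" for W M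
    using that by (auto simp: GE_neg_iff GE_Mon) (auto simp: GE_def)
  assume "M \<in> GE"
  then obtain W where "W \<in> Mon" "M \<in> {W, Tm ** W, W ** Tm, Tm ** W ** Tm} \<or> - M \<in> {W, Tm ** W, W ** Tm, Tm ** W ** Tm}"
    unfolding GE_def by blast
  then show ?thesis using 0[of W M] 0[of W "- M"] by (auto simp: GE_neg_iff)
qed

lemma GE_T_left: "M \<in> GE \<Longrightarrow> Tm ** M \<in> GE"
proof -
  have 0: "Tm ** M \<in> GE" if "W \<in> Mon" "M \<in> {W, Tm ** W, W ** Tm, Tm ** W ** Tm}" for W M
    using that GE_T_right[OF GE_Mon(1)[of W]] GE_T_right[OF GE_Mon(2)[of W]]
    by (auto simp: GE_neg_iff GE_Mon matrix_mul_assoc)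
  assume "M \<in> GE"
  then obtain W where "W \<in> Mon" "M \<in> {W, Tm ** W, W ** Tm, Tm ** W ** Tm} \<or> - M \<in> {W, Tm ** W, W ** Tm, Tm ** W ** Tm}"
    unfolding GE_def by blast
  then show ?thesis using 0[of W M] 0[of W "- M"] by (auto simp: GE_neg_iff)
qed

text \<open>A \<open>Tm\<close> between two letters merges them: \<open>V i ** Tm\<close> is
  \<open>Um i\<close>, so the indices add up.\<close>

lemma V_T_V:
  fixes W :: "real^2^2"
  shows "V i ** (Tm ** (V j ** W)) = - (Um (i + j) ** Tm ** W)"
proof -
  have "V i ** (Tm ** (V j ** W)) = (V i ** Tm) ** (V j ** W)" by (simp add: matrix_mul_assoc)
  also have "\<dots> = Um i ** (- (Um j ** Tm) ** W)" by (simp only: V_Um(2)[symmetric] V_Um(1)[symmetric])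
  also have "\<dots> = - (Um i ** ((Um j ** Tm) ** W))" unfolding neg_mult by (rule refl)
  also have "\<dots> = - (Um (i + j) ** Tm ** W)"
    by (simp add: matrix_mul_assoc flip: Um_add)
  finally show ?thesis .
qed

text \<open>The letter i merges with the first letter j of W. For i + j < p this is a letter again,
  for i + j = p the two collapse to \<open>Tm\<close>, and beyond p the rule
  \<open>Um (int p) = - mat 1\<close> reduces the index at the cost of a sign.\<close>

lemma GE_V_T:
  assumes "1 \<le> i" "i < int p" "W \<in> Mon"
  shows "V i ** (Tm ** W) \<in> GE"
  using assms(3)
proof cases
  case Mon_one
  then show ?thesis using GE_T_right[OF GE_Mon(1)[OF Mon_V[OF assms(1,2)]]] by simp
next
  case (Mon_step W' j)
  have e: "V i ** (Tm ** W) = - (Um (i + j) ** Tm ** W')" using V_T_V Mon_step(1) by simp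
  consider "i + j < int p" | "i + j = int p" | "i + j > int p" by linarith
  then show ?thesis
  proof cases
    case 1
    have "V i ** (Tm ** W) = V (i + j) ** W'" unfolding e by (simp add: V_Um(1))
    then show ?thesis using GE_Mon(1) Mon.Mon_step[OF Mon_step(2)] 1 assms Mon_step by auto
  next
    case 2
    then show ?thesis using GE_Mon(2)[OF Mon_step(2)] unfolding e by simp
  next
    case 3
    have "Um (i + j) = - Um (i + j - int p)" using Um_add_p[of "i + j - int p"] by simp
    then have "V i ** (Tm ** W) = - (V (i + j - int p) ** W')" unfolding e by (simp add: V_Um(1))
    then show ?thesis using GE_Mon(1) Mon.Mon_step[OF Mon_step(2)] 3 assms Mon_step by (auto simp: GE_neg_iff)
  qed
qed

lemma GE_V:
  assumes i: "1 \<le> i" "i < int p" and M: "M \<in> GE"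
  shows "V i ** M \<in> GE"
proof -
  have 0: "V i ** M \<in> GE" if W: "W \<in> Mon" "M \<in> {W, Tm ** W, W ** Tm, Tm ** W ** Tm}" for W M
  proof -
    have "V i ** W \<in> GE" "V i ** (Tm ** W) \<in> GE" using GE_Mon(1) Mon_step i W GE_V_T by auto
    then show ?thesis using that GE_T_right by (auto simp: matrix_mul_assoc)
  qed
  obtain W where "W \<in> Mon" "M \<in> {W, Tm ** W, W ** Tm, Tm ** W ** Tm} \<or> - M \<in> {W, Tm ** W, W ** Tm, Tm ** W ** Tm}"
    using M unfolding GE_def by blast
  then show ?thesis using 0[of W M] 0[of W "- M"] by (auto simp: GE_neg_iff)
qed

lemma GE_mult:
  assumes M: "M \<in> GE" and N: "N \<in> GE" shows "M ** N \<in> GE"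
proof -
  have 1: "W ** N \<in> GE" if "W \<in> Mon" "N \<in> GE" for W N
    using that by (induction rule: Mon.induct) (auto simp: GE_V simp flip: matrix_mul_assoc)
  have 0: "M ** N \<in> GE" if "W \<in> Mon" "M \<in> {W, Tm ** W, W ** Tm, Tm ** W ** Tm}" for W M
    using that N by (auto simp: 1 GE_T_left simp flip: matrix_mul_assoc)
  obtain W where "W \<in> Mon" "M \<in> {W, Tm ** W, W ** Tm, Tm ** W ** Tm} \<or> - M \<in> {W, Tm ** W, W ** Tm, Tm ** W ** Tm}"
    using M unfolding GE_def by blast
  then show ?thesis using 0[of W M] 0[of W "- M"] by (auto simp: GE_neg_iff)
qed

lemma GE_one: "mat 1 \<in> GE"
  by (rule GE_Mon) (rule Mon_one)

lemma GE_Tm: "Tm \<in> GE"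
  using GE_T_left[OF GE_one] by simp

text \<open>Supplies the normal form of the inverse of the generator \<open>S\<close>:
  \<open>V (int p - 1)\<close> is the transpose of \<open>S\<close>, and multiplying by
  \<open>Tm\<close> on both sides turns a transpose into an inverse up to sign.\<close>

lemma madj_V1: "madj (V 1) = - (Tm ** V (int p - 1) ** Tm)"
  using s_diff_p[of 1] s_diff_p[of 2] by (intro mtx_eqI) (simp_all add: algebra_simps)

lemma G_cases:
  assumes "M \<in> G"
  obtains W where "W \<in> Mon" "M \<in> {W, Tm ** W, W ** Tm, Tm ** W ** Tm} \<or> - M \<in> {W, Tm ** W, W ** Tm, Tm ** W ** Tm}"
proof -
  have "M \<in> generate SL2R {hecke_S p, hecke_T}" using assms by (simp add: hecke_group_def)
  then have "M \<in> GE"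
  proof (induction rule: generate.induct)
    case one then show ?case using GE_one by simp
  next
    case (incl h)
    then show ?case using GE_Mon(1)[OF Mon_V[of 1]] GE_Tm p3 by (auto simp: hecke_S_eq hecke_T_eq)
  next
    case (inv h)
    then have "h = V 1 \<or> h = Tm" by (auto simp: hecke_S_eq hecke_T_eq)
    then show ?case
      using GE_T_right[OF GE_T_left[OF GE_Mon(1)[OF Mon_V[of "int p - 1"]]]] GE_Tm p3
      by (auto simp: inv_SL2R madj_V1 GE_neg_iff)
  next
    case (eng h1 h2)
    then show ?case using GE_mult by simp
  qed
  then show ?thesis using that unfolding GE_def by blast
qed

text \<open>Multiplication by \<open>Tm\<close> permutes the entries up to sign, so the bound passes
  from \<open>Mon\<close> to the whole group. It serves below as the discreteness of the
  group.\<close>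

lemma G_entries:
  assumes "M \<in> G"
  shows "M$1$1 = 0 \<or> \<bar>M$1$1\<bar> \<ge> 1" "M$1$2 = 0 \<or> \<bar>M$1$2\<bar> \<ge> 1"
    "M$2$1 = 0 \<or> \<bar>M$2$1\<bar> \<ge> 1" "M$2$2 = 0 \<or> \<bar>M$2$2\<bar> \<ge> 1"
proof -
  obtain W where W: "W \<in> Mon" and
    M: "M \<in> {W, Tm ** W, W ** Tm, Tm ** W ** Tm} \<or> - M \<in> {W, Tm ** W, W ** Tm, Tm ** W ** Tm}"
    using G_cases[OF assms] by blast
  define P where "P M = ((M$1$1 = 0 \<or> \<bar>M$1$1\<bar> \<ge> 1) \<and> (M$1$2 = 0 \<or> \<bar>M$1$2\<bar> \<ge> 1) \<and>
    (M$2$1 = 0 \<or> \<bar>M$2$1\<bar> \<ge> 1) \<and> (M$2$2 = 0 \<or> \<bar>M$2$2\<bar> \<ge> 1))" for M :: "real^2^2"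
  have 1: "P W" "P (Tm ** W)" "P (W ** Tm)" "P (Tm ** W ** Tm)"
    using Mon_entries[OF W] unfolding P_def nn_discrete_def by auto
  have 2: "P (- M) \<longleftrightarrow> P M" by (simp add: P_def)
  have "P M \<or> P (- M)" using M 1 by auto
  then have "P M" using 2 by blast
  then show "M$1$1 = 0 \<or> \<bar>M$1$1\<bar> \<ge> 1" "M$1$2 = 0 \<or> \<bar>M$1$2\<bar> \<ge> 1"
    "M$2$1 = 0 \<or> \<bar>M$2$1\<bar> \<ge> 1" "M$2$2 = 0 \<or> \<bar>M$2$2\<bar> \<ge> 1" by (simp_all add: P_def)
qed

end

subsection \<open>Hyperbolic fixed points and their stabilizers\<close>

text \<open>Hyperbolic fixed points turn out to be real, so \<open>lft_denom\<close> and
  \<open>lft\<close> get real counterparts; \<open>lft_denom_real\<close> and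
  \<open>lft_real\<close> translate.\<close>

definition den :: "real^2^2 \<Rightarrow> real \<Rightarrow> real" where
  "den M x = M$2$1 * x + M$2$2"

text \<open>\<open>mv M x\<close> is 0 if \<open>den M x = 0\<close>.\<close>

definition mv :: "real^2^2 \<Rightarrow> real \<Rightarrow> real" where
  "mv M x = (M$1$1 * x + M$1$2) / den M x"

lemma den_mult: "den N x \<noteq> 0 \<Longrightarrow> den (M ** N) x = den M (mv N x) * den N x"
  by (simp add: den_def mv_def field_simps)

lemma mv_mult: "den N x \<noteq> 0 \<Longrightarrow> mv (M ** N) x = mv M (mv N x)"
proof -
  assume n: "den N x \<noteq> 0"
  have "M$1$1 * mv N x + M$1$2 = ((M ** N)$1$1 * x + (M ** N)$1$2) / den N x"
    using n by (simp add: mv_def field_simps) (simp add: den_def algebra_simps)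
  moreover have "mv (M ** N) x = ((M ** N)$1$1 * x + (M ** N)$1$2) / (den M (mv N x) * den N x)"
    by (simp only: mv_def den_mult[OF n])
  ultimately show ?thesis by (simp only: mv_def[of M] divide_divide_eq_left mult.commute)
qed

lemma den_mv_simps [simp]: "den (mat 1) x = 1" "mv (mat 1) x = x" "den (- M) x = - den M x" "mv (- M) x = mv M x"
  by (simp_all add: den_def mv_def divide_simps, auto simp: algebra_simps)

definition rfix :: "real^2^2 \<Rightarrow> real \<Rightarrow> bool" where
  "rfix M x \<longleftrightarrow> den M x \<noteq> 0 \<and> mv M x = x"

lemma rfix_eq: "rfix M x \<Longrightarrow> M$1$1 * x + M$1$2 = x * den M x"
  by (auto simp: rfix_def mv_def divide_eq_eq)

lemma rfixI: "den M x \<noteq> 0 \<Longrightarrow> M$1$1 * x + M$1$2 = x * den M x \<Longrightarrow> rfix M x"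
  by (simp add: rfix_def mv_def field_simps)

lemma rfix_mult: "rfix M x \<Longrightarrow> rfix N x \<Longrightarrow> rfix (M ** N) x" "rfix M x \<Longrightarrow> rfix N x \<Longrightarrow> den (M ** N) x = den M x * den N x"
  by (simp_all add: rfix_def den_mult mv_mult)

text \<open>\<open>den M x\<close> is the eigenvalue of M at the vector (x, 1) and the other factor
  is the second eigenvalue; their product is the determinant. Hence trace and hyperbolicity can be
  read off from \<open>den M x\<close>.\<close>

lemma rfix_conj_den: assumes "rfix M x" "det2 M = 1" shows "(M$1$1 - M$2$1 * x) * den M x = 1"
proof -
  have "(M$1$1 - M$2$1 * x) * den M x = det2 M + M$2$1 * (M$1$1 * x + M$1$2 - x * den M x)"
    by (simp add: den_def det2_def algebra_simps)
  then show ?thesis using assms rfix_eq[OF assms(1)] by simp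
qed

lemma rfix_trace: assumes "rfix M x" "det2 M = 1" shows "trace M = den M x + 1 / den M x"
  using rfix_conj_den[OF assms] assms by (simp add: trace_entries rfix_def field_simps) (simp add: den_def algebra_simps)

lemma rfix_madj: assumes "rfix M x" "det2 M = 1" shows "rfix (madj M) x" "den (madj M) x = 1 / den M x"
proof -
  have e: "den (madj M) x = M$1$1 - M$2$1 * x" by (simp add: den_def)
  then show d: "den (madj M) x = 1 / den M x" using rfix_conj_den[OF assms] unfolding e
    by (metis mult_zero_right nonzero_eq_divide_eq zero_neq_one)
  show "rfix (madj M) x"
  proof (rule rfixI)
    show "den (madj M) x \<noteq> 0" using d assms by (simp add: rfix_def)
    show "madj M$1$1 * x + madj M$1$2 = x * den (madj M) x"
      using rfix_eq[OF assms(1)] unfolding e by (simp add: den_def algebra_simps)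
  qed
qed

lemma rfix_neg [simp]: "rfix (- M) x \<longleftrightarrow> rfix M x"
  by (simp add: rfix_def)

lemma trace_den_gt_two:
  fixes j :: real assumes "j \<noteq> 0" shows "\<bar>j + 1 / j\<bar> = \<bar>j\<bar> + 1 / \<bar>j\<bar>" "\<bar>j + 1 / j\<bar> > 2 \<longleftrightarrow> \<bar>j\<bar> \<noteq> 1"
proof -
  show e: "\<bar>j + 1 / j\<bar> = \<bar>j\<bar> + 1 / \<bar>j\<bar>"
  proof (cases "j > 0")
    case True
    then have "j + 1 / j > 0" by (simp add: add_pos_pos)
    then show ?thesis using True by simp
  next
    case False
    then have "j < 0" "1 / j < 0" using assms by auto
    then have "j + 1 / j < 0" by linarith
    then show ?thesis using \<open>j < 0\<close> by simp
  qed
  have "\<bar>j\<bar> + 1 / \<bar>j\<bar> - 2 = (\<bar>j\<bar> - 1)\<^sup>2 / \<bar>j\<bar>"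
    using assms by (simp add: field_simps power2_eq_square)
  moreover have "(\<bar>j\<bar> - 1)\<^sup>2 / \<bar>j\<bar> > 0 \<longleftrightarrow> \<bar>j\<bar> \<noteq> 1"
    using assms by (simp add: zero_less_divide_iff)
  ultimately show "\<bar>j + 1 / j\<bar> > 2 \<longleftrightarrow> \<bar>j\<bar> \<noteq> 1" unfolding e by linarith
qed

lemma hyperbolic_iff_den:
  assumes "rfix M x" "det2 M = 1" shows "hyperbolic_matrix M \<longleftrightarrow> \<bar>den M x\<bar> \<noteq> 1"
  unfolding hyperbolic_matrix_def rfix_trace[OF assms]
  by (rule trace_den_gt_two(2)) (use assms in \<open>simp add: rfix_def\<close>)

lemma trace_mult_comm: "trace (A ** B) = trace (B ** A)" for A B :: "real^2^2"
  by (simp add: trace_entries)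

lemma hyperbolic_conj:
  assumes "det2 W = 1" shows "trace (W ** M ** madj W) = trace M"
  using trace_mult_comm[of W "M ** madj W"] madj_mult[OF assms]
  by (simp flip: matrix_mul_assoc)

context hecke
begin

text \<open>The diagonal entries have product 1 and, by discreteness, modulus at least 1. In
  consequence hyperbolic elements have both off-diagonal entries nonzero.\<close>

lemma G_upper:
  assumes "M \<in> G" "M$2$1 = 0 \<or> M$1$2 = 0"
  shows "M$1$1 = M$2$2" "\<bar>M$1$1\<bar> = 1" "\<not> hyperbolic_matrix M"
proof -
  have d: "M$1$1 * M$2$2 = 1" using G_det[OF assms(1)] assms(2) by (auto simp: det2_def)
  then have "M$1$1 \<noteq> 0" "M$2$2 \<noteq> 0" by auto
  then have a: "\<bar>M$1$1\<bar> \<ge> 1" "\<bar>M$2$2\<bar> \<ge> 1" using G_entries[OF assms(1)] by auto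
  have d': "\<bar>M$1$1\<bar> * \<bar>M$2$2\<bar> = 1" using d by (simp flip: abs_mult)
  have "\<bar>M$1$1\<bar> * 1 \<le> \<bar>M$1$1\<bar> * \<bar>M$2$2\<bar>" using a by (intro mult_left_mono) auto
  then show "\<bar>M$1$1\<bar> = 1" using a d' by linarith
  then have "M$1$1 = 1 \<or> M$1$1 = -1" by linarith
  then show "M$1$1 = M$2$2" using d by auto
  then show "\<not> hyperbolic_matrix M" using \<open>M$1$1 = 1 \<or> M$1$1 = -1\<close> by (auto simp: hyperbolic_matrix_def trace_entries)
qed

definition rst :: "real \<Rightarrow> (real^2^2) set" where "rst x = {M \<in> G. rfix M x}"

definition HR :: "real set" where "HR = {x. \<exists>M \<in> rst x. hyperbolic_matrix M}"

lemma rst_G: "M \<in> rst x \<Longrightarrow> M \<in> G" and rst_rfix: "M \<in> rst x \<Longrightarrow> rfix M x" and rst_den: "M \<in> rst x \<Longrightarrow> den M x \<noteq> 0"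
  by (auto simp: rst_def rfix_def)

text \<open>The factor \<open>den _ x\<close> is a homomorphism from the stabilizer to the nonzero
  reals. The structure of the stabilizer is derived from its kernel and its image.\<close>

lemma rst_mult: "M \<in> rst x \<Longrightarrow> N \<in> rst x \<Longrightarrow> M ** N \<in> rst x" "M \<in> rst x \<Longrightarrow> N \<in> rst x \<Longrightarrow> den (M ** N) x = den M x * den N x"
  by (auto simp: rst_def rfix_mult)

lemma rst_madj: "M \<in> rst x \<Longrightarrow> madj M \<in> rst x" "M \<in> rst x \<Longrightarrow> den (madj M) x = 1 / den M x"
  by (auto simp: rst_def rfix_madj)

lemma rst_neg [simp]: "M \<in> rst x \<Longrightarrow> - M \<in> rst x"
  by (auto simp: rst_def)

lemma rst_one [simp]: "mat 1 \<in> rst x"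
  by (auto simp: rst_def rfix_def)

lemma rst_hyperbolic: "M \<in> rst x \<Longrightarrow> hyperbolic_matrix M \<longleftrightarrow> \<bar>den M x\<bar> \<noteq> 1"
  by (simp add: rst_def hyperbolic_iff_den)

lemma HR_contracting:
  assumes "x \<in> HR" obtains M where "M \<in> rst x" "\<bar>den M x\<bar> < 1"
proof -
  obtain M where M: "M \<in> rst x" "\<bar>den M x\<bar> \<noteq> 1" using assms rst_hyperbolic by (auto simp: HR_def)
  then consider "\<bar>den M x\<bar> < 1" | "\<bar>den M x\<bar> > 1" by linarith
  then show ?thesis
    by cases (use that M in blast, use that rst_madj M in force)
qed

text \<open>Conjugation by a contracting element of the stabilizer multiplies the lower left entry of a
  unipotent element by a factor less than 1, but the entries of elements of the group are discrete.\<close>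

lemma unipotent_trivial:
  assumes x: "x \<in> HR" and M: "M \<in> rst x" and d: "den M x = 1"
  shows "M = mat 1"
proof -
  obtain M0 where M0: "M0 \<in> rst x" "\<bar>den M0 x\<bar> < 1" using HR_contracting[OF x] .
  define r where "r = 1 / (den M0 x)\<^sup>2"
  have r1: "r > 1" using M0 rst_den[OF M0(1)] by (simp add: r_def abs_square_less_1)
  \<comment> \<open>Once the factor is 1, fixing x leaves only the lower left entry free, so it
    suffices to show that this entry vanishes.\<close>
  have e: "N = mtx (1 + N$2$1 * x) (- N$2$1 * x\<^sup>2) (N$2$1) (1 - N$2$1 * x)" if "N \<in> rst x" "den N x = 1" for N
  proof -
    have 1: "N$2$2 = 1 - N$2$1 * x" using that(2) by (simp add: den_def)
    have 2: "N$1$1 = 1 + N$2$1 * x"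
      using rfix_conj_den[OF rst_rfix[OF that(1)]] rst_G[OF that(1)] that(2) by simp
    have 3: "N$1$2 = - N$2$1 * x\<^sup>2"
      using rfix_eq[OF rst_rfix[OF that(1)]] that(2) 2 by (simp add: algebra_simps power2_eq_square)
    show ?thesis by (rule mtx_eqI) (simp_all add: 1 2 3)
  qed
  have *: "\<bar>N$2$1\<bar> \<ge> r ^ n" if "N \<in> rst x" "den N x = 1" "N$2$1 \<noteq> 0" for n N
    using that
  proof (induction n arbitrary: N)
    case 0 then show ?case using G_entries(3)[OF rst_G[OF 0(1)]] by auto
  next
    case (Suc n)
    define N' where "N' = M0 ** N ** madj M0"
    have n': "N' \<in> rst x" "den N' x = 1"
      using Suc M0 rst_mult rst_madj rst_den[OF M0(1)] by (auto simp: N'_def)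
    have "N'$2$1 = N$2$1 * (den M0 x)\<^sup>2"
      unfolding N'_def by (subst e[OF Suc(2,3)]) (simp add: den_def algebra_simps power2_eq_square)
    then have 1: "\<bar>N'$2$1\<bar> * r = \<bar>N$2$1\<bar>" and "N'$2$1 \<noteq> 0"
      using rst_den[OF M0(1)] Suc(4) by (auto simp: r_def abs_mult)
    have "r ^ n \<le> \<bar>N'$2$1\<bar>" using Suc.IH[OF n' \<open>N'$2$1 \<noteq> 0\<close>] .
    then have "r ^ n * r \<le> \<bar>N'$2$1\<bar> * r" using r1 by (intro mult_right_mono) auto
    then show ?case using 1 by (simp add: mult.commute)
  qed
  have "M$2$1 = 0"
  proof (rule ccontr)
    assume "M$2$1 \<noteq> 0"
    obtain n where "\<bar>M$2$1\<bar> < r ^ n" using real_arch_pow[OF r1] by blast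
    then show False using *[OF M d \<open>M$2$1 \<noteq> 0\<close>, of n] by simp
  qed
  then show ?thesis using e[OF M d] by (auto intro!: mtx_eqI)
qed

lemma rst_abs_den_one:
  assumes "x \<in> HR" "M \<in> rst x" "\<bar>den M x\<bar> = 1"
  shows "M = mat 1 \<or> M = - mat 1"
proof (cases "den M x = 1")
  case True then show ?thesis using unipotent_trivial assms by blast
next
  case False
  then have "den (- M) x = 1" using assms by auto
  then have "- M = mat 1" using unipotent_trivial assms rst_neg by blast
  then show ?thesis by (metis minus_minus)
qed

text \<open>The commutator has factor 1, hence is trivial.\<close>

lemma rst_commute:
  assumes x: "x \<in> HR" and M: "M \<in> rst x" and N: "N \<in> rst x"
  shows "M ** N = N ** M"
proof -
  have "M ** N ** madj M ** madj N = mat 1"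
    by (rule unipotent_trivial[OF x]) (use M N in \<open>simp_all add: rst_mult rst_madj rst_den\<close>)
  then have "(M ** N ** madj M ** madj N) ** N ** M = N ** M" by simp
  then show ?thesis using madj_mult(1)[of M] madj_mult(1)[of N] rst_G M N by (simp flip: matrix_mul_assoc)
qed

text \<open>The second fixed point of a hyperbolic M: the roots of c z^2 + (d - a) z - b have sum (a
  - d) / c. By \<open>cj_rst\<close> the chosen M does not matter, and
  \<open>hecke_conjugate_cj\<close> identifies \<open>cj x\<close> with the Hecke conjugate.\<close>

definition cj :: "real \<Rightarrow> real" where
  "cj x = (let M = (SOME M. M \<in> rst x \<and> hyperbolic_matrix M) in (M$1$1 - M$2$2) / M$2$1 - x)"

text \<open>Comparing entries of M N = N M shows that (c, a - d) of M is proportional to that of the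
  N chosen in \<open>cj\<close>. So the formulas hold for every stabilizer element, including those
  with c = 0.\<close>

lemma cj_rst:
  assumes x: "x \<in> HR" and M: "M \<in> rst x"
  shows "M$2$1 * (x + cj x) = M$1$1 - M$2$2" "M$2$1 * (x * cj x) = - M$1$2"
    "M$2$1 * (x - cj x) = den M x - 1 / den M x"
proof -
  define N where "N = (SOME M. M \<in> rst x \<and> hyperbolic_matrix M)"
  have N: "N \<in> rst x" "hyperbolic_matrix N" using someI_ex[of "\<lambda>M. M \<in> rst x \<and> hyperbolic_matrix M"] x by (auto simp: N_def HR_def)
  have c0: "N$2$1 \<noteq> 0" using G_upper(3)[OF rst_G[OF N(1)]] N(2) by auto
  have cj: "N$2$1 * (x + cj x) = N$1$1 - N$2$2" using c0 by (simp add: cj_def N_def[symmetric])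
  have eq: "(M ** N)$1$1 = (N ** M)$1$1" "(M ** N)$2$1 = (N ** M)$2$1"
    using rst_commute[OF x M N(1)] by simp_all
  have 1: "M$2$1 * (N$1$1 - N$2$2) = N$2$1 * (M$1$1 - M$2$2)" using eq by (simp add: algebra_simps)
  have "N$2$1 * (M$2$1 * (x + cj x)) = M$2$1 * (N$2$1 * (x + cj x))" by simp
  also have "\<dots> = N$2$1 * (M$1$1 - M$2$2)" unfolding cj by (rule 1)
  finally have "N$2$1 * (M$2$1 * (x + cj x)) = N$2$1 * (M$1$1 - M$2$2)" .
  then show a: "M$2$1 * (x + cj x) = M$1$1 - M$2$2" using c0 by simp
  have "M$2$1 * (x * cj x) = (M$2$1 * (x + cj x) - M$2$1 * x) * x" by (simp add: algebra_simps)
  also have "\<dots> = - M$1$2" unfolding a using rfix_eq[OF rst_rfix[OF M]] by (simp add: den_def algebra_simps)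
  finally show "M$2$1 * (x * cj x) = - M$1$2" .
  have "1 / den M x = M$1$1 - M$2$1 * x" using rfix_conj_den[OF rst_rfix[OF M]] rst_G[OF M] rst_den[OF M] by (simp add: field_simps)
  then show "M$2$1 * (x - cj x) = den M x - 1 / den M x" using a by (simp add: den_def algebra_simps)
qed

lemma HR_hyp: assumes "x \<in> HR" obtains M where "M \<in> rst x" "hyperbolic_matrix M" "M$2$1 \<noteq> 0" "M$1$2 \<noteq> 0"
  using assms G_upper(3) rst_G by (auto simp: HR_def)

lemma abs_one_iff_inverse: "\<bar>j\<bar> = 1 \<longleftrightarrow> j - 1 / j = 0" if "j \<noteq> 0" for j :: real
  using that by (auto simp: field_simps abs_if square_eq_1_iff split: if_splits)

lemma cj_neq: assumes x: "x \<in> HR" shows "cj x \<noteq> x"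
proof
  assume e: "cj x = x"
  obtain M where M: "M \<in> rst x" "hyperbolic_matrix M" using HR_hyp[OF x] by metis
  have "den M x - 1 / den M x = 0" using cj_rst(3)[OF x M(1)] e by simp
  then show False using M rst_hyperbolic[OF M(1)] abs_one_iff_inverse[OF rst_den[OF M(1)]] by simp
qed

lemma HR_nonzero: assumes x: "x \<in> HR" shows "x \<noteq> 0" "cj x \<noteq> 0"
proof -
  obtain M where M: "M \<in> rst x" "M$1$2 \<noteq> 0" using HR_hyp[OF x] by metis
  then show "x \<noteq> 0" "cj x \<noteq> 0" using cj_rst(2)[OF x M(1)] by auto
qed

lemma rst_cj: assumes x: "x \<in> HR" and M: "M \<in> rst x" shows "M \<in> rst (cj x)" "den M (cj x) = 1 / den M x"
proof -
  show d: "den M (cj x) = 1 / den M x" using cj_rst(3)[OF x M] by (simp add: den_def algebra_simps)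
  have "M$1$1 * cj x + M$1$2 - cj x * den M (cj x) =
      cj x * ((M$1$1 - M$2$2) - M$2$1 * (x + cj x)) + (M$1$2 + M$2$1 * (x * cj x))"
    by (simp add: den_def algebra_simps)
  then have "M$1$1 * cj x + M$1$2 = cj x * den M (cj x)"
    using cj_rst(1,2)[OF x M] by simp
  then show "M \<in> rst (cj x)" using d rst_den[OF M] rst_G[OF M] by (auto simp: rst_def intro!: rfixI)
qed

lemma cj_HR: "x \<in> HR \<Longrightarrow> cj x \<in> HR"
  using HR_hyp rst_cj by (metis (mono_tags, lifting) HR_def mem_Collect_eq)

lemma cj_cj [simp]: assumes x: "x \<in> HR" shows "cj (cj x) = x"
proof -
  obtain M where M: "M \<in> rst x" "M$2$1 \<noteq> 0" using HR_hyp[OF x] by metis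
  have "M$2$1 * (x + cj x) = M$2$1 * (cj x + cj (cj x))"
    using cj_rst(1)[OF x M(1)] cj_rst(1)[OF cj_HR[OF x] rst_cj(1)[OF x M(1)]] by simp
  then show ?thesis using M by simp
qed

lemma rst_cj_iff: "x \<in> HR \<Longrightarrow> M \<in> rst (cj x) \<longleftrightarrow> M \<in> rst x"
  using rst_cj cj_HR cj_cj by metis

text \<open>If W moved x to \<infinity>, conjugation by W would turn a hyperbolic element fixing x
  into an upper triangular one, contrary to \<open>G_upper\<close>. So orbits of hyperbolic fixed
  points never leave the real line.\<close>

lemma HR_den: assumes x: "x \<in> HR" and W: "W \<in> G" shows "den W x \<noteq> 0"
proof
  assume 0: "den W x = 0"
  obtain M where M: "M \<in> rst x" "hyperbolic_matrix M" using HR_hyp[OF x] by metis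
  define N where "N = W ** M ** madj W"
  have N: "N \<in> G" "hyperbolic_matrix N"
    using M W rst_G hyperbolic_conj[of W M] by (auto simp: N_def hyperbolic_matrix_def)
  have NW: "N ** W = W ** M" unfolding N_def using madj_mult(1)[of W] W by (simp flip: matrix_mul_assoc)
  have "det2 W = W$1$1 * den W x - W$2$1 * (W$1$1 * x + W$1$2)" by (simp add: den_def det2_def algebra_simps)
  then have "det2 W = - W$2$1 * (W$1$1 * x + W$1$2)" using 0 by simp
  then have y: "W$1$1 * x + W$1$2 \<noteq> 0" using W by auto
  have "N$2$1 * (W$1$1 * x + W$1$2) + N$2$2 * den W x = (N ** W)$2$1 * x + (N ** W)$2$2"
    by (simp add: den_def algebra_simps)
  also have "\<dots> = W$2$1 * (M$1$1 * x + M$1$2) + W$2$2 * den M x" by (simp add: NW den_def algebra_simps)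
  also have "\<dots> = den M x * den W x"
    using rfix_eq[OF rst_rfix[OF M(1)]] by (simp add: den_def[of W] algebra_simps)
  finally have "N$2$1 = 0" using 0 y by simp
  then show False using G_upper(3) N by blast
qed

lemma mv_conj:
  assumes x: "x \<in> HR" and W: "W \<in> G" and M: "M \<in> rst x"
  shows "W ** M ** madj W \<in> rst (mv W x)" "den (W ** M ** madj W) (mv W x) = den M x"
proof -
  define N where "N = W ** M ** madj W"
  have NW: "N ** W = W ** M" unfolding N_def using madj_mult(1)[of W] W by (simp flip: matrix_mul_assoc)
  have d: "den W x \<noteq> 0" using HR_den[OF x W] .
  have m: "den M x \<noteq> 0" "mv M x = x" using rst_rfix[OF M] by (auto simp: rfix_def)
  have "den N (mv W x) * den W x = den (W ** M) x" unfolding NW[symmetric] by (rule den_mult[OF d, symmetric])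
  also have "\<dots> = den W x * den M x" unfolding den_mult[OF m(1)] by (simp only: m(2))
  also have "\<dots> = den M x * den W x" by (rule mult.commute)
  finally have "den N (mv W x) * den W x = den M x * den W x" .
  then have e: "den N (mv W x) = den M x"
    unfolding mult_right_cancel[OF d] .
  have "mv N (mv W x) = mv (W ** M) x" unfolding NW[symmetric] by (rule mv_mult[OF d, symmetric])
  also have "\<dots> = mv W x" unfolding mv_mult[OF m(1)] by (simp only: m(2))
  finally have f: "mv N (mv W x) = mv W x" .
  have "N \<in> G" using rst_G[OF M] W by (simp add: N_def)
  then show "W ** M ** madj W \<in> rst (mv W x)" "den (W ** M ** madj W) (mv W x) = den M x"
    unfolding N_def[symmetric] rst_def rfix_def using e f m(1) by simp_all
qed

lemma HR_mv: assumes x: "x \<in> HR" and W: "W \<in> G" shows "mv W x \<in> HR"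
proof -
  obtain M where M: "M \<in> rst x" "hyperbolic_matrix M" using HR_hyp[OF x] by metis
  then have "hyperbolic_matrix (W ** M ** madj W)"
    using hyperbolic_conj[of W M] W by (simp add: hyperbolic_matrix_def)
  then show ?thesis using mv_conj(1)[OF x W M(1)] unfolding HR_def by blast
qed

lemma HR_mv_mult: "x \<in> HR \<Longrightarrow> N \<in> G \<Longrightarrow> mv (M ** N) x = mv M (mv N x)"
  by (simp add: mv_mult HR_den)

lemma HR_mv_madj: assumes "x \<in> HR" "W \<in> G" shows "mv (madj W) (mv W x) = x" "mv W (mv (madj W) x) = x"
  using HR_mv_mult[of x W "madj W"] HR_mv_mult[of x "madj W" W] assms madj_mult[of W] by auto

text \<open>The conjugated element N has the same factor at both points, namely the inverse of its
  factor at \<open>mv W x\<close>. As its lower left entry is nonzero, \<open>den N\<close> is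
  injective.\<close>

lemma mv_cj: assumes x: "x \<in> HR" and W: "W \<in> G" shows "mv W (cj x) = cj (mv W x)"
proof -
  obtain M where M: "M \<in> rst x" "hyperbolic_matrix M" using HR_hyp[OF x] by metis
  define N where "N = W ** M ** madj W"
  define y where "y = mv W x"
  have y: "y \<in> HR" using HR_mv x W by (simp add: y_def)
  have N: "N \<in> rst y" "N \<in> rst (mv W (cj x))" "den N y = den M x"
    "den N (mv W (cj x)) = 1 / den M x"
    using mv_conj[OF x W M(1)] mv_conj[OF cj_HR[OF x] W rst_cj(1)[OF x M(1)]] rst_cj(2)[OF x M(1)]
    by (simp_all add: N_def y_def)
  have "N$2$1 \<noteq> 0" using G_upper(3)[OF rst_G[OF N(1)]] M hyperbolic_conj[of W M] W by (auto simp: N_def hyperbolic_matrix_def)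
  moreover have "den N (cj y) = den N (mv W (cj x))" using N rst_cj(2)[OF y N(1)] by simp
  ultimately show ?thesis by (simp add: den_def y_def)
qed

text \<open>A description of stabilizer generators by least absolute trace. Unlike generation, it is
  preserved by conjugation at once, and \<open>stabilizer_generator_isgen\<close> shows that it
  covers every admissible generator.\<close>

definition isgen :: "real \<Rightarrow> real^2^2 \<Rightarrow> bool" where
  "isgen x h \<longleftrightarrow> h \<in> rst x \<and> hyperbolic_matrix h \<and> (\<forall>M\<in>rst x. hyperbolic_matrix M \<longrightarrow> \<bar>trace h\<bar> \<le> \<bar>trace M\<bar>)"

lemma isgen_conj:
  assumes "x \<in> HR" "W \<in> G" "isgen x h" shows "isgen (mv W x) (W ** h ** madj W)"
proof -
  have tr: "trace (W ** h ** madj W) = trace h" using hyperbolic_conj assms(2) by simp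
  have *: "\<bar>trace h\<bar> \<le> \<bar>trace M\<bar>" if M: "M \<in> rst (mv W x)" "hyperbolic_matrix M" for M
  proof -
    have t: "trace (madj W ** M ** madj (madj W)) = trace M" using hyperbolic_conj[of "madj W"] assms(2) by simp
    have "madj W ** M ** madj (madj W) \<in> rst x"
      using mv_conj(1)[OF HR_mv[OF assms(1,2)] G_madj[OF assms(2)] M(1)] HR_mv_madj(1)[OF assms(1,2)] by simp
    then show ?thesis using assms(3) t M(2) by (auto simp: isgen_def hyperbolic_matrix_def)
  qed
  show ?thesis using * assms mv_conj(1)[of x W h] tr by (auto simp: isgen_def hyperbolic_matrix_def)
qed

lemma isgen_cj: "x \<in> HR \<Longrightarrow> isgen (cj x) h \<longleftrightarrow> isgen x h"
proof -
  assume "x \<in> HR"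
  then have "rst (cj x) = rst x" using rst_cj_iff by blast
  then show ?thesis by (simp add: isgen_def)
qed

lemma trace_le_iff:
  fixes a b :: real assumes "a \<ge> 1" "b \<ge> 1" shows "a + 1 / a \<le> b + 1 / b \<longleftrightarrow> a \<le> b"
proof -
  have e: "b + 1 / b - (a + 1 / a) = (b - a) * (a * b - 1) / (a * b)"
    using assms by (simp add: field_simps)
  have ab: "a * b \<ge> a" "a * b \<ge> b" using assms by auto
  show ?thesis
  proof (cases "a \<le> b")
    case True
    have "a * b - 1 \<ge> 0" "a * b > 0" using ab assms by linarith+
    then have "(b - a) * (a * b - 1) / (a * b) \<ge> 0" using True using assms by (intro divide_nonneg_nonneg mult_nonneg_nonneg) linarith+
    then show ?thesis using True e by linarith
  next
    case False
    then have "a * b > 1" using assms ab by linarith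
    then have "(b - a) * (a * b - 1) / (a * b) < 0" using False by (simp add: divide_neg_pos mult_neg_pos)
    then show ?thesis using False e by linarith
  qed
qed

lemma rst_same_den:
  assumes x: "x \<in> HR" and M: "M \<in> rst x" and N: "N \<in> rst x" and e: "\<bar>den M x\<bar> = \<bar>den N x\<bar>"
  shows "M = N \<or> M = - N"
proof -
  have "\<bar>den (M ** madj N) x\<bar> = 1" using rst_mult[OF M rst_madj(1)[OF N]] rst_madj(2)[OF N] e rst_den[OF N] by (simp add: abs_mult)
  then have "M ** madj N = mat 1 \<or> M ** madj N = - mat 1"
    using rst_abs_den_one[OF x] rst_mult(1)[OF M rst_madj(1)[OF N]] by blast
  then have "M ** madj N ** N = N \<or> M ** madj N ** N = - N" by auto
  then show ?thesis using madj_mult(1)[of N] rst_G[OF N] by (simp flip: matrix_mul_assoc)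
qed

lemma rst_expand: assumes M: "M \<in> rst x" "hyperbolic_matrix M"
  obtains N where "N \<in> {M, madj M}" "N \<in> rst x" "\<bar>den N x\<bar> > 1" "\<bar>trace M\<bar> = \<bar>den N x\<bar> + 1 / \<bar>den N x\<bar>"
proof -
  have t: "\<bar>trace M\<bar> = \<bar>den M x\<bar> + 1 / \<bar>den M x\<bar>"
    using rfix_trace[OF rst_rfix[OF M(1)]] trace_den_gt_two(1)[OF rst_den[OF M(1)]] rst_G[OF M(1)] by simp
  have "\<bar>den M x\<bar> > 1 \<or> \<bar>den M x\<bar> < 1" using M rst_hyperbolic by fastforce
  then show ?thesis
  proof
    assume "\<bar>den M x\<bar> > 1" then show ?thesis using that[of M] t M by simp
  next
    assume "\<bar>den M x\<bar> < 1" then show ?thesis using that[of "madj M"] t rst_madj M rst_den[OF M(1)] by (simp add: add.commute)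
  qed
qed

text \<open>The absolute trace determines the absolute factor up to inversion, and elements with the
  same absolute factor differ by a sign. After replacing both by their expanding versions, they
  agree up to sign.\<close>

lemma isgen_unique:
  assumes x: "x \<in> HR" and h: "isgen x h" and k: "isgen x k"
  shows "k \<in> {h, - h, madj h, - madj h}"
proof -
  have hk: "h \<in> rst x" "hyperbolic_matrix h" "k \<in> rst x" "hyperbolic_matrix k" using h k by (auto simp: isgen_def)
  obtain h' where h': "h' \<in> {h, madj h}" "h' \<in> rst x" "\<bar>den h' x\<bar> > 1" "\<bar>trace h\<bar> = \<bar>den h' x\<bar> + 1 / \<bar>den h' x\<bar>"
    using rst_expand[OF hk(1,2)] .
  obtain k' where k': "k' \<in> {k, madj k}" "k' \<in> rst x" "\<bar>den k' x\<bar> > 1" "\<bar>trace k\<bar> = \<bar>den k' x\<bar> + 1 / \<bar>den k' x\<bar>"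
    using rst_expand[OF hk(3,4)] .
  have "\<bar>trace h\<bar> = \<bar>trace k\<bar>" using h k hk by (auto simp: isgen_def intro: antisym)
  then have "\<bar>den h' x\<bar> = \<bar>den k' x\<bar>"
    using trace_le_iff[of "\<bar>den h' x\<bar>" "\<bar>den k' x\<bar>"] trace_le_iff[of "\<bar>den k' x\<bar>" "\<bar>den h' x\<bar>"] h' k' by linarith
  then have "k' = h' \<or> k' = - h'" using rst_same_den[OF x k'(2) h'(2)] by simp
  moreover have "madj (- M) = - madj M" for M by (rule mtx_eqI) simp_all
  ultimately show ?thesis using h'(1) k'(1) by (metis insertCI insertE madj_madj singletonD)
qed

text \<open>The number \<open>den M x - 1 / den M x\<close> is c (x - x') with c = 0 or
  \<bar>c\<bar> \<ge> 1. So it is 0 or bounded away from 0, which keeps the factors away from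
  1.\<close>

lemma rst_gap:
  assumes x: "x \<in> HR"
  obtains \<delta> where "\<delta> > 1" "\<And>M. M \<in> rst x \<Longrightarrow> \<bar>den M x\<bar> > 1 \<Longrightarrow> \<bar>den M x\<bar> \<ge> \<delta>"
proof -
  define e where "e = \<bar>x - cj x\<bar>"
  have e: "e > 0" using cj_neq[OF x] by (simp add: e_def)
  have "\<bar>den M x\<bar> \<ge> sqrt (1 + e)" if M: "M \<in> rst x" and d: "\<bar>den M x\<bar> > 1" for M
  proof -
    define j where "j = den M x"
    have j: "\<bar>j\<bar> > 1" "j \<noteq> 0" using d by (auto simp: j_def)
    have "j - 1 / j \<noteq> 0" using abs_one_iff_inverse[OF j(2)] j by auto
    then have "M$2$1 \<noteq> 0" using cj_rst(3)[OF x M] by (auto simp: j_def)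
    then have "\<bar>M$2$1\<bar> \<ge> 1" using G_entries(3)[OF rst_G[OF M]] by auto
    then have "1 * e \<le> \<bar>M$2$1\<bar> * e" using e by (intro mult_right_mono) auto
    then have "e \<le> \<bar>j - 1 / j\<bar>" using cj_rst(3)[OF x M] by (simp add: e_def j_def flip: abs_mult)
    moreover have "\<bar>j\<bar> * \<bar>j - 1 / j\<bar> = j\<^sup>2 - 1"
    proof -
      have "j * (j - 1 / j) = j\<^sup>2 - 1" using j by (simp add: algebra_simps power2_eq_square)
      moreover have "j\<^sup>2 \<ge> 1" using j abs_le_square_iff[of 1 j] by simp
      ultimately show ?thesis by (simp flip: abs_mult)
    qed
    moreover have "1 * e \<le> \<bar>j\<bar> * e" using e j by (intro mult_right_mono) auto
    moreover have "\<bar>j\<bar> * e \<le> \<bar>j\<bar> * \<bar>j - 1 / j\<bar>" using calculation(1) by (intro mult_left_mono) auto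
    ultimately have "1 + e \<le> j\<^sup>2" by linarith
    then show ?thesis using real_sqrt_le_iff[of "1 + e" "j\<^sup>2"] e by (simp add: j_def)
  qed
  moreover have "sqrt (1 + e) > 1" using e by simp
  ultimately show ?thesis using that by blast
qed

text \<open>The gap makes the infimum of the factors beyond 1 attained. If g has factor below
  \<open>Inf J * \<delta>\<close> and some M had a smaller factor beyond 1, then the factor of
  \<open>g ** madj M\<close> would lie strictly between 1 and \<delta>.\<close>

lemma generator_exists:
  assumes x: "x \<in> HR"
  obtains g where "g \<in> rst x" "\<bar>den g x\<bar> > 1" "\<And>M. M \<in> rst x \<Longrightarrow> \<bar>den M x\<bar> > 1 \<Longrightarrow> \<bar>den M x\<bar> \<ge> \<bar>den g x\<bar>"
proof -
  obtain \<delta> where \<delta>: "\<delta> > 1" "\<And>M. M \<in> rst x \<Longrightarrow> \<bar>den M x\<bar> > 1 \<Longrightarrow> \<bar>den M x\<bar> \<ge> \<delta>" using rst_gap[OF x] by blast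
  define J where "J = {\<bar>den M x\<bar> | M. M \<in> rst x \<and> \<bar>den M x\<bar> > 1}"
  obtain M0 where M0: "M0 \<in> rst x" "\<bar>den M0 x\<bar> < 1" using HR_contracting[OF x] .
  have "\<bar>den (madj M0) x\<bar> > 1" using M0 rst_madj(2)[OF M0(1)] rst_den[OF M0(1)] by simp
  then have ne: "J \<noteq> {}" using rst_madj(1)[OF M0(1)] by (auto simp: J_def)
  have bd: "bdd_below J" by (rule bdd_belowI[of _ 1]) (auto simp: J_def)
  have "Inf J \<ge> \<delta>" using ne \<delta>(2) by (intro cInf_greatest) (auto simp: J_def)
  then have "Inf J * 1 < Inf J * \<delta>" using \<delta>(1) by (intro mult_strict_left_mono) auto
  then obtain t where "t \<in> J" "t < Inf J * \<delta>" using cInf_lessD[OF ne, of "Inf J * \<delta>"] by auto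
  then obtain g where g: "g \<in> rst x" "\<bar>den g x\<bar> > 1" "\<bar>den g x\<bar> < Inf J * \<delta>" by (auto simp: J_def)
  have "\<bar>den M x\<bar> \<ge> \<bar>den g x\<bar>" if M: "M \<in> rst x" "\<bar>den M x\<bar> > 1" for M
  proof (rule ccontr)
    assume less: "\<not> \<bar>den M x\<bar> \<ge> \<bar>den g x\<bar>"
    have q: "g ** madj M \<in> rst x" "\<bar>den (g ** madj M) x\<bar> = \<bar>den g x\<bar> / \<bar>den M x\<bar>"
      using rst_mult[OF g(1) rst_madj(1)[OF M(1)]] rst_madj(2)[OF M(1)] by (simp_all add: abs_mult)
    have "\<bar>den (g ** madj M) x\<bar> > 1" unfolding q(2) using less M(2) by simp
    then have "\<bar>den g x\<bar> / \<bar>den M x\<bar> \<ge> \<delta>" using \<delta>(2) q by metis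
    then have "\<bar>den g x\<bar> \<ge> \<delta> * \<bar>den M x\<bar>" using M(2) by (simp add: field_simps)
    moreover have "Inf J \<le> \<bar>den M x\<bar>" using M bd by (intro cInf_lower) (auto simp: J_def)
    then have "Inf J * \<delta> \<le> \<delta> * \<bar>den M x\<bar>" using \<delta>(1) by (simp add: mult.commute)
    ultimately show False using g(3) by linarith
  qed
  then show ?thesis using that g by blast
qed

lemma lft_denom_real: "lft_denom M (of_real x) = of_real (den M x)"
  by (simp add: lft_denom_def den_def)

lemma lft_real: "lft M (of_real x) = of_real (mv M x)"
  by (simp add: lft_def moebius_def mv_def den_def)

lemma stabilizer_real: "stabilizer p (of_real x) = rst x"
  by (auto simp: stabilizer_def rst_def lft_fixes_def rfix_def lft_denom_real lft_real)

text \<open>A fixed point with imaginary part v \<noteq> 0 would force (a + d)^2 - 4 = - 4 (c v)^2,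
  against \<bar>a + d\<bar> > 2.\<close>

lemma hyperbolic_fixed_points_real: "hyperbolic_fixed_points p = of_real ` HR"
proof -
  have "\<alpha> \<in> of_real ` HR" if M: "M \<in> G" "hyperbolic_matrix M" "lft_fixes M \<alpha>" for M \<alpha>
  proof -
    define a b c d where "a = M$1$1" "b = M$1$2" "c = M$2$1" "d = M$2$2"
    note abcd = this
    define u v where "u = Re \<alpha>" "v = Im \<alpha>"
    have det: "a * d - b * c = 1" using G_det[OF M(1)] by (simp add: det2_def abcd)
    have "\<bar>a + d\<bar>\<^sup>2 > 2\<^sup>2" using M(2) by (intro power_strict_mono) (auto simp: hyperbolic_matrix_def trace_entries abcd)
    then have tr: "(a + d)\<^sup>2 > 4" by simp
    have n: "lft_denom M \<alpha> \<noteq> 0" "lft M \<alpha> = \<alpha>" using M(3) by (auto simp: lft_fixes_def)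
    then have "of_real a * \<alpha> + of_real b = \<alpha> * (of_real c * \<alpha> + of_real d)"
      by (simp add: lft_def moebius_def lft_denom_def abcd divide_eq_eq)
    then have re: "a * u + b = c * (u * u - v * v) + d * u" and im: "a * v = 2 * c * u * v + d * v"
      by (auto simp: complex_eq_iff u_v_def algebra_simps)
    have "v = 0"
    proof (rule ccontr)
      assume "v \<noteq> 0"
      then have h: "a - d = 2 * c * u" using im by (simp flip: distrib_right)
      have b: "b = c * (u * u - v * v) - (a - d) * u" using re by (simp add: algebra_simps)
      have "(a + d)\<^sup>2 - 4 = (a - d)\<^sup>2 + 4 * c * b"
      proof -
        have "(a + d)\<^sup>2 - 4 * (a * d - b * c) = (a - d)\<^sup>2 + 4 * c * b" by (simp add: power2_eq_square algebra_simps)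
        then show ?thesis unfolding det by simp
      qed
      also have "\<dots> = - 4 * (c * v)\<^sup>2"
        unfolding b h by (simp add: power2_eq_square algebra_simps)
      finally have "(a + d)\<^sup>2 - 4 = - 4 * (c * v)\<^sup>2" .
      then show False using tr zero_le_power2[of "c * v"] by linarith
    qed
    then have \<alpha>: "\<alpha> = of_real u" by (simp add: complex_eq_iff u_v_def)
    then have "rfix M u" using n by (simp add: rfix_def lft_denom_real lft_real)
    then show ?thesis using M \<alpha> by (auto simp: HR_def rst_def)
  qed
  moreover have "of_real x \<in> hyperbolic_fixed_points p" if "x \<in> HR" for x
    using that by (auto simp: HR_def rst_def hyperbolic_fixed_points_def rfix_def lft_fixes_def lft_denom_real lft_real)
  ultimately show ?thesis by (auto simp: hyperbolic_fixed_points_def)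
qed

text \<open>Division with remainder on the absolute factors: multiplying by g or its inverse moves
  the factor of M towards 1, and no factor lies strictly between 1 and that of g.\<close>

lemma stabilizer_generator_exists:
  assumes x: "x \<in> HR"
  obtains g where "g \<in> rst x" "\<bar>den g x\<bar> > 1" "\<And>M. M \<in> rst x \<Longrightarrow> \<bar>den M x\<bar> > 1 \<Longrightarrow> \<bar>den M x\<bar> \<ge> \<bar>den g x\<bar>"
    "stabilizer_generator p (of_real x) g"
proof -
  obtain g where g: "g \<in> rst x" "\<bar>den g x\<bar> > 1" "\<And>M. M \<in> rst x \<Longrightarrow> \<bar>den M x\<bar> > 1 \<Longrightarrow> \<bar>den M x\<bar> \<ge> \<bar>den g x\<bar>"
    using generator_exists[OF x] by blast
  define H where "H = generate SL2R {g, - mat 1}"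
  have sub: "subgroup H SL2R"
    unfolding H_def by (rule SL2R.generate_is_subgroup) (use rst_G[OF g(1)] in auto)
  have Hm: "A ** B \<in> H" if "A \<in> H" "B \<in> H" for A B using subgroup.m_closed[OF sub that] by simp
  have Hg: "g \<in> H" "- mat 1 \<in> H" by (auto simp: H_def generate.incl)
  have Ha: "madj g \<in> H" using subgroup.m_inv_closed[OF sub Hg(1)] inv_SL2R[of g] rst_G[OF g(1)] by simp
  define t where "t = \<bar>den g x\<bar>"
  \<comment> \<open>The two bounds say that the factor lies between the powers -n and n of t; one
    multiplication lowers n by 1.\<close>
  have "M \<in> H" if "M \<in> rst x" "\<bar>den M x\<bar> \<le> t ^ n" "1 \<le> t ^ n * \<bar>den M x\<bar>" for M n
    using that
  proof (induction n arbitrary: M)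
    case 0
    then have "M = mat 1 \<or> M = - mat 1" using rst_abs_den_one[OF x 0(1)] by simp
    then show ?case using Hg subgroup.one_closed[OF sub] by auto
  next
    case (Suc n)
    have t: "t > 1" using g by (simp add: t_def)
    have M: "M \<in> rst x" "den M x \<noteq> 0" using Suc rst_den by auto
    have tn: "t ^ n \<ge> 1" using t by simp
    consider "\<bar>den M x\<bar> = 1" | "\<bar>den M x\<bar> > 1" | "\<bar>den M x\<bar> < 1" by linarith
    then show ?case
    proof cases
      case 1
      then have "M = mat 1 \<or> M = - mat 1" using rst_abs_den_one[OF x M(1)] by simp
      then show ?thesis using Hg subgroup.one_closed[OF sub] by auto
    next
      case 2
      then have ge: "\<bar>den M x\<bar> \<ge> t" using g(3)[OF M(1)] by (simp add: t_def)
      define N where "N = M ** madj g"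
      have N: "N \<in> rst x" "\<bar>den N x\<bar> = \<bar>den M x\<bar> / t"
        using rst_mult[OF M(1) rst_madj(1)[OF g(1)]] rst_madj(2)[OF g(1)] by (simp_all add: N_def abs_mult t_def)
      have l: "\<bar>den N x\<bar> \<ge> 1" using ge t N(2) by simp
      have "1 * 1 \<le> t ^ n * \<bar>den N x\<bar>" using l tn by (intro mult_mono) auto
      moreover have "\<bar>den N x\<bar> \<le> t ^ n" unfolding N(2) using Suc(3) t by (simp add: divide_le_eq mult.commute)
      ultimately have "N \<in> H" using Suc.IH[OF N(1)] by simp
      then have "N ** g \<in> H" using Hm Hg by blast
      then show ?thesis using madj_mult(1)[of g] rst_G[OF g(1)] by (simp add: N_def flip: matrix_mul_assoc)
    next
      case 3
      have "\<bar>den (madj M) x\<bar> \<ge> t" using g(3)[OF rst_madj(1)[OF M(1)]] rst_madj(2)[OF M(1)] 3 M(2) by (simp add: t_def)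
      then have le: "\<bar>den M x\<bar> * t \<le> 1" using rst_madj(2)[OF M(1)] M(2) by (simp add: field_simps)
      define N where "N = M ** g"
      have N: "N \<in> rst x" "\<bar>den N x\<bar> = \<bar>den M x\<bar> * t"
        using rst_mult[OF M(1) g(1)] by (simp_all add: N_def abs_mult t_def)
      have "1 \<le> t ^ n * \<bar>den N x\<bar>" using Suc(4) N(2) by (simp add: mult_ac)
      moreover have "\<bar>den N x\<bar> \<le> t ^ n" using le N(2) tn by linarith
      ultimately have "N \<in> H" using Suc.IH[OF N(1)] by simp
      then have "N ** madj g \<in> H" using Hm Ha by blast
      then show ?thesis using madj_mult(2)[of g] rst_G[OF g(1)] by (simp add: N_def flip: matrix_mul_assoc)
    qed
  qed
  note * = this
  have "M \<in> H" if M: "M \<in> rst x" for M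
  proof -
    have t: "t > 1" using g by (simp add: t_def)
    obtain n where n: "max (\<bar>den M x\<bar>) (1 / \<bar>den M x\<bar>) < t ^ n" using real_arch_pow[OF t] by blast
    then show ?thesis using *[OF M, of n] rst_den[OF M] by (simp add: field_simps)
  qed
  moreover have "H \<subseteq> rst x"
  proof
    fix M assume "M \<in> H"
    then have "M \<in> generate SL2R {g, - mat 1}" by (simp add: H_def)
    then show "M \<in> rst x"
    proof (induction rule: generate.induct)
      case one then show ?case by simp
    next
      case (incl h) then show ?case using g rst_neg[OF rst_one] by auto
    next
      case (inv h)
      then have "h \<in> rst x" using g rst_neg[OF rst_one] by auto
      then show ?case using rst_madj rst_G by (simp add: inv_SL2R)
    next
      case (eng h1 h2) then show ?case using rst_mult by simp
    qed
  qed
  ultimately have "stabilizer_generator p (of_real x) g"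
    unfolding stabilizer_generator_def stabilizer_real H_def by blast
  then show ?thesis using that g by blast
qed

text \<open>All absolute factors are powers of that of h. So the least one beyond 1 is a positive
  power of the factor of h or of its inverse, whichever exceeds 1; hence that one is minimal
  itself.\<close>

lemma stabilizer_generator_isgen:
  assumes x: "x \<in> HR" and h: "stabilizer_generator p (of_real x) h"
  shows "isgen x h"
proof -
  obtain g where g: "g \<in> rst x" "\<bar>den g x\<bar> > 1" "\<And>M. M \<in> rst x \<Longrightarrow> \<bar>den M x\<bar> > 1 \<Longrightarrow> \<bar>den M x\<bar> \<ge> \<bar>den g x\<bar>"
    using generator_exists[OF x] by blast
  have H: "generate SL2R {h, - mat 1} = rst x" using h by (simp add: stabilizer_generator_def stabilizer_real)
  have hr: "h \<in> rst x" using H generate.incl[of h] by blast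
  have "\<exists>n. \<bar>den M x\<bar> = \<bar>den h x\<bar> powi n" if "M \<in> rst x" for M
  proof -
    have "M \<in> generate SL2R {h, - mat 1}" using H that by simp
    then show ?thesis
    proof (induction rule: generate.induct)
      case one then show ?case by (auto intro!: exI[of _ 0])
    next
      case (incl k) then show ?case by (auto intro: exI[of _ 0] exI[of _ 1])
    next
      case (inv k)
      have "madj (- mat 1) = (- mat 1 :: real^2^2)" by (rule mtx_eqI) simp_all
      then show ?case using inv rst_madj(2)[OF hr] rst_G[OF hr]
        by (auto simp: inv_SL2R power_int_minus inverse_eq_divide intro: exI[of _ 0] exI[of _ "-1"])
    next
      case (eng k1 k2)
      then obtain n1 n2 where "\<bar>den k1 x\<bar> = \<bar>den h x\<bar> powi n1" "\<bar>den k2 x\<bar> = \<bar>den h x\<bar> powi n2" by blast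
      moreover have "k1 \<in> rst x" "k2 \<in> rst x" using eng(1,2) H by auto
      ultimately show ?case using rst_mult(2)[of k1 x k2] rst_den[OF hr]
        by (auto simp: abs_mult power_int_add intro!: exI[of _ "n1 + n2"])
    qed
  qed
  then obtain n where n: "\<bar>den g x\<bar> = \<bar>den h x\<bar> powi n" using g by blast
  then have "\<bar>den h x\<bar> \<noteq> 1" using g by auto
  then have hyp: "hyperbolic_matrix h" using rst_hyperbolic[OF hr] by simp
  obtain k where k: "k \<in> {h, madj h}" "k \<in> rst x" "\<bar>den k x\<bar> > 1" "\<bar>trace h\<bar> = \<bar>den k x\<bar> + 1 / \<bar>den k x\<bar>"
    using rst_expand[OF hr hyp] .
  have "\<exists>m. \<bar>den g x\<bar> = \<bar>den k x\<bar> powi m"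
  proof -
    consider "k = h" | "k = madj h" using k(1) by blast
    then show ?thesis
    proof cases
      case 1 then show ?thesis using n by blast
    next
      case 2
      then have "\<bar>den k x\<bar> = inverse \<bar>den h x\<bar>" using rst_madj(2)[OF hr] by (simp add: divide_inverse)
      then have "\<bar>den k x\<bar> powi (- n) = \<bar>den h x\<bar> powi n" by (simp add: power_int_inverse power_int_minus)
      then show ?thesis using n by metis
    qed
  qed
  then obtain m where m: "\<bar>den g x\<bar> = \<bar>den k x\<bar> powi m" ..
  have "m \<ge> 1"
  proof (rule ccontr)
    assume "\<not> m \<ge> 1"
    then have "\<bar>den k x\<bar> powi m \<le> \<bar>den k x\<bar> powi 0" using k(3) by (intro power_int_increasing) auto
    then show False using m g(2) by simp
  qed
  then have "\<bar>den k x\<bar> powi 1 \<le> \<bar>den k x\<bar> powi m" using k(3) by (intro power_int_increasing) auto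
  then have le: "\<bar>den k x\<bar> \<le> \<bar>den g x\<bar>" using m by simp
  have "\<bar>trace h\<bar> \<le> \<bar>trace M\<bar>" if M: "M \<in> rst x" "hyperbolic_matrix M" for M
  proof -
    obtain N where N: "N \<in> rst x" "\<bar>den N x\<bar> > 1" "\<bar>trace M\<bar> = \<bar>den N x\<bar> + 1 / \<bar>den N x\<bar>"
      using rst_expand[OF M] by metis
    then have "\<bar>den k x\<bar> \<le> \<bar>den N x\<bar>" using g(3)[OF N(1)] le by linarith
    then show ?thesis using trace_le_iff[of "\<bar>den k x\<bar>" "\<bar>den N x\<bar>"] k N by simp
  qed
  then show ?thesis using hr hyp by (auto simp: isgen_def)
qed

lemma isgen_some:
  assumes x: "x \<in> HR" shows "isgen x (SOME M. stabilizer_generator p (of_real x) M)"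
  using stabilizer_generator_isgen[OF x] stabilizer_generator_exists[OF x] someI_ex[of "stabilizer_generator p (of_real x)"] by metis


subsection \<open>Hyperbolic forms and their classes\<close>

abbreviation "ZL \<equiv> Z_lambda p"

lemma map_poly_of_int_add: "map_poly (of_int :: int \<Rightarrow> real) (P + Q) = map_poly of_int P + map_poly of_int Q"
  by (rule poly_eqI) (simp add: coeff_map_poly)

lemma map_poly_of_int_mult: "map_poly (of_int :: int \<Rightarrow> real) (P * Q) = map_poly of_int P * map_poly of_int Q"
  by (rule poly_eqI) (simp add: coeff_map_poly coeff_mult)

lemma ZL_simps [simp]: "x \<otimes>\<^bsub>ZL\<^esub> y = x * y" "x \<oplus>\<^bsub>ZL\<^esub> y = x + y" "\<one>\<^bsub>ZL\<^esub> = 1" "\<zero>\<^bsub>ZL\<^esub> = 0"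
  by (simp_all add: Z_lambda_def)

lemma ZL_add [intro]: "x \<in> carrier ZL \<Longrightarrow> y \<in> carrier ZL \<Longrightarrow> x + y \<in> carrier ZL"
  by (auto simp: Z_lambda_def simp flip: poly_add map_poly_of_int_add)

lemma ZL_mult [intro]: "x \<in> carrier ZL \<Longrightarrow> y \<in> carrier ZL \<Longrightarrow> x * y \<in> carrier ZL"
  by (auto simp: Z_lambda_def simp flip: poly_mult map_poly_of_int_mult)

lemma ZL_int: "of_int n \<in> carrier ZL"
  unfolding Z_lambda_def by (auto intro!: range_eqI[of _ _ "[:n:]"] simp: map_poly_pCons)

lemma ZL_01 [simp, intro]: "0 \<in> carrier ZL" "1 \<in> carrier ZL"
  using ZL_int[of 0] ZL_int[of 1] by simp_all

lemma ZL_neg [intro]: "x \<in> carrier ZL \<Longrightarrow> - x \<in> carrier ZL"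
  using ZL_mult[OF ZL_int[of "-1"], of x] by simp

lemma ZL_neg_iff [simp]: "- x \<in> carrier ZL \<longleftrightarrow> x \<in> carrier ZL"
  using ZL_neg[of x] ZL_neg[of "- x"] by auto

lemma ZL_diff [intro]: "x \<in> carrier ZL \<Longrightarrow> y \<in> carrier ZL \<Longrightarrow> x - y \<in> carrier ZL"
  using ZL_add[of x "- y"] by auto

lemma ZL_lambda: "hecke_lambda p \<in> carrier ZL"
  unfolding Z_lambda_def by (auto intro!: range_eqI[of _ _ "[:0, 1:]"] simp: map_poly_pCons)

lemma G_ZL: "M \<in> G \<Longrightarrow> M$1$1 \<in> carrier ZL \<and> M$1$2 \<in> carrier ZL \<and> M$2$1 \<in> carrier ZL \<and> M$2$2 \<in> carrier ZL"
  unfolding hecke_group_def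
proof (induction rule: generate.induct)
  case one then show ?case by simp
next
  case (incl h) then show ?case using ZL_lambda by (auto simp: hecke_S_eq hecke_T_eq s_two)
next
  case (inv h) then show ?case using ZL_lambda by (auto simp: hecke_S_eq hecke_T_eq inv_SL2R s_two)
next
  case (eng h1 h2) then show ?case by auto
qed

lemma cring_ZL: "cring ZL"
proof (rule cringI)
  show "abelian_group ZL"
    by (rule abelian_groupI) (auto intro!: bexI[where x="- x" for x])
  show "comm_monoid ZL" by (rule comm_monoidI) auto
qed (simp add: algebra_simps)

interpretation ZL: cring ZL
  by (rule cring_ZL)

text \<open>The ideal of the coefficients as an explicit set of combinations, so that its invariance
  under the group action becomes a computation.\<close>

definition idl3 :: "bqf \<Rightarrow> real set" where
  "idl3 Q = (case Q of (A, B, C) \<Rightarrow> {u * A + v * B + w * C | u v w. u \<in> carrier ZL \<and> v \<in> carrier ZL \<and> w \<in> carrier ZL})"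

lemma genideal_idl3:
  assumes "A \<in> carrier ZL" "B \<in> carrier ZL" "C \<in> carrier ZL"
  shows "Idl\<^bsub>ZL\<^esub> {A, B, C} = idl3 (A, B, C)"
proof
  have idl: "ideal (idl3 (A, B, C)) ZL"
  proof (rule idealI)
    show "ring ZL" by (rule ZL.ring_axioms)
    have inv: "inv\<^bsub>add_monoid ZL\<^esub> x = - x" if "x \<in> carrier ZL" for x
      using ZL.minus_equality[of "- x" x] that by (simp add: a_inv_def)
    show "subgroup (idl3 (A, B, C)) (add_monoid ZL)"
    proof (rule subgroup.intro)
      show "idl3 (A, B, C) \<subseteq> carrier (add_monoid ZL)" using assms by (auto simp: idl3_def)
      fix x y assume "x \<in> idl3 (A, B, C)" "y \<in> idl3 (A, B, C)"
      then obtain u v w u' v' w' where *: "x = u * A + v * B + w * C" "y = u' * A + v' * B + w' * C"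
        "u \<in> carrier ZL" "v \<in> carrier ZL" "w \<in> carrier ZL" "u' \<in> carrier ZL" "v' \<in> carrier ZL" "w' \<in> carrier ZL"
        by (auto simp: idl3_def)
      have "x + y = (u + u') * A + (v + v') * B + (w + w') * C" by (simp add: * algebra_simps)
      then show "x \<otimes>\<^bsub>add_monoid ZL\<^esub> y \<in> idl3 (A, B, C)" using * by (simp add: idl3_def) blast
      have "x \<in> carrier ZL" using * assms by auto
      moreover have "- x = (- u) * A + (- v) * B + (- w) * C" by (simp add: * algebra_simps)
      moreover have "- u \<in> carrier ZL" "- v \<in> carrier ZL" "- w \<in> carrier ZL" using * by auto
      ultimately have "\<exists>u v w. - x = u * A + v * B + w * C \<and> u \<in> carrier ZL \<and> v \<in> carrier ZL \<and> w \<in> carrier ZL" by blast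
      then have "- x \<in> idl3 (A, B, C)" by (simp add: idl3_def)
      then show "inv\<^bsub>add_monoid ZL\<^esub> x \<in> idl3 (A, B, C)" using inv[OF \<open>x \<in> carrier ZL\<close>] by simp
    next
      have "0 = 0 * A + 0 * B + 0 * C" by simp
      then have "0 \<in> idl3 (A, B, C)" unfolding idl3_def using ZL_01 by blast
      then show "\<one>\<^bsub>add_monoid ZL\<^esub> \<in> idl3 (A, B, C)" by simp
    qed
    fix a x assume "a \<in> idl3 (A, B, C)" and x: "x \<in> carrier ZL"
    then obtain u v w where *: "a = u * A + v * B + w * C" "u \<in> carrier ZL" "v \<in> carrier ZL" "w \<in> carrier ZL"
      by (auto simp: idl3_def)
    have "x * a = (x * u) * A + (x * v) * B + (x * w) * C" by (simp add: * algebra_simps)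
    moreover have "x * u \<in> carrier ZL" "x * v \<in> carrier ZL" "x * w \<in> carrier ZL" using * x by auto
    ultimately have "x * a \<in> idl3 (A, B, C)" unfolding idl3_def by auto
    then show "x \<otimes>\<^bsub>ZL\<^esub> a \<in> idl3 (A, B, C)" "a \<otimes>\<^bsub>ZL\<^esub> x \<in> idl3 (A, B, C)" by (simp_all add: mult.commute)
  qed
  have "A = 1 * A + 0 * B + 0 * C" "B = 0 * A + 1 * B + 0 * C" "C = 0 * A + 0 * B + 1 * C" by simp_all
  then have "{A, B, C} \<subseteq> idl3 (A, B, C)" unfolding idl3_def using ZL_01 by blast
  then show "Idl\<^bsub>ZL\<^esub> {A, B, C} \<subseteq> idl3 (A, B, C)" by (rule ZL.genideal_minimal[OF idl])
  interpret I: ideal "Idl\<^bsub>ZL\<^esub> {A, B, C}" ZL using assms by (intro ZL.genideal_ideal) auto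
  have mem: "A \<in> Idl\<^bsub>ZL\<^esub> {A, B, C}" "B \<in> Idl\<^bsub>ZL\<^esub> {A, B, C}" "C \<in> Idl\<^bsub>ZL\<^esub> {A, B, C}"
    using ZL.genideal_self[of "{A, B, C}"] assms by auto
  show "idl3 (A, B, C) \<subseteq> Idl\<^bsub>ZL\<^esub> {A, B, C}"
  proof
    fix z assume "z \<in> idl3 (A, B, C)"
    then obtain u v w where *: "z = u * A + v * B + w * C" "u \<in> carrier ZL" "v \<in> carrier ZL" "w \<in> carrier ZL"
      by (auto simp: idl3_def)
    then show "z \<in> Idl\<^bsub>ZL\<^esub> {A, B, C}"
      using I.I_l_closed[OF mem(1) *(2)] I.I_l_closed[OF mem(2) *(3)] I.I_l_closed[OF mem(3) *(4)] I.a_closed by simp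
  qed
qed

text \<open>The fixed point equation of h as a form, before normalization. Its value at a vector v
  is the determinant of the pair (v, h v).\<close>

definition fq :: "real^2^2 \<Rightarrow> bqf" where
  "fq h = (h$2$1, h$2$2 - h$1$1, - (h$1$2))"

lemma fq_neg: "fq (- h) = - fq h" "fq (madj h) = - fq h"
  by (simp_all add: fq_def)

lemma fq_ZL: "h \<in> G \<Longrightarrow> fq h = (A, B, C) \<Longrightarrow> A \<in> carrier ZL \<and> B \<in> carrier ZL \<and> C \<in> carrier ZL"
  using G_ZL[of h] by (auto simp: fq_def)

text \<open>With N = W h W^(-1), the pair (W v, N W v) equals (W v, W h v), whose determinant is
  that of (v, h v). The proof compares coefficients through N W = W h.\<close>

lemma bqf_act_conj:
  assumes "det2 W = 1" shows "bqf_act (fq (W ** h ** madj W)) W = fq h"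
proof -
  have n: "(W ** h ** madj W) ** W = W ** h" using madj_mult(1)[OF assms] by (simp flip: matrix_mul_assoc)
  define N where "N = W ** h ** madj W"
  define a b c d where "a = W$1$1" "b = W$1$2" "c = W$2$1" "d = W$2$2"
  note abcd = this
  have det: "a * d - b * c = 1" using assms by (simp add: det2_def abcd)
  have eq: "(N ** W)$i$j = (W ** h)$i$j" for i j unfolding N_def n ..
  have e: "N$1$1 * a + N$1$2 * c = a * h$1$1 + b * h$2$1" "N$1$1 * b + N$1$2 * d = a * h$1$2 + b * h$2$2"
    "N$2$1 * a + N$2$2 * c = c * h$1$1 + d * h$2$1" "N$2$1 * b + N$2$2 * d = c * h$1$2 + d * h$2$2"
    using eq[of 1 1] eq[of 1 2] eq[of 2 1] eq[of 2 2] by (simp_all add: abcd)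
  have 1: "N$2$1 * a\<^sup>2 + (N$2$2 - N$1$1) * a * c + - (N$1$2) * c\<^sup>2 = h$2$1"
  proof -
    have "N$2$1 * a\<^sup>2 + (N$2$2 - N$1$1) * a * c + - (N$1$2) * c\<^sup>2
      = a * (N$2$1 * a + N$2$2 * c) - c * (N$1$1 * a + N$1$2 * c)" by (simp add: algebra_simps power2_eq_square)
    also have "\<dots> = (a * d - b * c) * h$2$1" unfolding e by (simp add: algebra_simps)
    finally show ?thesis using det by simp
  qed
  have 2: "N$2$1 * b\<^sup>2 + (N$2$2 - N$1$1) * b * d + - (N$1$2) * d\<^sup>2 = - h$1$2"
  proof -
    have "N$2$1 * b\<^sup>2 + (N$2$2 - N$1$1) * b * d + - (N$1$2) * d\<^sup>2
      = b * (N$2$1 * b + N$2$2 * d) - d * (N$1$1 * b + N$1$2 * d)" by (simp add: algebra_simps power2_eq_square)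
    also have "\<dots> = - (a * d - b * c) * h$1$2" unfolding e by (simp add: algebra_simps)
    finally show ?thesis using det by simp
  qed
  have 3: "2 * N$2$1 * a * b + (N$2$2 - N$1$1) * (a * d + b * c) + 2 * (- (N$1$2)) * c * d = h$2$2 - h$1$1"
  proof -
    have "2 * N$2$1 * a * b + (N$2$2 - N$1$1) * (a * d + b * c) + 2 * (- (N$1$2)) * c * d
      = a * (N$2$1 * b + N$2$2 * d) + b * (N$2$1 * a + N$2$2 * c) - c * (N$1$1 * b + N$1$2 * d) - d * (N$1$1 * a + N$1$2 * c)"
      by (simp add: algebra_simps)
    also have "\<dots> = (a * d - b * c) * (h$2$2 - h$1$1)" unfolding e by (simp add: algebra_simps)
    finally show ?thesis using det by simp
  qed
  show ?thesis unfolding N_def[symmetric] fq_def bqf_act.simps Let_def abcd[symmetric] 1 2 3 ..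
qed

lemma bqf_act_mult: "bqf_act (bqf_act Q M) N = bqf_act Q (M ** N)"
  by (cases Q) (simp add: Let_def algebra_simps power2_eq_square)

lemma bqf_act_one [simp]: "bqf_act Q (mat 1) = Q"
  by (cases Q) (simp add: Let_def)

lemma bqf_act_scale: "bqf_act (r *\<^sub>R Q) M = r *\<^sub>R bqf_act Q M" "bqf_act (- Q) M = - bqf_act Q M"
  by (cases Q; simp add: Let_def algebra_simps)+

lemma idl3_act:
  assumes "W \<in> G" shows "idl3 (bqf_act Q W) \<subseteq> idl3 Q"
proof -
  obtain A B C where Q: "Q = (A, B, C)" by (cases Q)
  define a b c d where "a = W$1$1" "b = W$1$2" "c = W$2$1" "d = W$2$2"
  note abcd = this
  have Z: "a \<in> carrier ZL" "b \<in> carrier ZL" "c \<in> carrier ZL" "d \<in> carrier ZL" using G_ZL[OF assms] by (auto simp: abcd)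
  have two: "2 \<in> carrier ZL" using ZL_int[of 2] by simp
  show ?thesis
  proof
    fix z assume "z \<in> idl3 (bqf_act Q W)"
    then obtain u v w where *: "u \<in> carrier ZL" "v \<in> carrier ZL" "w \<in> carrier ZL"
      "z = u * (A * a\<^sup>2 + B * a * c + C * c\<^sup>2) + v * (2 * A * a * b + B * (a * d + b * c) + 2 * C * c * d) + w * (A * b\<^sup>2 + B * b * d + C * d\<^sup>2)"
      by (auto simp: idl3_def Q abcd Let_def)
    have "z = (u * (a * a) + v * (2 * (a * b)) + w * (b * b)) * A + (u * (a * c) + v * (a * d + b * c) + w * (b * d)) * B
        + (u * (c * c) + v * (2 * (c * d)) + w * (d * d)) * C" unfolding *(4) by (simp add: algebra_simps power2_eq_square)
    moreover have "u * (a * a) + v * (2 * (a * b)) + w * (b * b) \<in> carrier ZL" "u * (a * c) + v * (a * d + b * c) + w * (b * d) \<in> carrier ZL"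
      "u * (c * c) + v * (2 * (c * d)) + w * (d * d) \<in> carrier ZL" using Z two * by blast+
    ultimately show "z \<in> idl3 Q" unfolding idl3_def Q by auto
  qed
qed

lemma idl3_act_eq: assumes "W \<in> G" shows "idl3 (bqf_act Q W) = idl3 Q"
  using idl3_act[OF assms, of Q] idl3_act[OF G_madj[OF assms], of "bqf_act Q W"] madj_mult(2)[of W] assms
  by (simp add: bqf_act_mult)

lemma idl3_neg: "idl3 (- Q) = idl3 Q"
proof -
  have "idl3 (- Q) \<subseteq> idl3 Q" for Q
  proof
    fix z assume "z \<in> idl3 (- Q)"
    moreover obtain A B C where Q: "Q = (A, B, C)" by (cases Q)
    ultimately obtain u v w where *: "u \<in> carrier ZL" "v \<in> carrier ZL" "w \<in> carrier ZL" "z = u * (- A) + v * (- B) + w * (- C)"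
      by (auto simp: idl3_def)
    then have "z = (- u) * A + (- v) * B + (- w) * C" "- u \<in> carrier ZL" "- v \<in> carrier ZL" "- w \<in> carrier ZL" by auto
    then show "z \<in> idl3 Q" unfolding idl3_def Q by blast
  qed
  from this[of Q] this[of "- Q"] show ?thesis by simp
qed

text \<open>The normalizing factor g of the definition of the form. It depends on the coefficient
  ideal only, hence is constant along an orbit.\<close>

definition gg :: "bqf \<Rightarrow> real" where
  "gg Q = (if principal_domain ZL then positive_generator p (idl3 Q) else 1)"

text \<open>A generator exists in a principal ideal domain, is nonzero because A is, and can be
  negated; so the choice in \<open>positive_generator\<close> has a witness.\<close>

lemma positive_generator_idl3:
  assumes "principal_domain ZL" "A \<in> carrier ZL" "B \<in> carrier ZL" "C \<in> carrier ZL" "A \<noteq> 0"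
  shows "positive_generator p (idl3 (A, B, C)) > 0" "positive_generator p (idl3 (A, B, C)) \<in> carrier ZL"
    "PIdl\<^bsub>ZL\<^esub> (positive_generator p (idl3 (A, B, C))) = idl3 (A, B, C)"
proof -
  interpret principal_domain ZL by fact
  have "ideal (idl3 (A, B, C)) ZL" using ZL.genideal_ideal[of "{A, B, C}"] genideal_idl3 assms by simp
  then obtain g where g: "g \<in> carrier ZL" "idl3 (A, B, C) = PIdl\<^bsub>ZL\<^esub> g" using exists_gen by blast
  have "A = 1 * A + 0 * B + 0 * C" by simp
  then have "A \<in> idl3 (A, B, C)" unfolding idl3_def using ZL_01 by blast
  then have g0: "g \<noteq> 0" using g assms(5) by (auto simp: cgenideal_def)
  have *: "PIdl\<^bsub>ZL\<^esub> (- g) = PIdl\<^bsub>ZL\<^esub> g"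
  proof -
    have "PIdl\<^bsub>ZL\<^esub> (- a) \<subseteq> PIdl\<^bsub>ZL\<^esub> a" for a
    proof
      fix z assume "z \<in> PIdl\<^bsub>ZL\<^esub> (- a)"
      then obtain y where "y \<in> carrier ZL" "z = (- y) * a" by (auto simp: cgenideal_def)
      then show "z \<in> PIdl\<^bsub>ZL\<^esub> a" by (auto simp: cgenideal_def intro!: exI[of _ "- y"])
    qed
    from this[of g] this[of "- g"] show ?thesis by auto
  qed
  have "\<exists>g. g \<in> carrier ZL \<and> g > 0 \<and> PIdl\<^bsub>ZL\<^esub> g = idl3 (A, B, C)"
    using g g0 * by (intro exI[of _ "\<bar>g\<bar>"]) (auto simp: abs_if)
  from someI_ex[OF this] show "positive_generator p (idl3 (A, B, C)) > 0" "positive_generator p (idl3 (A, B, C)) \<in> carrier ZL"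
    "PIdl\<^bsub>ZL\<^esub> (positive_generator p (idl3 (A, B, C))) = idl3 (A, B, C)"
    unfolding positive_generator_def by blast+
qed

abbreviation hf :: "real \<Rightarrow> bqf" where "hf x \<equiv> hyperbolic_form p (of_real x)"

lemma isgen_facts:
  assumes x: "x \<in> HR" and h: "isgen x h"
  shows "h \<in> G" "h$2$1 \<noteq> 0" "den h x - 1 / den h x \<noteq> 0"
proof -
  have hr: "h \<in> rst x" "hyperbolic_matrix h" using h by (auto simp: isgen_def)
  then show "h \<in> G" "h$2$1 \<noteq> 0" using rst_G G_upper(3) by auto
  show "den h x - 1 / den h x \<noteq> 0" using rst_hyperbolic hr rst_den abs_one_iff_inverse by blast
qed

text \<open>Frees the form from the arbitrary generator. The square root in the definition is the
  modulus of \<open>den h x - 1 / den h x\<close> = c (x - x'), so the sign of this number decides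
  between the two cases. Passing to the inverse or the negative negates both this sign and
  \<open>fq h\<close>.\<close>

lemma hf_gen:
  assumes x: "x \<in> HR" and h: "isgen x h"
  shows "hf x = (sgn (den h x - 1 / den h x) / gg (fq h)) *\<^sub>R fq h"
proof -
  define k where "k = (SOME M. stabilizer_generator p (of_real x) M)"
  have k: "isgen x k" unfolding k_def by (rule isgen_some[OF x])
  have kr: "k \<in> rst x" using k by (simp add: isgen_def)
  define c where "c = k$2$1"
  have c0: "c \<noteq> 0" using isgen_facts[OF x k] by (simp add: c_def)
  define j where "j = den k x - 1 / den k x"
  have j: "j \<noteq> 0" "c * (x - cj x) = j" using isgen_facts[OF x k] cj_rst(3)[OF x kr] by (simp_all add: j_def c_def)
  have "(k$1$1 + k$2$2)\<^sup>2 - 4 = (k$1$1 + k$2$2)\<^sup>2 - 4 * det2 k" using isgen_facts[OF x k] by simp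
  also have "\<dots> = (k$1$1 - k$2$2)\<^sup>2 + 4 * (k$1$2) * k$2$1" by (simp add: det2_def algebra_simps power2_eq_square)
  also have "\<dots> = (c * (x + cj x))\<^sup>2 - 4 * (c * (x * cj x)) * c"
    using cj_rst(1,2)[OF x kr] by (simp add: c_def)
  also have "\<dots> = (c * (x - cj x))\<^sup>2" by (simp add: algebra_simps power2_eq_square)
  finally have sq: "sqrt ((k$1$1 + k$2$2)\<^sup>2 - 4) = \<bar>j\<bar>" by (simp add: j)
  have "k$1$1 - k$2$2 = c * (x + cj x)" using cj_rst(1)[OF x kr] by (simp add: c_def)
  then have r: "(k$1$1 - k$2$2 + sqrt ((k$1$1 + k$2$2)\<^sup>2 - 4)) / (2 * k$2$1) = (c * (x + cj x) + \<bar>c * (x - cj x)\<bar>) / (2 * c)"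
    unfolding sq c_def[symmetric] by (simp add: j)
  have "x = (c * (x + cj x) + \<bar>c * (x - cj x)\<bar>) / (2 * c) \<longleftrightarrow> j > 0"
  proof (cases "j > 0")
    case True
    then have "\<bar>c * (x - cj x)\<bar> = c * (x - cj x)" using j by simp
    then show ?thesis using True c0 by (simp add: field_simps)
  next
    case False
    then have "\<bar>c * (x - cj x)\<bar> = - (c * (x - cj x))" using j by simp
    then show ?thesis using False c0 cj_neq[OF x] by (simp add: field_simps)
  qed
  then have cond: "(of_real x :: complex) = of_real ((k$1$1 - k$2$2 + sqrt ((k$1$1 + k$2$2)\<^sup>2 - 4)) / (2 * k$2$1)) \<longleftrightarrow> j > 0"
    unfolding r of_real_eq_iff .
  have kZ: "k$2$1 \<in> carrier ZL" "k$2$2 - k$1$1 \<in> carrier ZL" "- (k$1$2) \<in> carrier ZL"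
    using fq_ZL[OF isgen_facts(1)[OF x k]] by (auto simp: fq_def)
  have "hf x = (if j > 0 then (1 / gg (fq k)) *\<^sub>R fq k else - ((1 / gg (fq k)) *\<^sub>R fq k))"
    unfolding hyperbolic_form_def Let_def k_def[symmetric] cond unfolding gg_def fq_def genideal_idl3[OF kZ] by simp
  then have 1: "hf x = (sgn (den k x - 1 / den k x) / gg (fq k)) *\<^sub>R fq k"
    using j(1) by (auto simp: j_def[symmetric] sgn_if)
  have "h \<in> {k, - k, madj k, - madj k}" using isgen_unique[OF x k h] .
  then consider "h = k" | "fq h = - fq k" "den h x - 1 / den h x = - j" | "h = - madj k" by (fastforce simp: fq_neg j_def rst_madj(2)[OF kr])
  then show ?thesis
  proof cases
    case 2
    have g: "gg (- fq k) = gg (fq k)" unfolding gg_def idl3_neg ..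
    show ?thesis unfolding 1 2 g sgn_minus j_def[symmetric]
      by (simp only: minus_divide_left[symmetric] scaleR_minus_left scaleR_minus_right minus_minus)
  next
    case 3
    have "fq h = fq k" unfolding 3 fq_neg by simp
    moreover have "den h x - 1 / den h x = j" unfolding 3 j_def using rst_madj(2)[OF kr] by simp
    ultimately show ?thesis by (simp add: 1 j_def)
  qed (simp add: 1)
qed

lemma gg_pos: assumes x: "x \<in> HR" and h: "isgen x h" shows "gg (fq h) > 0"
proof (cases "principal_domain ZL")
  case True
  have kZ: "h$2$1 \<in> carrier ZL" "h$2$2 - h$1$1 \<in> carrier ZL" "- (h$1$2) \<in> carrier ZL"
    using fq_ZL[OF isgen_facts(1)[OF x h]] by (auto simp: fq_def)
  show ?thesis using positive_generator_idl3(1)[OF True kZ isgen_facts(2)[OF x h]] True by (simp add: gg_def fq_def)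
qed (simp add: gg_def)

text \<open>Conjugation by W carries generators to generators, keeps the factor and does not change
  the coefficient ideal. This equivariance underlies all statements on classes.\<close>

lemma hf_mv:
  assumes x: "x \<in> HR" and W: "W \<in> G" shows "bqf_act (hf (mv W x)) W = hf x"
proof -
  define h where "h = (SOME M. stabilizer_generator p (of_real x) M)"
  have h: "isgen x h" unfolding h_def by (rule isgen_some[OF x])
  have hr: "h \<in> rst x" using h by (simp add: isgen_def)
  define N where "N = W ** h ** madj W"
  have N: "isgen (mv W x) N" "den N (mv W x) = den h x"
    using isgen_conj[OF x W h] mv_conj(2)[OF x W hr] by (simp_all add: N_def)
  have a: "bqf_act (fq N) W = fq h" unfolding N_def using W by (intro bqf_act_conj) simp
  have g: "gg (fq N) = gg (fq h)" unfolding a[symmetric] gg_def idl3_act_eq[OF W] ..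
  show ?thesis unfolding hf_gen[OF HR_mv[OF x W] N(1)] hf_gen[OF x h] bqf_act_scale a N(2) g ..
qed

lemma hf_cj: assumes x: "x \<in> HR" shows "hf (cj x) = - hf x"
proof -
  define h where "h = (SOME M. stabilizer_generator p (of_real x) M)"
  have h: "isgen x h" unfolding h_def by (rule isgen_some[OF x])
  have hr: "h \<in> rst x" using h by (simp add: isgen_def)
  have h': "isgen (cj x) h" using h isgen_cj[OF x] by simp
  have "den h (cj x) - 1 / den h (cj x) = - (den h x - 1 / den h x)" using rst_cj(2)[OF x hr] by simp
  then show ?thesis unfolding hf_gen[OF x h] hf_gen[OF cj_HR[OF x] h'] by (simp only: sgn_minus) simp
qed

definition lead :: "real \<Rightarrow> real" where "lead x = fst (hf x)"

text \<open>The form is l (z - x) (z - x') with l = \<open>lead x\<close>. The sign condition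
  records that x, and not x', is the root (-B + sqrt D) / (2 A).\<close>

lemma hf_coeffs:
  assumes x: "x \<in> HR"
  shows "hf x = (lead x, - lead x * (x + cj x), lead x * (x * cj x))" "lead x * (x - cj x) > 0"
proof -
  define h where "h = (SOME M. stabilizer_generator p (of_real x) M)"
  have h: "isgen x h" unfolding h_def by (rule isgen_some[OF x])
  have hr: "h \<in> rst x" using h by (simp add: isgen_def)
  define r where "r = sgn (den h x - 1 / den h x) / gg (fq h)"
  have e: "hf x = r *\<^sub>R fq h" using hf_gen[OF x h] by (simp add: r_def)
  then have l: "lead x = r * h$2$1" by (simp add: lead_def fq_def)
  have "h$2$2 - h$1$1 = - h$2$1 * (x + cj x)" "- h$1$2 = h$2$1 * (x * cj x)" using cj_rst[OF x hr] by simp_all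
  then show "hf x = (lead x, - lead x * (x + cj x), lead x * (x * cj x))" unfolding e l fq_def by simp
  have "lead x * (x - cj x) = r * (den h x - 1 / den h x)" unfolding l using cj_rst(3)[OF x hr] by simp
  also have "\<dots> = \<bar>den h x - 1 / den h x\<bar> / gg (fq h)" by (simp add: r_def abs_sgn mult.commute)
  also have "\<dots> > 0" using gg_pos[OF x h] isgen_facts(3)[OF x h] by simp
  finally show "lead x * (x - cj x) > 0" .
qed

lemma lead_nonzero: "x \<in> HR \<Longrightarrow> lead x \<noteq> 0"
  using hf_coeffs(2)[of x] by auto

text \<open>Equal coefficients leave y = x or y = x'; the sign condition on the leading coefficient
  excludes the conjugate.\<close>

lemma hf_inj: assumes "x \<in> HR" "y \<in> HR" "hf x = hf y" shows "x = y"
proof -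
  have l: "lead x = lead y" using assms(3) by (simp add: lead_def)
  have e: "x + cj x = y + cj y" "x * cj x = y * cj y"
    using assms hf_coeffs(1)[OF assms(1)] hf_coeffs(1)[OF assms(2)] l lead_nonzero by auto
  have "(y - x) * (y - cj x) = y * y - (x + cj x) * y + x * cj x" by (simp add: algebra_simps)
  also have "\<dots> = 0" unfolding e by (simp add: algebra_simps)
  finally consider "y = x" | "y = cj x" by auto
  then show ?thesis
  proof cases
    case 2
    then have "cj y = x" using e by simp
    then have "lead x * (x - cj x) > 0" "lead x * (cj x - x) > 0" using hf_coeffs(2)[OF assms(1)] hf_coeffs(2)[OF assms(2)] l 2 by auto
    then have False unfolding zero_less_mult_iff by linarith
    then show ?thesis ..
  qed simp
qed

lemma hecke_conjugate_cj: assumes x: "x \<in> HR" shows "hecke_conjugate p (of_real x) = of_real (cj x)"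
proof -
  define l where "l = lead x"
  have l: "l * (x - cj x) > 0" "l \<noteq> 0" using hf_coeffs(2)[OF x] lead_nonzero[OF x] by (auto simp: l_def)
  have "(- l * (x + cj x))\<^sup>2 - 4 * l * (l * (x * cj x)) = (l * (x - cj x))\<^sup>2" by (simp add: algebra_simps power2_eq_square)
  then have "sqrt ((- l * (x + cj x))\<^sup>2 - 4 * l * (l * (x * cj x))) = l * (x - cj x)" using l by simp
  then have "(- (- l * (x + cj x)) - sqrt ((- l * (x + cj x))\<^sup>2 - 4 * l * (l * (x * cj x)))) / (2 * l) = cj x"
    using l by (simp add: field_simps)
  then show ?thesis unfolding hecke_conjugate_def hf_coeffs(1)[OF x] l_def[symmetric] prod.case bqf_disc.simps by (simp only:)
qed

lemma hf_simple: assumes x: "x \<in> HR" shows "simple_form (hf x) \<longleftrightarrow> cj x < 0 \<and> 0 < x"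
proof -
  have l: "lead x * (x - cj x) > 0" by (rule hf_coeffs(2)[OF x])
  show ?thesis unfolding hf_coeffs(1)[OF x] simple_form.simps using l
    by (auto simp: zero_less_mult_iff mult_less_0_iff)
qed

text \<open>In the principal case g divides all coefficients and is a combination of them; dividing
  that combination by g shows primitivity.\<close>

lemma hf_lambda_bqfs: assumes x: "x \<in> HR" shows "hf x \<in> lambda_bqfs p"
proof -
  define h where "h = (SOME M. stabilizer_generator p (of_real x) M)"
  have h: "isgen x h" unfolding h_def by (rule isgen_some[OF x])
  define g where "g = gg (fq h)"
  define \<sigma> where "\<sigma> = sgn (den h x - 1 / den h x)"
  have \<sigma>: "\<sigma> = 1 \<or> \<sigma> = -1" using isgen_facts(3)[OF x h] by (auto simp: \<sigma>_def sgn_if)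
  have \<sigma>Z: "\<sigma> \<in> carrier ZL" "\<sigma> * \<sigma> = 1" using \<sigma> by auto
  obtain a b c where q: "fq h = (a, b, c)" by (cases "fq h")
  have Z: "a \<in> carrier ZL" "b \<in> carrier ZL" "c \<in> carrier ZL" "a \<noteq> 0"
    using fq_ZL[OF isgen_facts(1)[OF x h] q] isgen_facts(2)[OF x h] q by (auto simp: fq_def)
  have g0: "g > 0" using gg_pos[OF x h] by (simp add: g_def)
  have e: "hf x = (\<sigma> * (a / g), \<sigma> * (b / g), \<sigma> * (c / g))"
    using hf_gen[OF x h] by (simp add: q \<sigma>_def g_def q)
  have mem: "a = 1 * a + 0 * b + 0 * c" "b = 0 * a + 1 * b + 0 * c" "c = 0 * a + 0 * b + 1 * c" by simp_all
  have div: "y / g \<in> carrier ZL" if "y \<in> {a, b, c}" for y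
  proof (cases "principal_domain ZL")
    case True
    have "y \<in> idl3 (a, b, c)" using that mem unfolding idl3_def using ZL_01 by blast
    then have "y \<in> PIdl\<^bsub>ZL\<^esub> g" using positive_generator_idl3(3)[OF True Z] True by (simp add: g_def gg_def q)
    then show ?thesis using g0 by (auto simp: cgenideal_def)
  next
    case False then show ?thesis using that Z by (auto simp: g_def gg_def)
  qed
  have ent: "\<sigma> * (a / g) \<in> carrier ZL" "\<sigma> * (b / g) \<in> carrier ZL" "\<sigma> * (c / g) \<in> carrier ZL"
    using div[of a] div[of b] div[of c] ZL_mult[OF \<sigma>Z(1)] by blast+
  have "bqf_disc (hf x) = (lead x * (x - cj x))\<^sup>2"
    unfolding hf_coeffs(1)[OF x] by (simp add: algebra_simps power2_eq_square)
  then have disc: "bqf_disc (hf x) > 0" using hf_coeffs(2)[OF x] zero_less_power by metis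
  have "Idl\<^bsub>ZL\<^esub> {\<sigma> * (a / g), \<sigma> * (b / g), \<sigma> * (c / g)} = carrier ZL" if P: "principal_domain ZL"
  proof -
    have "g \<in> PIdl\<^bsub>ZL\<^esub> g" using positive_generator_idl3(2)[OF P Z] P by (intro ZL.cgenideal_self) (simp add: g_def gg_def q)
    then have "g \<in> idl3 (a, b, c)" using positive_generator_idl3(3)[OF P Z] P by (simp add: g_def gg_def q)
    then obtain u v w where *: "g = u * a + v * b + w * c" "u \<in> carrier ZL" "v \<in> carrier ZL" "w \<in> carrier ZL" by (auto simp: idl3_def)
    have one: "1 = (\<sigma> * u) * (\<sigma> * (a / g)) + (\<sigma> * v) * (\<sigma> * (b / g)) + (\<sigma> * w) * (\<sigma> * (c / g))"
    proof -
      have "(\<sigma> * u) * (\<sigma> * (a / g)) + (\<sigma> * v) * (\<sigma> * (b / g)) + (\<sigma> * w) * (\<sigma> * (c / g)) = (\<sigma> * \<sigma>) * ((u * a + v * b + w * c) / g)"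
        by (simp add: add_divide_distrib algebra_simps)
      then show ?thesis using \<sigma>Z(2) *(1) g0 by simp
    qed
    have "z \<in> idl3 (\<sigma> * (a / g), \<sigma> * (b / g), \<sigma> * (c / g))" if "z \<in> carrier ZL" for z
    proof -
      have "z = z * ((\<sigma> * u) * (\<sigma> * (a / g)) + (\<sigma> * v) * (\<sigma> * (b / g)) + (\<sigma> * w) * (\<sigma> * (c / g)))" using one by simp
      then have "z = (z * (\<sigma> * u)) * (\<sigma> * (a / g)) + (z * (\<sigma> * v)) * (\<sigma> * (b / g)) + (z * (\<sigma> * w)) * (\<sigma> * (c / g))"
        by (simp only: distrib_left mult.assoc)
      moreover have "z * (\<sigma> * u) \<in> carrier ZL" "z * (\<sigma> * v) \<in> carrier ZL" "z * (\<sigma> * w) \<in> carrier ZL" using that * \<sigma>Z by auto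
      ultimately show ?thesis unfolding idl3_def by blast
    qed
    moreover have "idl3 (\<sigma> * (a / g), \<sigma> * (b / g), \<sigma> * (c / g)) \<subseteq> carrier ZL"
    proof -
      have "idl3 (A, B, C) \<subseteq> carrier ZL" if "A \<in> carrier ZL" "B \<in> carrier ZL" "C \<in> carrier ZL" for A B C
        using that by (auto simp: idl3_def)
      then show ?thesis using ent by blast
    qed
    ultimately show ?thesis unfolding genideal_idl3[OF ent] by blast
  qed
  then show ?thesis using ent disc unfolding lambda_bqfs_def e by simp
qed

section \<open>Classes of forms as orbits of points\<close>

lemma equiv_hecke: "equiv (lambda_bqfs p) (hecke_equiv p)"
proof (rule equivI)
  show "hecke_equiv p \<subseteq> lambda_bqfs p \<times> lambda_bqfs p" by (auto simp: hecke_equiv_def)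
  show "refl_on (lambda_bqfs p) (hecke_equiv p)"
    by (rule refl_onI) (auto simp: hecke_equiv_def intro!: bexI[of _ "mat 1"])
  show "sym (hecke_equiv p)"
  proof (rule symI)
    fix P Q assume "(P, Q) \<in> hecke_equiv p"
    then obtain W where W: "W \<in> G" "Q = bqf_act P W" "P \<in> lambda_bqfs p" "Q \<in> lambda_bqfs p" by (auto simp: hecke_equiv_def)
    then have "P = bqf_act Q (madj W)" using madj_mult(2)[of W] by (simp add: bqf_act_mult)
    then show "(Q, P) \<in> hecke_equiv p" using W(3,4) G_madj[OF W(1)] unfolding hecke_equiv_def by blast
  qed
  show "trans (hecke_equiv p)"
  proof (rule transI)
    fix P Q R assume "(P, Q) \<in> hecke_equiv p" "(Q, R) \<in> hecke_equiv p"
    then obtain W W' where W: "W \<in> G" "Q = bqf_act P W" "W' \<in> G" "R = bqf_act Q W'" "P \<in> lambda_bqfs p" "R \<in> lambda_bqfs p"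
      unfolding hecke_equiv_def mem_Collect_eq prod.case by blast
    then have "R = bqf_act P (W ** W')" by (simp only: bqf_act_mult)
    then show "(P, R) \<in> hecke_equiv p" using W unfolding hecke_equiv_def by blast
  qed
qed

definition same_orbit :: "real \<Rightarrow> real \<Rightarrow> bool" where
  "same_orbit x y \<longleftrightarrow> (\<exists>W\<in>G. y = mv W x)"

lemma same_orbit_iff: assumes x: "x \<in> HR" and y: "y \<in> HR"
  shows "(hf x, hf y) \<in> hecke_equiv p \<longleftrightarrow> same_orbit x y"
proof
  assume "(hf x, hf y) \<in> hecke_equiv p"
  then obtain W where W: "W \<in> G" "hf y = bqf_act (hf x) W" by (auto simp: hecke_equiv_def)
  have "bqf_act (hf (mv W (mv (madj W) x))) W = hf (mv (madj W) x)"
    by (rule hf_mv[OF HR_mv[OF x G_madj[OF W(1)]] W(1)])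
  then have "hf y = hf (mv (madj W) x)" using W HR_mv_madj(2)[OF x W(1)] by simp
  then have "y = mv (madj W) x" using hf_inj[OF y HR_mv[OF x G_madj[OF W(1)]]] by simp
  then show "same_orbit x y" using W by (auto simp: same_orbit_def)
next
  assume "same_orbit x y"
  then obtain W where W: "W \<in> G" "y = mv W x" by (auto simp: same_orbit_def)
  have "bqf_act (hf y) W = hf x" using hf_mv[OF x W(1)] W by simp
  then have "bqf_act (hf x) (madj W) = bqf_act (hf y) (W ** madj W)" by (simp only: bqf_act_mult[symmetric])
  then have "hf y = bqf_act (hf x) (madj W)" using madj_mult(2)[of W] W by simp
  then show "(hf x, hf y) \<in> hecke_equiv p" using G_madj[OF W(1)] hf_lambda_bqfs[OF x] hf_lambda_bqfs[OF y]
    unfolding hecke_equiv_def by blast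
qed

lemma class_orbit:
  assumes A: "\<A> \<in> hyperbolic_classes p" and x: "x \<in> HR" "hf x \<in> \<A>" and y: "y \<in> HR"
  shows "hf y \<in> \<A> \<longleftrightarrow> same_orbit x y"
proof -
  have q: "\<A> \<in> lambda_bqfs p // hecke_equiv p" using A by (simp add: hyperbolic_classes_def)
  show ?thesis unfolding same_orbit_iff[OF x(1) y, symmetric]
    using in_quotient_imp_in_rel[OF equiv_hecke q] in_quotient_imp_closed[OF equiv_hecke q x(2)] x(2) by blast
qed

lemma class_exists:
  assumes x: "x \<in> HR" shows "hecke_equiv p `` {hf x} \<in> hyperbolic_classes p" "hf x \<in> hecke_equiv p `` {hf x}"
proof -
  show "hf x \<in> hecke_equiv p `` {hf x}" using equiv_class_self[OF equiv_hecke hf_lambda_bqfs[OF x]] .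
  have "Q \<in> hyperbolic_forms p" if "(hf x, Q) \<in> hecke_equiv p" for Q
  proof -
    obtain W where W: "W \<in> G" "Q = bqf_act (hf x) W" using \<open>(hf x, Q) \<in> hecke_equiv p\<close>
      unfolding hecke_equiv_def mem_Collect_eq prod.case by blast
    have "bqf_act (hf (mv W (mv (madj W) x))) W = hf (mv (madj W) x)"
      by (rule hf_mv[OF HR_mv[OF x G_madj[OF W(1)]] W(1)])
    then have "Q = hf (mv (madj W) x)" using W HR_mv_madj(2)[OF x W(1)] by simp
    then show ?thesis using HR_mv[OF x G_madj[OF W(1)]] unfolding hyperbolic_forms_def hyperbolic_fixed_points_real by blast
  qed
  then show "hecke_equiv p `` {hf x} \<in> hyperbolic_classes p"
    using quotientI[OF hf_lambda_bqfs[OF x]] unfolding hyperbolic_classes_def by blast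
qed

lemma class_unique:
  assumes "\<A> \<in> hyperbolic_classes p" "\<B> \<in> hyperbolic_classes p" "Q \<in> \<A>" "Q \<in> \<B>" shows "\<A> = \<B>"
  using assms quotient_disj[OF equiv_hecke, of \<A> \<B>] unfolding hyperbolic_classes_def by blast

lemma class_nonempty: "\<A> \<in> hyperbolic_classes p \<Longrightarrow> Q \<in> \<A> \<Longrightarrow> \<exists>x\<in>HR. Q = hf x"
  unfolding hyperbolic_classes_def hyperbolic_forms_def hyperbolic_fixed_points_real by blast

text \<open>The group commutes with conjugation and is transitive on the points of a class, so one
  conjugate pair inside the class is enough.\<close>

lemma class_symmetric:
  assumes A: "\<A> \<in> hyperbolic_classes p" and x: "x \<in> HR" "hf x \<in> \<A>" and c: "hf (cj x) \<in> \<A>"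
  shows "uminus ` \<A> = \<A>"
proof -
  have 1: "- Q \<in> \<A>" if Q: "Q \<in> \<A>" for Q
  proof -
    obtain y where y: "y \<in> HR" "Q = hf y" using class_nonempty[OF A Q] by blast
    then obtain W where W: "W \<in> G" "y = mv W x" using class_orbit[OF A x y(1)] Q by (auto simp: same_orbit_def)
    then have "same_orbit (cj x) (cj y)" using mv_cj[OF x(1) W(1)] unfolding same_orbit_def by metis
    then have "hf (cj y) \<in> \<A>" using class_orbit[OF A cj_HR[OF x(1)] c cj_HR[OF y(1)]] by simp
    then show ?thesis using hf_cj y by simp
  qed
  show ?thesis
  proof
    show "uminus ` \<A> \<subseteq> \<A>" using 1 by blast
    show "\<A> \<subseteq> uminus ` \<A>" using 1 by (metis image_iff minus_minus subsetI)
  qed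
qed

lemma same_orbit_mv: "x \<in> HR \<Longrightarrow> W \<in> G \<Longrightarrow> same_orbit x (mv W x)"
  by (auto simp: same_orbit_def)

lemma class_mv: "\<A> \<in> hyperbolic_classes p \<Longrightarrow> x \<in> HR \<Longrightarrow> W \<in> G \<Longrightarrow> hf (mv W x) \<in> \<A> \<longleftrightarrow> hf x \<in> \<A>"
proof -
  assume *: "\<A> \<in> hyperbolic_classes p" "x \<in> HR" "W \<in> G"
  have y: "mv W x \<in> HR" using HR_mv * by blast
  have "same_orbit x (mv W x)" "same_orbit (mv W x) x"
    using same_orbit_mv[OF *(2,3)] same_orbit_mv[OF y G_madj[OF *(3)]] HR_mv_madj(1)[OF *(2,3)] by simp_all
  then show ?thesis using class_orbit[OF *(1,2) _ y] class_orbit[OF *(1) y _ *(2)] by blast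
qed

lemma class_cj: "\<A> \<in> hyperbolic_classes p \<Longrightarrow> uminus ` \<A> = \<A> \<Longrightarrow> x \<in> HR \<Longrightarrow> hf (cj x) \<in> \<A> \<longleftrightarrow> hf x \<in> \<A>"
proof -
  assume *: "uminus ` \<A> = \<A>" "x \<in> HR"
  have "- Q \<in> \<A>" if "Q \<in> \<A>" for Q using that *(1) by blast
  from this[of "hf x"] this[of "- hf x"] show ?thesis unfolding hf_cj[OF *(2)] by auto
qed

definition ZR :: "bqf set \<Rightarrow> real set" where
  "ZR \<A> = {x \<in> HR. hf x \<in> \<A> \<and> cj x < 0 \<and> 0 < x}"

lemma Z_set_ZR: "Z_set p \<A> = of_real ` ZR \<A>"
  unfolding Z_set_def ZR_def hyperbolic_fixed_points_real using hf_simple by blast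


subsection \<open>Orbits of U and reduction\<close>

text \<open>The points of a \<open>U\<close>-orbit are quotients of consecutive terms of the
  sequence \<open>den (Um j) x\<close>, see \<open>mv_Um\<close>. The sequence runs from 1 at j = 0
  to -1 at j = p; this recursion shows that it changes sign only once.\<close>

lemma den_Um_step: "den (Um (j + 1)) x * s j - den (Um j) x * s (j + 1) = - 1"
  using s_det[of j] by (simp add: den_def algebra_simps)

lemma mv_Um: "mv (Um j) x = den (Um (j + 1)) x / den (Um j) x"
  by (simp add: mv_def den_def[of "Um (j + 1)"])

lemma den_Um_0 [simp]: "den (Um 0) x = 1" and den_Um_p [simp]: "den (Um (int p)) x = - 1"
  by simp_all

lemma den_Um_neg_step:
  assumes "1 \<le> j" "j < int p" "den (Um j) x < 0" shows "den (Um (j + 1)) x < 0"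
proof -
  have "den (Um (j + 1)) x * s j = den (Um j) x * s (j + 1) - 1" using den_Um_step[of j x] by linarith
  moreover have "den (Um j) x * s (j + 1) \<le> 0" using s_nonneg[of "j + 1"] assms by (intro mult_nonpos_nonneg) auto
  ultimately have "den (Um (j + 1)) x * s j < 0" by linarith
  then show ?thesis using s_ge_one[of j] assms by (simp add: mult_less_0_iff)
qed

lemma den_Um_neg_mono:
  assumes "1 \<le> i" "i \<le> j" "j \<le> int p" "den (Um i) x < 0" shows "den (Um j) x < 0"
  using assms(2,3)
proof (induction j rule: int_ge_induct)
  case base then show ?case using assms by simp
next
  case (step j) then show ?case using den_Um_neg_step[of j x] assms by auto
qed

text \<open>If n is the first index with a negative denominator, the quotient of the terms n and n -
  1 is negative; it is the orbit point of index n - 1.\<close>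

lemma U_neg_exists:
  assumes x: "x \<in> HR" obtains j where "0 \<le> j" "j < int p" "mv (Um j) x < 0"
proof -
  define n where "n = (LEAST n. den (Um (int n)) x < 0)"
  have n: "den (Um (int n)) x < 0" unfolding n_def by (rule LeastI[of _ p]) simp
  have np: "n \<le> p" unfolding n_def by (rule Least_le) simp
  have n0: "n \<noteq> 0" using n by (metis den_Um_0 of_nat_0 not_one_less_zero)
  have "\<not> den (Um (int (n - 1))) x < 0" using not_less_Least[of "n - 1" "\<lambda>n. den (Um (int n)) x < 0"] n0 unfolding n_def[symmetric] by simp
  moreover have "den (Um (int (n - 1))) x \<noteq> 0" using HR_den[OF x] by blast
  ultimately have "den (Um (int (n - 1))) x > 0" by linarith
  moreover have "int (n - 1) + 1 = int n" using n0 by simp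
  ultimately have "mv (Um (int (n - 1))) x < 0" using n mv_Um[of "int (n - 1)" x] by (simp add: divide_neg_pos)
  then show ?thesis using that[of "int (n - 1)"] np n0 by simp
qed

text \<open>A negative orbit point marks a passage of the denominators from positive to negative,
  and once negative they stay so up to index p.\<close>

lemma U_neg_unique:
  assumes "0 \<le> i" "i < int p" "mv (Um i) x < 0" "0 \<le> j" "j < int p" "mv (Um j) x < 0"
  shows "i = j"
proof -
  have sgn: "den (Um (i + 1)) x < 0 \<and> den (Um i) x > 0" if "0 \<le> i" "i < int p" "mv (Um i) x < 0" for i
  proof (cases "den (Um i) x < 0")
    case True
    then have "i \<noteq> 0" by auto
    then have "den (Um (i + 1)) x < 0" using den_Um_neg_step[of i x] True that by simp
    then show ?thesis using True that(3) by (simp add: mv_Um divide_less_0_iff)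
  next
    case False then show ?thesis using that(3) by (auto simp: mv_Um divide_less_0_iff)
  qed
  have no: "\<not> i < j" if "0 \<le> i" "i < int p" "mv (Um i) x < 0" "0 \<le> j" "j < int p" "mv (Um j) x < 0" for i j
  proof
    assume "i < j"
    then have "den (Um j) x < 0" using den_Um_neg_mono[of "i + 1" j x] sgn[OF that(1-3)] that by auto
    then show False using sgn[OF that(4-6)] by simp
  qed
  show ?thesis using no[OF assms] no[OF assms(4-6) assms(1-3)] by linarith
qed

lemma mv_Tm: "mv Tm x = - 1 / x"
  by (simp add: mv_def den_def)

lemma HR_T: "x \<in> HR \<Longrightarrow> mv Tm x \<in> HR"
  by (rule HR_mv) auto

lemma mv_T_T: "x \<in> HR \<Longrightarrow> mv Tm (mv Tm x) = x"
  using HR_nonzero by (simp add: mv_Tm)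

lemma cj_T: "x \<in> HR \<Longrightarrow> cj (mv Tm x) = mv Tm (cj x)"
  using mv_cj[of x Tm] by simp

lemma mv_V: "x \<in> HR \<Longrightarrow> mv (V j) x = mv (Um j) (mv Tm x)"
  unfolding V_Um(1) den_mv_simps by (rule HR_mv_mult) auto

lemma mv_Um_Um: "x \<in> HR \<Longrightarrow> mv (Um i) (mv (Um j) x) = mv (Um (i + j)) x"
  by (simp add: HR_mv_mult flip: Um_add)

text \<open>Turning the common image z back by the powers p - i and p - j of \<open>U\<close> gives
  \<open>T x\<close> and \<open>T y\<close>, both negative. A \<open>U\<close>-orbit has only one
  negative point.\<close>

lemma V_inj:
  assumes x: "x \<in> HR" "x > 0" and y: "y \<in> HR" "y > 0" and i: "1 \<le> i" "i < int p" and j: "1 \<le> j" "j < int p"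
    and e: "mv (V i) x = mv (V j) y"
  shows "i = j" "x = y"
proof -
  define z where "z = mv (V i) x"
  have *: "mv (Um (int p - i)) (mv (V i) x) = mv Tm x" if "x \<in> HR" for x i
    using mv_Um_Um[of "mv Tm x" "int p - i" i] that HR_T by (simp add: mv_V)
  have 1: "mv (Um (int p - i)) z = mv Tm x" "mv (Um (int p - j)) z = mv Tm y"
    using *[OF x(1), of i] *[OF y(1), of j] unfolding z_def e by simp_all
  have "int p - i = int p - j"
    by (rule U_neg_unique[of _ z]) (use 1 x y i j in \<open>simp_all add: mv_Tm\<close>)
  then show "i = j" by simp
  then have "mv Tm x = mv Tm y" using 1 by simp
  then show "x = y" using mv_T_T x y by metis
qed

section \<open>Simple points and words connecting them\<close>

definition simple :: "real \<Rightarrow> bool" where "simple x \<longleftrightarrow> x \<in> HR \<and> cj x < 0 \<and> 0 < x"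

lemma ZR_simple: "x \<in> ZR \<A> \<longleftrightarrow> simple x \<and> hf x \<in> \<A>"
  by (auto simp: ZR_def simple_def)

text \<open>Both conjugates are negative points of the \<open>U\<close>-orbit of
  \<open>mv Tm (cj x)\<close>.\<close>

lemma simple_V_index:
  assumes "simple x" "simple (mv (V i) x)" "1 \<le> i" "i < int p" "simple (mv (V j) x)" "1 \<le> j" "j < int p"
  shows "i = j"
proof (rule U_neg_unique)
  have x: "x \<in> HR" using assms by (simp add: simple_def)
  have "cj (mv (V i) x) = mv (Um i) (mv Tm (cj x))" for i
    using mv_cj[OF x, of "V i"] mv_V[OF cj_HR[OF x]] by simp
  then show "mv (Um i) (mv Tm (cj x)) < 0" "mv (Um j) (mv Tm (cj x)) < 0" using assms by (auto simp: simple_def)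
qed (use assms in auto)

lemma Mon_pos:
  assumes W: "W \<in> Mon" and x: "x \<in> HR" "x > 0" shows "mv W x > 0"
proof -
  have n: "W$1$1 \<ge> 0" "W$1$2 \<ge> 0" "W$2$1 \<ge> 0" "W$2$2 \<ge> 0" using Mon_entries[OF W] by (auto simp: nn_discrete_def)
  then have "mv W x \<ge> 0" using x by (simp add: mv_def den_def)
  moreover have "mv W x \<noteq> 0" using HR_nonzero HR_mv[OF x(1)] W by blast
  ultimately show ?thesis by linarith
qed

text \<open>If the conjugate of x were positive, the nonnegative W would keep it positive.
  Simplicity therefore descends from the end of a word to every earlier point.\<close>

lemma simple_intermediate:
  assumes W: "W \<in> Mon" and x: "x \<in> HR" "x > 0" and y: "simple (mv W x)" shows "simple x"
proof -
  have "\<not> cj x > 0"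
    using Mon_pos[OF W cj_HR[OF x(1)]] mv_cj[OF x(1), of W] y W by (auto simp: simple_def)
  then show ?thesis using HR_nonzero(2)[OF x(1)] x by (auto simp: simple_def)
qed

lemma Mon_simple_induct:
  assumes step: "\<And>d i. simple d \<Longrightarrow> 1 \<le> i \<Longrightarrow> i < int p \<Longrightarrow> simple (mv (V i) d) \<Longrightarrow> hf d \<in> \<A> \<Longrightarrow> P d = P (mv (V i) d)"
    and A: "\<A> \<in> hyperbolic_classes p"
    and W: "W \<in> Mon" and x: "simple x" "hf x \<in> \<A>" and y: "simple (mv W x)"
  shows "P x = P (mv W x)"
  using W y
proof (induction rule: Mon.induct)
  case Mon_one then show ?case by simp
next
  case (Mon_step W j)
  have xH: "x \<in> HR" "x > 0" using x by (auto simp: simple_def)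
  define z where "z = mv W x"
  have z: "z \<in> HR" "z > 0" using HR_mv xH Mon_pos Mon_step(1) by (auto simp: z_def)
  have e: "mv (V j ** W) x = mv (V j) z" using HR_mv_mult[OF xH(1)] Mon_step(1) by (auto simp: z_def)
  have sz: "simple z" using simple_intermediate[OF Mon_V[of j] z] Mon_step e by simp
  have "hf z \<in> \<A>" unfolding z_def using class_mv[OF A xH(1)] Mon_step(1) x by blast
  then have "P z = P (mv (V j) z)" using step[OF sz Mon_step(2,3)] Mon_step e by simp
  then show ?case using Mon_step.IH sz e by (simp add: z_def)
qed

lemma transpose_entries [simp]: "transpose M$i$j = M$j$i"
  by (simp add: transpose_def)

text \<open>Transposition reverses the word and replaces the letter j by p - j.\<close>

lemma Mon_transpose: "W \<in> Mon \<Longrightarrow> transpose W \<in> Mon"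
proof (induction rule: Mon.induct)
  case Mon_one then show ?case by (simp add: Mon.Mon_one)
next
  case (Mon_step W j)
  have "transpose (V j) = V (int p - j)"
    using s_diff_p[of j] s_diff_p[of "j - 1"] s_diff_p[of "j + 1"] by (intro mtx_eqI) (simp_all add: algebra_simps)
  then show ?case using Mon_mult[OF Mon_step(4) Mon_V[of "int p - j"]] Mon_step by (simp add: matrix_transpose_mul)
qed

lemma Tm_conj: "madj (Tm ** W ** Tm) = - transpose W"
  by (rule mtx_eqI) simp_all

text \<open>The reduction theory: two simple points of one orbit are connected by a word in the matrices
  \<open>V j\<close>, all of whose intermediate points are simple.\<close>

lemma simple_class_connected:
  assumes step: "\<And>d i. simple d \<Longrightarrow> 1 \<le> i \<Longrightarrow> i < int p \<Longrightarrow> simple (mv (V i) d) \<Longrightarrow> hf d \<in> \<A> \<Longrightarrow> P d = P (mv (V i) d)"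
    and A: "\<A> \<in> hyperbolic_classes p" and x: "x \<in> ZR \<A>" and y: "y \<in> ZR \<A>"
  shows "P x = P y"
proof -
  have sx: "simple x" "hf x \<in> \<A>" and sy: "simple y" "hf y \<in> \<A>" using x y by (auto simp: ZR_simple)
  have xH: "x \<in> HR" "x > 0" "cj x \<in> HR" "cj x < 0" and yH: "y \<in> HR" "y > 0" "cj y < 0"
    using sx sy cj_HR by (auto simp: simple_def)
  obtain M where M: "M \<in> G" "y = mv M x" using class_orbit[OF A xH(1) sx(2) yH(1)] sy by (auto simp: same_orbit_def)
  obtain W where W: "W \<in> Mon" "M \<in> {W, Tm ** W, W ** Tm, Tm ** W ** Tm} \<or> - M \<in> {W, Tm ** W, W ** Tm, Tm ** W ** Tm}"
    using G_cases[OF M(1)] by blast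
  have WG: "W \<in> G" using W(1) by blast
  obtain N where N: "N \<in> {W, Tm ** W, W ** Tm, Tm ** W ** Tm}" "mv N x = y" "N \<in> G"
  proof (cases "M \<in> {W, Tm ** W, W ** Tm, Tm ** W ** Tm}")
    case True then show ?thesis using that M by blast
  next
    case False then show ?thesis using that[of "- M"] M W(2) by simp
  qed
  \<comment> \<open>A single \<open>Tm\<close> is impossible: on the left it makes y negative, on
    the right it makes the conjugate of y positive. With \<open>Tm\<close> on both sides the inverse
    is, up to sign, a word leading from y back to x.\<close>
  consider "N = W" | "N = Tm ** W" | "N = W ** Tm" | "N = Tm ** W ** Tm" using N(1) by blast
  then show ?thesis
  proof cases
    case 1
    then show ?thesis using Mon_simple_induct[OF step A W(1) sx] N sy by simp
  next
    case 2
    then have "y = mv Tm (mv W x)" using HR_mv_mult[OF xH(1) WG] N by simp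
    then have "y < 0" using Mon_pos[OF W(1) xH(1,2)] by (simp add: mv_Tm)
    then show ?thesis using yH by simp
  next
    case 3
    have "cj y = mv N (cj x)" using mv_cj[OF xH(1) N(3)] N(2) by simp
    also have "\<dots> = mv W (mv Tm (cj x))" unfolding 3 by (rule HR_mv_mult[OF xH(3) G_T])
    finally have "cj y > 0" using Mon_pos[OF W(1) HR_T[OF xH(3)]] xH(4) by (simp add: mv_Tm)
    then show ?thesis using yH by simp
  next
    case 4
    have "x = mv (madj N) y" using HR_mv_madj(1)[OF xH(1) N(3)] N(2) by simp
    then have "x = mv (transpose W) y" unfolding 4 Tm_conj by simp
    then show ?thesis using Mon_simple_induct[OF step A Mon_transpose[OF W(1)] sy] sx by simp
  qed
qed

lemma Mon_diag: "W \<in> Mon \<Longrightarrow> W$1$1 \<ge> 1 \<and> W$2$2 \<ge> 1"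
proof (induction rule: Mon.induct)
  case (Mon_step W j)
  have n: "W$1$2 \<ge> 0" "W$2$1 \<ge> 0" using Mon_entries[OF Mon_step(1)] by (auto simp: nn_discrete_def)
  have "s j \<ge> 1" "s (j - 1) \<ge> 0" "s (j + 1) \<ge> 0" using Mon_step s_ge_one s_nonneg by auto
  moreover then have "1 * 1 \<le> s j * W$1$1" "1 * 1 \<le> s j * W$2$2" using Mon_step by (intro mult_mono; simp)+
  moreover have "s (j + 1) * W$2$1 \<ge> 0" "s (j - 1) * W$1$2 \<ge> 0" using calculation n by simp_all
  ultimately show ?case by simp
qed simp

text \<open>As p \<ge> 3, j cannot be both 1 and p - 1, so \<open>V j\<close> has a positive
  off-diagonal entry. Multiplied by a diagonal entry of W it survives, since nothing can cancel
  among nonnegative terms.\<close>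

lemma Mon_step_nontrivial:
  assumes "W \<in> Mon" "1 \<le> j" "j < int p" shows "V j ** W \<noteq> mat 1" "V j ** W \<noteq> - mat 1"
proof -
  have n: "W$1$2 \<ge> 0" "W$2$1 \<ge> 0" using Mon_entries[OF assms(1)] by (auto simp: nn_discrete_def)
  have s: "s j \<ge> 0" "s (j - 1) \<ge> 0" "s (j + 1) \<ge> 0" using assms s_nonneg by auto
  have d: "W$1$1 \<ge> 1" "W$2$2 \<ge> 1" using Mon_diag assms by auto
  have "s (j + 1) \<ge> 1 \<or> s (j - 1) \<ge> 1" using assms s_ge_one[of "j + 1"] s_ge_one[of "j - 1"] p3 by (cases "j + 1 < int p") auto
  then have "s (j + 1) * W$2$2 > 0 \<or> s (j - 1) * W$1$1 > 0" using d by auto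
  moreover have "s j * W$1$2 \<ge> 0" "s j * W$2$1 \<ge> 0" "s (j + 1) * W$2$2 \<ge> 0" "s (j - 1) * W$1$1 \<ge> 0" using s n d by simp_all
  ultimately have "(V j ** W)$1$2 > 0 \<or> (V j ** W)$2$1 > 0" by auto
  then show "V j ** W \<noteq> mat 1" "V j ** W \<noteq> - mat 1" by (metis less_irrefl one_entries(2,3), auto simp del: mult_entries)
qed

text \<open>A nontrivial stabilizer element is hyperbolic, so its off-diagonal entries b and c are
  positive here, and x x' = - b / c is negative.\<close>

lemma Mon_fixed_simple:
  assumes x: "x \<in> HR" "x > 0" and W: "W \<in> Mon" "W \<noteq> mat 1" "W \<noteq> - mat 1" and f: "mv W x = x"
  shows "simple x" "\<bar>den W x\<bar> \<noteq> 1"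
proof -
  have r: "W \<in> rst x" using W f HR_den[OF x(1)] by (auto simp: rst_def rfix_def)
  show d: "\<bar>den W x\<bar> \<noteq> 1" using rst_abs_den_one[OF x(1) r] W by blast
  then have "W$2$1 \<noteq> 0" "W$1$2 \<noteq> 0" using G_upper(3)[OF rst_G[OF r]] rst_hyperbolic[OF r] by auto
  moreover have "W$2$1 \<ge> 0" "W$1$2 \<ge> 0" using Mon_entries[OF W(1)] by (auto simp: nn_discrete_def)
  ultimately have n: "W$2$1 > 0" "W$1$2 > 0" by linarith+
  have "W$2$1 * x * cj x < 0" using cj_rst(2)[OF x(1) r] n by (simp add: mult.assoc)
  then have "cj x < 0" using n x by (simp add: mult_less_0_iff)
  then show "simple x" using x by (simp add: simple_def)
qed

text \<open>The map sending x to the conjugate of \<open>T x\<close> is an involution of the simple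
  points of a symmetric class, and f changes sign under conjugation.\<close>

lemma ZR_T_sum:
  fixes f :: "real \<Rightarrow> complex"
  assumes A: "\<A> \<in> hyperbolic_classes p" "uminus ` \<A> = \<A>" and f: "\<And>x. x \<in> HR \<Longrightarrow> f (cj x) = - f x"
  shows "(\<Sum>x\<in>ZR \<A>. f (mv Tm x)) = - (\<Sum>x\<in>ZR \<A>. f x)"
proof -
  define \<phi> where "\<phi> x = cj (mv Tm x)" for x
  have m: "\<phi> x \<in> ZR \<A>" "\<phi> (\<phi> x) = x" "f (mv Tm x) = - f (\<phi> x)" if "x \<in> ZR \<A>" for x
  proof -
    have x: "x \<in> HR" "x > 0" "cj x < 0" "hf x \<in> \<A>" using that by (auto simp: ZR_def)
    have T: "mv Tm x \<in> HR" "hf (mv Tm x) \<in> \<A>" using HR_T class_mv[OF A(1) x(1), of Tm] x by auto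
    show "\<phi> (\<phi> x) = x" using x T
      unfolding \<phi>_def by (metis cj_cj cj_T mv_T_T cj_HR)
    show "f (mv Tm x) = - f (\<phi> x)" using f[OF T(1)] by (simp add: \<phi>_def)
    have "cj (\<phi> x) = mv Tm x" using cj_cj T by (simp add: \<phi>_def)
    moreover have "\<phi> x = mv Tm (cj x)" using cj_T x by (simp add: \<phi>_def)
    ultimately show "\<phi> x \<in> ZR \<A>" using x T cj_HR[OF T(1)] class_cj[OF A T(1)] unfolding ZR_def \<phi>_def
      by (simp add: mv_Tm divide_neg_pos)
  qed
  have "(\<Sum>x\<in>ZR \<A>. f (mv Tm x)) = (\<Sum>x\<in>ZR \<A>. - f x)"
    by (rule sum.reindex_bij_witness[of _ \<phi> \<phi>]) (use m in auto)
  then show ?thesis by (simp add: sum_negf)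
qed

text \<open>An orbit of \<open>U\<close> contains exactly one negative point, so it meets the simple points of a
  class in at most one point, and exactly when \<open>w\<close> and its conjugate become negative at different
  places. This condition is symmetric in \<open>w\<close> and its conjugate.\<close>

lemma ZR_U_sum:
  fixes f :: "real \<Rightarrow> complex"
  assumes A: "\<A> \<in> hyperbolic_classes p" "uminus ` \<A> = \<A>" and f: "\<And>x. x \<in> HR \<Longrightarrow> f (cj x) = - f x"
    and fin: "finite (ZR \<A>)"
  shows "(\<Sum>j\<in>{0..<int p}. \<Sum>x\<in>ZR \<A>. f (mv (Um (- j)) x)) = 0"
proof -
  \<comment> \<open>X is the set of all summation points of the double sum. The index j, hence the
    pair (j, x), is recovered from w as the place where the conjugate becomes negative.\<close>
  define X where "X = {w \<in> HR. hf w \<in> \<A> \<and> (\<exists>j\<in>{0..<int p}. mv (Um j) w > 0 \<and> mv (Um j) (cj w) < 0)}"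
  define \<phi> where "\<phi> = (\<lambda>(j, x). mv (Um (- j)) x)"
  have cancel: "mv (Um j) (mv (Um (- j)) x) = x" "mv (Um (- j)) (mv (Um j) x) = x" if "x \<in> HR" for x j
    using mv_Um_Um[OF that, of j "- j"] mv_Um_Um[OF that, of "- j" j] by simp_all
  have inj: "inj_on \<phi> ({0..<int p} \<times> ZR \<A>)"
  proof (rule inj_onI, clarify)
    fix i x j y assume i: "i \<in> {0..<int p}" "x \<in> ZR \<A>" and j: "j \<in> {0..<int p}" "y \<in> ZR \<A>"
      and e: "\<phi> (i, x) = \<phi> (j, y)"
    have x: "x \<in> HR" "cj x < 0" and y: "y \<in> HR" "cj y < 0" using i j by (auto simp: ZR_def)
    define w where "w = \<phi> (i, x)"
    have w: "w \<in> HR" "mv (Um i) w = x" "mv (Um j) w = y"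
    proof -
      show "w \<in> HR" using HR_mv x by (simp add: w_def \<phi>_def)
      show "mv (Um i) w = x" using cancel(1)[OF x(1)] by (simp add: w_def \<phi>_def)
      show "mv (Um j) w = y" unfolding w_def e using cancel(1)[OF y(1)] by (simp add: \<phi>_def)
    qed
    have "mv (Um i) (cj w) < 0" "mv (Um j) (cj w) < 0" using mv_cj[OF w(1)] w x y by auto
    then show "i = j \<and> x = y" using U_neg_unique[of i "cj w" j] i j w by auto
  qed
  have img: "\<phi> ` ({0..<int p} \<times> ZR \<A>) = X"
  proof
    show "\<phi> ` ({0..<int p} \<times> ZR \<A>) \<subseteq> X"
    proof clarify
      fix j x assume j: "j \<in> {0..<int p}" "x \<in> ZR \<A>"
      have x: "x \<in> HR" "cj x < 0" "x > 0" "hf x \<in> \<A>" using j by (auto simp: ZR_def)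
      define w where "w = mv (Um (- j)) x"
      have w: "w \<in> HR" "mv (Um j) w = x" "hf w \<in> \<A>" using x cancel HR_mv class_mv[OF A(1) x(1)] by (auto simp: w_def)
      moreover have "mv (Um j) (cj w) < 0" using mv_cj[OF w(1)] w x by auto
      ultimately have "w \<in> X" using j(1) x unfolding X_def by auto
      then show "\<phi> (j, x) \<in> X" by (simp add: \<phi>_def w_def)
    qed
    show "X \<subseteq> \<phi> ` ({0..<int p} \<times> ZR \<A>)"
    proof
      fix w assume "w \<in> X"
      then obtain j where w: "w \<in> HR" "hf w \<in> \<A>" "j \<in> {0..<int p}" "mv (Um j) w > 0" "mv (Um j) (cj w) < 0" by (auto simp: X_def)
      then have "mv (Um j) w \<in> ZR \<A>" using HR_mv class_mv[OF A(1) w(1)] mv_cj[OF w(1)] by (auto simp: ZR_def)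
      moreover have "w = \<phi> (j, mv (Um j) w)" using cancel[OF w(1)] by (simp add: \<phi>_def)
      ultimately show "w \<in> \<phi> ` ({0..<int p} \<times> ZR \<A>)" using w(3) by blast
    qed
  qed
  \<comment> \<open>At the place i where w itself becomes negative its conjugate is positive,
    because the only negative place of the conjugate is j \<noteq> i. So i is the index required for
    the conjugate.\<close>
  have cX: "cj w \<in> X" if "w \<in> X" for w
  proof -
    obtain j where w: "w \<in> HR" "hf w \<in> \<A>" "j \<in> {0..<int p}" "mv (Um j) w > 0" "mv (Um j) (cj w) < 0" using \<open>w \<in> X\<close> by (auto simp: X_def)
    obtain i where i: "0 \<le> i" "i < int p" "mv (Um i) w < 0" using U_neg_exists[OF w(1)] .
    have "i \<noteq> j" using i w by auto
    then have "\<not> mv (Um i) (cj w) < 0" using U_neg_unique[of i "cj w" j] i w by auto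
    moreover have "mv (Um i) (cj w) \<noteq> 0" using HR_nonzero(1)[OF HR_mv[OF cj_HR[OF w(1)] G_Um]] .
    ultimately have "mv (Um i) (cj w) > 0" by linarith
    then show ?thesis using w i cj_HR class_cj[OF A w(1)] by (auto simp: X_def)
  qed
  have "(\<Sum>w\<in>X. f w) = (\<Sum>w\<in>X. - f w)"
    by (rule sum.reindex_bij_witness[of _ cj cj]) (use cX f in \<open>auto simp: X_def\<close>)
  then have "(\<Sum>w\<in>X. f w) = 0" by (simp add: sum_negf)
  moreover have "(\<Sum>j\<in>{0..<int p}. \<Sum>x\<in>ZR \<A>. f (mv (Um (- j)) x)) = (\<Sum>z\<in>{0..<int p} \<times> ZR \<A>. f (\<phi> z))"
    unfolding sum.cartesian_product by (rule sum.cong) (auto simp: \<phi>_def)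
  moreover have "\<dots> = (\<Sum>w\<in>X. f w)" unfolding img[symmetric] by (rule sum.reindex[OF inj, symmetric, unfolded o_def])
  ultimately show ?thesis by simp
qed

end

subsection \<open>Rational functions and the slash operator\<close>

text \<open>Regular up to a removable singularity: the value at a itself is ignored, since rational
  functions are given only up to finitely many points.\<close>

definition reg :: "(complex \<Rightarrow> complex) \<Rightarrow> complex \<Rightarrow> bool" where
  "reg f a \<longleftrightarrow> (\<exists>L. (f \<longlongrightarrow> L) (at a))"

text \<open>L is allowed to be 0; the order is then less than m. This case is used when a leading
  term has been subtracted.\<close>

definition has_pole_order :: "(complex \<Rightarrow> complex) \<Rightarrow> complex \<Rightarrow> nat \<Rightarrow> complex \<Rightarrow> bool" where
  "has_pole_order f a m L \<longleftrightarrow> ((\<lambda>z. (z - a) ^ m * f z) \<longlongrightarrow> L) (at a)"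

lemma at_neq: "\<forall>\<^sub>F z in at (a::complex). z \<noteq> a"
  by (simp add: eventually_at_filter)

lemma cofinite_at:
  assumes "\<forall>\<^sub>F z in cofinite. P z" shows "\<forall>\<^sub>F z in at (a::complex). P z"
proof -
  have f: "finite {z. \<not> P z}" using assms by (simp add: eventually_cofinite)
  then have "open (- ({z. \<not> P z} - {a}))" by (intro open_Compl finite_imp_closed) auto
  then show ?thesis unfolding eventually_at_topological by (intro exI[of _ "- ({z. \<not> P z} - {a})"]) auto
qed

lemma reg_cong: "\<forall>\<^sub>F z in at a. f z = g z \<Longrightarrow> reg f a \<longleftrightarrow> reg g a"
  unfolding reg_def using tendsto_cong by blast

lemma reg_add: "reg f a \<Longrightarrow> reg g a \<Longrightarrow> reg (\<lambda>z. f z + g z) a"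
  unfolding reg_def using tendsto_add by blast

lemma reg_mult: "reg f a \<Longrightarrow> reg g a \<Longrightarrow> reg (\<lambda>z. f z * g z) a"
  unfolding reg_def using tendsto_mult by blast

lemma reg_const [simp]: "reg (\<lambda>z. c) a"
  unfolding reg_def using tendsto_const by blast

lemma reg_cmult: "reg f a \<Longrightarrow> reg (\<lambda>z. c * f z) a"
  by (intro reg_mult reg_const)

lemma reg_minus: "reg f a \<Longrightarrow> reg (\<lambda>z. - f z) a"
  unfolding reg_def using tendsto_minus by blast

lemma reg_diff: "reg f a \<Longrightarrow> reg g a \<Longrightarrow> reg (\<lambda>z. f z - g z) a"
  unfolding reg_def using tendsto_diff by blast

lemma reg_sum: "(\<And>i. i \<in> I \<Longrightarrow> reg (f i) a) \<Longrightarrow> reg (\<lambda>z. \<Sum>i\<in>I. f i z) a"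
proof (induction I rule: infinite_finite_induct)
  case (insert i I) then show ?case using reg_add[of "f i" a "\<lambda>z. \<Sum>i\<in>I. f i z"] by simp
qed simp_all

lemma reg_continuous: "isCont f a \<Longrightarrow> reg f a"
  unfolding reg_def isCont_def by blast

lemma pole_order_not_reg:
  assumes "has_pole_order f a m L" "m \<ge> 1" "L \<noteq> 0" shows "\<not> reg f a" "is_pole f a"
proof -
  have l: "((\<lambda>z. (z - a) ^ m * f z) \<longlongrightarrow> L) (at a)" using assms by (simp add: has_pole_order_def)
  have z: "((\<lambda>z. (z - a) ^ m) \<longlongrightarrow> 0) (at a)" using assms(2) by (auto intro!: tendsto_eq_intros)
  show "\<not> reg f a"
  proof
    assume "reg f a"
    then obtain l where "(f \<longlongrightarrow> l) (at a)" by (auto simp: reg_def)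
    from tendsto_mult[OF z this] have "((\<lambda>z. (z - a) ^ m * f z) \<longlongrightarrow> 0) (at a)" by simp
    then show False using l assms(3) tendsto_unique[OF trivial_limit_at] by blast
  qed
  have "filterlim (\<lambda>z. (z - a) ^ m) (at 0) (at a)"
        unfolding filterlim_at
  proof
    show "\<forall>\<^sub>F z in at a. (z - a) ^ m \<in> UNIV \<and> (z - a) ^ m \<noteq> 0" by (rule eventually_mono[OF at_neq[of a]]) simp
  qed (rule z)
  from filterlim_divide_at_infinity[OF l this assms(3)]
  have "filterlim (\<lambda>z. (z - a) ^ m * f z / (z - a) ^ m) at_infinity (at a)" .
  moreover have "\<forall>\<^sub>F z in at a. (z - a) ^ m * f z / (z - a) ^ m = f z"
    by (auto simp: eventually_at_filter)
  ultimately show "is_pole f a" unfolding is_pole_def by (rule iffD1[OF filterlim_cong[OF refl refl], rotated])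
qed

lemma pole_not_reg: "is_pole f a \<Longrightarrow> \<not> reg f a"
  unfolding is_pole_def reg_def using not_tendsto_and_filterlim_at_infinity[OF trivial_limit_at] by blast

lemma poly_nonzero_cofinite: "Q \<noteq> 0 \<Longrightarrow> \<forall>\<^sub>F z in cofinite. poly Q z \<noteq> (0::complex)"
  by (simp add: eventually_cofinite poly_roots_finite)

lemma rational_functionD:
  assumes "rational_function f" obtains P Q where "Q \<noteq> 0" "\<forall>\<^sub>F z in cofinite. f z = poly P z / poly Q z"
proof -
  obtain P Q where PQ: "Q \<noteq> 0" "\<And>z. poly Q z \<noteq> 0 \<Longrightarrow> f z = poly P z / poly Q z" using assms by (auto simp: rational_function_def)
  then show ?thesis using that[of Q P] eventually_mono[OF poly_nonzero_cofinite[OF PQ(1)], of "\<lambda>z. f z = poly P z / poly Q z"] by blast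
qed

text \<open>The definition prescribes f wherever the denominator is nonzero; multiplying numerator
  and denominator by R makes the finitely many exceptional points zeros of the denominator.\<close>

lemma rational_functionI:
  assumes Q: "Q \<noteq> 0" and f: "\<forall>\<^sub>F z in cofinite. f z = poly P z / poly Q z"
  shows "rational_function f"
proof -
  define S :: "complex set" where "S = {z. f z \<noteq> poly P z / poly Q z}"
  have fin: "finite S" using f by (simp add: S_def eventually_cofinite)
  define R where "R = (\<Prod>b\<in>S. [:- b, 1:])"
  have R: "poly R z = 0 \<longleftrightarrow> z \<in> S" for z using fin by (auto simp: R_def poly_prod)
  have "R \<noteq> 0" using fin by (auto simp: R_def)
  moreover have "f z = poly (P * R) z / poly (Q * R) z" if "poly (Q * R) z \<noteq> 0" for z
    using that R by (auto simp: S_def)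
  ultimately show ?thesis unfolding rational_function_def using Q by (intro exI[of _ "P * R"] exI[of _ "Q * R"]) auto
qed

lemma rational_function_cong:
  assumes "rational_function f" "\<forall>\<^sub>F z in cofinite. g z = f z" shows "rational_function g"
proof -
  obtain P Q where PQ: "Q \<noteq> 0" "\<forall>\<^sub>F z in cofinite. f z = poly P z / poly Q z" using rational_functionD[OF assms(1)] .
  have "\<forall>\<^sub>F z in cofinite. g z = poly P z / poly Q z" using PQ(2) assms(2) by eventually_elim simp
  then show ?thesis by (rule rational_functionI[OF PQ(1)])
qed

lemma rational_function_poly_div: "Q \<noteq> 0 \<Longrightarrow> rational_function (\<lambda>z. poly P z / poly Q z)"
  by (rule rational_functionI[of Q _ P]) auto

lemma rational_function_add:
  assumes "rational_function f" "rational_function g" shows "rational_function (\<lambda>z. f z + g z)"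
proof -
  obtain P Q where PQ: "Q \<noteq> 0" "\<forall>\<^sub>F z in cofinite. f z = poly P z / poly Q z" using rational_functionD[OF assms(1)] .
  obtain R S where RS: "S \<noteq> 0" "\<forall>\<^sub>F z in cofinite. g z = poly R z / poly S z" using rational_functionD[OF assms(2)] .
  show ?thesis
    by (rule rational_functionI[of "Q * S" _ "P * S + R * Q"])
       (use PQ RS in simp, use PQ(2) RS(2) poly_nonzero_cofinite[OF PQ(1)] poly_nonzero_cofinite[OF RS(1)] in eventually_elim,
        simp add: field_simps)
qed

lemma rational_function_mult:
  assumes "rational_function f" "rational_function g" shows "rational_function (\<lambda>z. f z * g z)"
proof -
  obtain P Q where PQ: "Q \<noteq> 0" "\<forall>\<^sub>F z in cofinite. f z = poly P z / poly Q z" using rational_functionD[OF assms(1)] .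
  obtain R S where RS: "S \<noteq> 0" "\<forall>\<^sub>F z in cofinite. g z = poly R z / poly S z" using rational_functionD[OF assms(2)] .
  show ?thesis
    by (rule rational_functionI[of "Q * S" _ "P * R"])
       (use PQ RS in simp, use PQ(2) RS(2) in eventually_elim, simp)
qed

lemma rational_function_const: "rational_function (\<lambda>z. c)"
  using rational_function_poly_div[of 1 "[:c:]"] by simp

lemma rational_function_sum: "(\<And>i. i \<in> I \<Longrightarrow> rational_function (f i)) \<Longrightarrow> rational_function (\<lambda>z. \<Sum>i\<in>I. f i z)"
  by (induction I rule: infinite_finite_induct) (auto simp: rational_function_const rational_function_add)

lemma poly_factor_at:
  assumes "P \<noteq> (0 :: complex poly)"
  obtains i P1 where "P = [:- a, 1:] ^ i * P1" "poly P1 a \<noteq> 0"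
  using order_decomp[OF assms, of a] by (auto simp: poly_eq_0_iff_dvd)

lemma rational_order:
  assumes f: "rational_function f" and nz: "\<not> (\<forall>\<^sub>F z in cofinite. f z = 0)"
  obtains n :: int and L where "L \<noteq> 0" "((\<lambda>z. f z * (z - a) powi n) \<longlongrightarrow> L) (at a)"
proof -
  obtain P Q where PQ: "Q \<noteq> 0" "\<forall>\<^sub>F z in cofinite. f z = poly P z / poly Q z" using rational_functionD[OF f] .
  have "P \<noteq> 0"
    proof
    assume "P = 0"
    then have "\<forall>\<^sub>F z in cofinite. f z = 0" using PQ(2) by simp
    then show False using nz by contradiction
  qed
  then obtain i P1 where P: "P = [:- a, 1:] ^ i * P1" "poly P1 a \<noteq> 0" using poly_factor_at by blast
  obtain j Q1 where Q: "Q = [:- a, 1:] ^ j * Q1" "poly Q1 a \<noteq> 0" using poly_factor_at[OF PQ(1)] by blast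
  have "((\<lambda>z. poly P1 z / poly Q1 z) \<longlongrightarrow> poly P1 a / poly Q1 a) (at a)"
    using Q(2) by (auto intro!: tendsto_intros)
  moreover have "\<forall>\<^sub>F z in at a. f z * (z - a) powi (int j - int i) = poly P1 z / poly Q1 z"
    using cofinite_at[OF PQ(2)] at_neq
  proof (rule eventually_elim2)
    fix z assume z: "f z = poly P z / poly Q z" "z \<noteq> a"
    have "f z * (z - a) powi (int j - int i) = ((z - a) ^ i * poly P1 z) / ((z - a) ^ j * poly Q1 z) * ((z - a) ^ j / (z - a) ^ i)"
      using z by (simp add: P(1) Q(1) power_int_diff poly_power)
    then show "f z * (z - a) powi (int j - int i) = poly P1 z / poly Q1 z" using z(2) by (simp add: divide_simps)
  qed
  ultimately have "((\<lambda>z. f z * (z - a) powi (int j - int i)) \<longlongrightarrow> poly P1 a / poly Q1 a) (at a)"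
    by (simp add: tendsto_cong)
  moreover have "poly P1 a / poly Q1 a \<noteq> 0" using P(2) Q(2) by simp
  ultimately show ?thesis using that by blast
qed

lemma rational_reg_or_pole:
  assumes f: "rational_function f"
  obtains "reg f a" | m L where "m \<ge> 1" "L \<noteq> 0" "has_pole_order f a m L"
proof (cases "\<forall>\<^sub>F z in cofinite. f z = 0")
  case True
  then have "reg f a" using reg_cong[OF cofinite_at[OF True], of a] by simp
  then show ?thesis using that by blast
next
  case False
  then obtain n L where nL: "L \<noteq> 0" "((\<lambda>z. f z * (z - a) powi n) \<longlongrightarrow> L) (at a)" using rational_order[OF f False] by blast
  show ?thesis
  proof (cases "n \<ge> 1")
    case True
    then have "has_pole_order f a (nat n) L" using nL(2) by (simp add: has_pole_order_def power_int_def mult.commute)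
    then show ?thesis using that(2)[of "nat n" L] nL(1) True by simp
  next
    case False
    have "reg (\<lambda>z. f z * (z - a) powi n * (z - a) ^ nat (- n)) a"
    proof (rule reg_mult)
      show "reg (\<lambda>z. f z * (z - a) powi n) a" using nL(2) by (auto simp: reg_def)
      show "reg (\<lambda>z. (z - a) ^ nat (- n)) a" by (intro reg_continuous continuous_intros)
    qed
    moreover have "\<forall>\<^sub>F z in at a. f z * (z - a) powi n * (z - a) ^ nat (- n) = f z"
      using at_neq by (rule eventually_mono) (use False in \<open>auto simp: power_int_def field_simps\<close>)
    ultimately have "reg f a" by (rule reg_cong[THEN iffD1, rotated])
    then show ?thesis using that by blast
  qed
qed

lemma is_pole_iff_not_reg: "rational_function f \<Longrightarrow> is_pole f a \<longleftrightarrow> \<not> reg f a"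
  using rational_reg_or_pole[of f a] pole_order_not_reg pole_not_reg by metis

lemma finite_poles: assumes "rational_function f" shows "finite (poles f)"
proof -
  obtain P Q where PQ: "Q \<noteq> 0" "\<forall>\<^sub>F z in cofinite. f z = poly P z / poly Q z" using rational_functionD[OF assms] .
  have "poly Q a = 0" if "is_pole f a" for a
  proof (rule ccontr)
    assume "poly Q a \<noteq> 0"
    then have "reg (\<lambda>z. poly P z / poly Q z) a" by (intro reg_continuous) auto
    then show False using reg_cong[OF cofinite_at[OF PQ(2)]] pole_not_reg[OF that] by blast
  qed
  then have "poles f \<subseteq> {a. poly Q a = 0}" by (auto simp: poles_def)
  then show ?thesis using poly_roots_finite[OF PQ(1)] finite_subset by blast
qed

section \<open>The slash operator\<close>

lemma lft_eq: "lft M z = (of_real (M$1$1) * z + of_real (M$1$2)) / lft_denom M z"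
  by (simp add: lft_def moebius_def lft_denom_def)

lemma lft_denom_mult: "lft_denom N z \<noteq> 0 \<Longrightarrow> lft_denom (M ** N) z = lft_denom M (lft N z) * lft_denom N z"
  by (simp add: lft_eq lft_denom_def[of M] lft_denom_def[of "M ** N"] distrib_right) (simp add: lft_denom_def algebra_simps)

lemma lft_mult:
  assumes n: "lft_denom N z \<noteq> 0" shows "lft (M ** N) z = lft M (lft N z)"
proof -
  have "(of_real (M$1$1) * lft N z + of_real (M$1$2)) * lft_denom N z = of_real ((M ** N)$1$1) * z + of_real ((M ** N)$1$2)"
    using n by (simp add: lft_eq distrib_right) (simp add: lft_denom_def algebra_simps)
  then have "lft (M ** N) z = (of_real (M$1$1) * lft N z + of_real (M$1$2)) * lft_denom N z / (lft_denom M (lft N z) * lft_denom N z)"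
    unfolding lft_eq[of "M ** N"] lft_denom_mult[OF n] by simp
  then show ?thesis using n by (simp add: lft_eq[of M])
qed

lemma lft_simps [simp]: "lft_denom (mat 1) z = 1" "lft (mat 1) z = z" "lft_denom (- M) z = - lft_denom M z" "lft (- M) z = lft M z"
proof -
  show d: "lft_denom (- M) z = - lft_denom M z" by (simp add: lft_denom_def)
  have "lft (- M) z = - (of_real (M$1$1) * z + of_real (M$1$2)) / - lft_denom M z" by (simp add: lft_eq d)
  then show "lft (- M) z = lft M z" by (simp only: minus_divide_left[symmetric] minus_divide_right[symmetric] minus_minus lft_eq)
qed (simp_all add: lft_eq lft_denom_def)

lemma lft_madj:
  assumes "det2 M = 1" "lft_denom M z \<noteq> 0"
  shows "lft (madj M) (lft M z) = z" "lft_denom (madj M) (lft M z) = 1 / lft_denom M z"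
  using lft_mult[OF assms(2), of "madj M"] lft_denom_mult[OF assms(2), of "madj M"] madj_mult[OF assms(1)] assms(2)
  by (simp_all add: field_simps)

lemma lft_denom_cofinite: assumes "det2 M = 1" shows "\<forall>\<^sub>F z in cofinite. lft_denom M z \<noteq> 0"
proof -
  have "[:of_real (M$2$2), of_real (M$2$1):] \<noteq> (0 :: complex poly)" using assms by (auto simp: det2_def)
  from poly_nonzero_cofinite[OF this] show ?thesis by (simp add: lft_denom_def add.commute mult.commute)
qed

lemma lft_cofinite:
  assumes M: "det2 M = 1" and P: "\<forall>\<^sub>F z in cofinite. P z" shows "\<forall>\<^sub>F z in cofinite. P (lft M z)"
proof -
  have "{z. \<not> P (lft M z)} \<subseteq> {z. lft_denom M z = 0} \<union> lft (madj M) ` {z. \<not> P z}"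
    using lft_madj(1)[OF M] by (auto intro!: rev_image_eqI)
  moreover have "finite {z. lft_denom M z = 0}" "finite {z. \<not> P z}"
    using lft_denom_cofinite[OF M] P by (simp_all add: eventually_cofinite)
  ultimately show ?thesis unfolding eventually_cofinite by (meson finite_UnI finite_imageI finite_subset)
qed

lemma isCont_lft_denom: "isCont (lft_denom M) a"
  unfolding lft_denom_def[abs_def] by (intro continuous_intros)

lemma isCont_lft: "lft_denom M a \<noteq> 0 \<Longrightarrow> isCont (lft M) a"
  unfolding lft_eq[abs_def] by (intro continuous_intros isCont_lft_denom)

text \<open>Besides continuity this needs injectivity of M near a, so that punctured neighbourhoods
  are mapped into punctured ones.\<close>

lemma lft_filterlim:
  assumes M: "det2 M = 1" and a: "lft_denom M a \<noteq> 0"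
  shows "filterlim (lft M) (at (lft M a)) (at a)"
  unfolding filterlim_at
proof
  show "(lft M \<longlongrightarrow> lft M a) (at a)" using isCont_lft[OF a] by (simp add: isCont_def)
  have "\<forall>\<^sub>F z in at a. z \<noteq> a" by (rule at_neq)
  with cofinite_at[OF lft_denom_cofinite[OF M]]
  show "\<forall>\<^sub>F z in at a. lft M z \<in> UNIV \<and> lft M z \<noteq> lft M a"
  proof eventually_elim
    case (elim z)
    then show ?case using lft_madj(1)[OF M, of z] lft_madj(1)[OF M a] by auto
  qed
qed

lemma slash_cong:
  assumes M: "det2 M = 1" and P: "\<forall>\<^sub>F z in cofinite. f z = g z"
  shows "\<forall>\<^sub>F z in cofinite. slash k f M z = slash k g M z"
  using lft_cofinite[OF M P] by eventually_elim (simp add: slash_def)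

lemma slash_linear:
  "slash k (\<lambda>z. f z + g z) M z = slash k f M z + slash k g M z"
  "slash k (\<lambda>z. c * f z) M z = c * slash k f M z"
  "slash k (\<lambda>z. f z - g z) M z = slash k f M z - slash k g M z"
  "slash k (\<lambda>z. - f z) M z = - slash k f M z"
  by (simp_all add: slash_def algebra_simps)

lemma slash_sum: "slash k (\<lambda>z. \<Sum>i\<in>I. f i z) M z = (\<Sum>i\<in>I. slash k (f i) M z)"
  by (simp add: slash_def sum_distrib_left)

lemma slash_slash: "lft_denom N z \<noteq> 0 \<Longrightarrow> slash k (slash k f M) N z = slash k f (M ** N) z"
proof -
  assume n: "lft_denom N z \<noteq> 0"
  show ?thesis unfolding slash_def lft_mult[OF n] lft_denom_mult[OF n] power_int_mult_distrib by simp
qed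

lemma slash_slash_cofinite: "det2 N = 1 \<Longrightarrow> \<forall>\<^sub>F z in cofinite. slash k (slash k f M) N z = slash k f (M ** N) z"
  using lft_denom_cofinite[of N] by (rule eventually_mono) (simp_all add: slash_slash)

lemma slash_neg [simp]: "slash k f (- M) z = slash k f M z"
  by (simp add: slash_def)

lemma slash_one [simp]: "slash k f (mat 1) z = f z"
  by (simp add: slash_def)

lemma reg_slash:
  assumes M: "det2 M = 1" and a: "lft_denom M a \<noteq> 0" and f: "reg f (lft M a)"
  shows "reg (slash k f M) a"
proof -
  obtain L where "(f \<longlongrightarrow> L) (at (lft M a))" using f by (auto simp: reg_def)
  then have "((\<lambda>z. f (lft M z)) \<longlongrightarrow> L) (at a)" using filterlim_compose lft_filterlim[OF M a] by blast
  then have "reg (\<lambda>z. f (lft M z)) a" by (auto simp: reg_def)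
  moreover have "isCont (\<lambda>z. lft_denom M z powi - (2 * int k)) a"
    using a by (intro continuous_intros isCont_lft_denom) auto
  ultimately show ?thesis unfolding slash_def[abs_def] by (intro reg_mult reg_continuous[where f="\<lambda>z. lft_denom M z powi _"])
qed

text \<open>Slashing with the inverse matrix restores f, so regularity is carried in both
  directions.\<close>

lemma reg_slash_iff:
  assumes M: "det2 M = 1" and a: "lft_denom M a \<noteq> 0"
  shows "reg (slash k f M) a \<longleftrightarrow> reg f (lft M a)"
proof
  assume r: "reg (slash k f M) a"
  define b where "b = lft M a"
  have b: "lft_denom (madj M) b \<noteq> 0" "lft (madj M) b = a" using lft_madj[OF M a] a by (simp_all add: b_def)
  have "reg (slash k (slash k f M) (madj M)) b" by (rule reg_slash) (use M b r in auto)
  moreover have "\<forall>\<^sub>F z in at b. slash k (slash k f M) (madj M) z = f z"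
    using cofinite_at[OF slash_slash_cofinite[of "madj M" k f M]] M madj_mult(2)[OF M] by simp
  ultimately show "reg f (lft M a)" using reg_cong b_def by blast
qed (use reg_slash[OF assms] in blast)

subsection \<open>Rational period functions of the explicit form\<close>

locale hecke_weight = hecke p for p +
  fixes k :: nat
  assumes k: "k > 0" "odd k"
begin

abbreviation rpf :: "(complex \<Rightarrow> complex) \<Rightarrow> bool" where "rpf \<equiv> rational_period_function p k"

lemma sum_int_interval: "(\<Sum>j\<in>{0..<int n}. g j) = (\<Sum>j<n. g (int j))" for g :: "int \<Rightarrow> complex"
  by (rule sum.reindex_bij_witness[of _ int nat]) auto

lemma rpf_iff:
  "rpf q \<longleftrightarrow> rational_function q \<and> (\<forall>\<^sub>F z in cofinite. q z + slash k q Tm z = 0) \<and>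
     (\<forall>\<^sub>F z in cofinite. (\<Sum>j\<in>{0..<int p}. slash k q (Um j) z) = 0)"
proof -
  have "(\<Sum>j\<in>{0..<int p}. slash k q (Um j) z) = q z + (\<Sum>j=1..p-1. slash k q (hecke_U p [^]\<^bsub>SL2R\<^esub> j) z)" for z
  proof -
    have "{..<p} = insert 0 {1..p-1}" using p3 by auto
    then show ?thesis by (simp add: sum_int_interval hecke_U_power)
  qed
  then show ?thesis using k by (simp add: rational_period_function_def hecke_T_eq)
qed

lemma Um_denom_cofinite: "\<forall>\<^sub>F z in cofinite. \<forall>j\<in>{0..int p}. lft_denom (Um j) z \<noteq> 0"
  by (rule eventually_ball_finite) (auto intro: lft_denom_cofinite)

lemma rpf_add: assumes "rpf f" "rpf g" shows "rpf (\<lambda>z. f z + g z)"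
proof -
  have f: "\<forall>\<^sub>F z in cofinite. f z + slash k f Tm z = 0" "\<forall>\<^sub>F z in cofinite. (\<Sum>j\<in>{0..<int p}. slash k f (Um j) z) = 0"
    and g: "\<forall>\<^sub>F z in cofinite. g z + slash k g Tm z = 0" "\<forall>\<^sub>F z in cofinite. (\<Sum>j\<in>{0..<int p}. slash k g (Um j) z) = 0"
    using assms by (simp_all add: rpf_iff)
  have "\<forall>\<^sub>F z in cofinite. f z + g z + slash k (\<lambda>z. f z + g z) Tm z = 0"
    using f(1) g(1) by eventually_elim (simp add: slash_linear algebra_simps)
  moreover have "\<forall>\<^sub>F z in cofinite. (\<Sum>j\<in>{0..<int p}. slash k (\<lambda>z. f z + g z) (Um j) z) = 0"
    using f(2) g(2) by eventually_elim (simp add: slash_linear sum.distrib)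
  ultimately show ?thesis using assms by (simp add: rpf_iff rational_function_add)
qed

lemma rpf_cmult: assumes "rpf f" shows "rpf (\<lambda>z. c * f z)"
proof -
  have f: "\<forall>\<^sub>F z in cofinite. f z + slash k f Tm z = 0" "\<forall>\<^sub>F z in cofinite. (\<Sum>j\<in>{0..<int p}. slash k f (Um j) z) = 0"
    using assms by (simp_all add: rpf_iff)
  have "\<forall>\<^sub>F z in cofinite. c * f z + slash k (\<lambda>z. c * f z) Tm z = 0"
    using f(1) by eventually_elim (simp add: slash_linear flip: distrib_left)
  moreover have "\<forall>\<^sub>F z in cofinite. (\<Sum>j\<in>{0..<int p}. slash k (\<lambda>z. c * f z) (Um j) z) = 0"
    using f(2) by eventually_elim (simp add: slash_linear flip: sum_distrib_left)
  ultimately show ?thesis using assms by (simp add: rpf_iff rational_function_mult rational_function_const)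
qed

lemma rpf_zero: "rpf (\<lambda>z. 0)"
  by (simp add: rpf_iff rational_function_const slash_def)

lemma rpf_sum: "(\<And>i. i \<in> I \<Longrightarrow> rpf (f i)) \<Longrightarrow> rpf (\<lambda>z. \<Sum>i\<in>I. f i z)"
  by (induction I rule: infinite_finite_induct) (auto simp: rpf_zero rpf_add)

lemma rpf_cong: assumes "rpf f" and e: "\<forall>\<^sub>F z in cofinite. g z = f z" shows "rpf g"
proof -
  have f: "\<forall>\<^sub>F z in cofinite. f z + slash k f Tm z = 0" "\<forall>\<^sub>F z in cofinite. (\<Sum>j\<in>{0..<int p}. slash k f (Um j) z) = 0"
    using assms by (simp_all add: rpf_iff)
  have "\<forall>\<^sub>F z in cofinite. \<forall>j\<in>{0..<int p}. slash k g (Um j) z = slash k f (Um j) z"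
    by (rule eventually_ball_finite) (auto intro: slash_cong[OF _ e])
  then have "\<forall>\<^sub>F z in cofinite. (\<Sum>j\<in>{0..<int p}. slash k g (Um j) z) = 0"
    using f(2) by eventually_elim simp
  moreover have "\<forall>\<^sub>F z in cofinite. g z + slash k g Tm z = 0"
    using f(1) e slash_cong[OF det2_Tm e, of k] by eventually_elim simp
  ultimately show ?thesis using assms rational_function_cong[OF _ e] by (simp add: rpf_iff)
qed

definition fx :: "real \<Rightarrow> complex \<Rightarrow> complex" where
  "fx x z = bqf_eval (hf x) z 1 powi (- int k)"

lemma bqf_eval_scale: "bqf_eval Q (w * e) e = e\<^sup>2 * bqf_eval Q w 1"
  by (cases Q) (simp add: algebra_simps power2_eq_square)

text \<open>By equivariance the form of \<open>mv (madj W) x\<close> is that of x composed with W;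
  homogeneity of degree 2 produces exactly the weight factor.\<close>

lemma fx_slash:
  assumes x: "x \<in> HR" and W: "W \<in> G" and z: "lft_denom W z \<noteq> 0"
  shows "slash k (fx x) W z = fx (mv (madj W) x) z"
proof -
  define e where "e = lft_denom W z"
  define y where "y = mv (madj W) x"
  have y: "y \<in> HR" "mv W y = x" using HR_mv[OF x G_madj[OF W]] HR_mv_madj(2)[OF x W] by (simp_all add: y_def)
  have "hf y = bqf_act (hf x) W" using hf_mv[OF y(1) W] y(2) by simp
  then have "bqf_eval (hf y) z 1 = bqf_eval (hf x) (lft W z * e) e"
    using z by (simp only: bqf_eval_act mult_1_right) (simp add: lft_eq e_def, simp add: lft_denom_def)
  also have "\<dots> = e powi 2 * bqf_eval (hf x) (lft W z) 1" by (simp add: bqf_eval_scale)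
  finally have "fx y z = e powi (2 * (- int k)) * fx x (lft W z)"
    unfolding fx_def by (simp only: power_int_mult_distrib power_int_mult)
  then show ?thesis by (simp add: slash_def e_def y_def)
qed

lemma bqf_eval_hf: "x \<in> HR \<Longrightarrow> bqf_eval (hf x) z 1 = of_real (lead x) * (z - of_real x) * (z - of_real (cj x))"
  by (simp add: hf_coeffs(1) algebra_simps power2_eq_square)

lemma fx_formula: "x \<in> HR \<Longrightarrow> fx x z = 1 / (of_real (lead x) * (z - of_real x) * (z - of_real (cj x))) ^ k"
  by (simp add: fx_def bqf_eval_hf power_int_minus divide_inverse)

text \<open>The form of the conjugate is the negative one, and k is odd. Every cancellation in part
  (b) rests on this sign.\<close>

lemma fx_cj: assumes "x \<in> HR" shows "fx (cj x) z = - fx x z"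
proof -
  have "bqf_eval (- Q) z 1 = - bqf_eval Q z 1" for Q by (cases Q) simp
  then show ?thesis unfolding fx_def hf_cj[OF assms] using k by (simp add: power_int_minus)
qed

lemma fx_reg:
  assumes x: "x \<in> HR" and a: "a \<noteq> of_real x" "a \<noteq> of_real (cj x)" shows "reg (fx x) a"
proof (rule reg_continuous)
  have "fx x = (\<lambda>z. 1 / (of_real (lead x) * (z - of_real x) * (z - of_real (cj x))) ^ k)" using fx_formula[OF x] by blast
  then show "isCont (fx x) a" using a lead_nonzero[OF x] by (auto intro!: continuous_intros)
qed

lemma fx_pole:
  assumes x: "x \<in> HR"
  obtains L where "L \<noteq> 0" "has_pole_order (fx x) (of_real x) k L"
proof -
  define l where "l = complex_of_real (lead x)"
  define L where "L = 1 / (l * (of_real x - of_real (cj x))) ^ k"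
  have l: "l \<noteq> 0" "complex_of_real x - of_real (cj x) \<noteq> 0" using lead_nonzero[OF x] cj_neq[OF x] by (auto simp: l_def)
  have "((\<lambda>z. 1 / (l * (z - of_real (cj x))) ^ k) \<longlongrightarrow> L) (at (of_real x))"
    unfolding L_def using l by (intro tendsto_intros) auto
  moreover have "\<forall>\<^sub>F z in at (of_real x). (z - of_real x) ^ k * fx x z = 1 / (l * (z - of_real (cj x))) ^ k"
    by (rule eventually_mono[OF at_neq]) (simp add: fx_formula[OF x] l_def power_mult_distrib)
  ultimately have "has_pole_order (fx x) (of_real x) k L" unfolding has_pole_order_def by (simp add: tendsto_cong)
  moreover have "L \<noteq> 0" using l by (simp add: L_def)
  ultimately show ?thesis using that by blast
qed

lemma fx_rational: assumes x: "x \<in> HR" shows "rational_function (fx x)"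
proof -
  define Q :: "complex poly" where "Q = ([:of_real (lead x):] * [:- of_real x, 1:] * [:- of_real (cj x), 1:]) ^ k"
  have "rational_function (\<lambda>z. poly 1 z / poly Q z)"
    by (rule rational_function_poly_div) (use lead_nonzero[OF x] in \<open>simp add: Q_def\<close>)
  moreover have "fx x = (\<lambda>z. poly 1 z / poly Q z)"
    by (rule ext) (simp add: fx_formula[OF x] Q_def algebra_simps)
  ultimately show ?thesis by simp
qed

definition FA :: "bqf set \<Rightarrow> complex \<Rightarrow> complex" where
  "FA \<A> z = (\<Sum>x\<in>ZR \<A>. fx x z)"

lemma ZR_HR: "x \<in> ZR \<A> \<Longrightarrow> x \<in> HR"
  by (simp add: ZR_def)

lemma FA_Z_set: "(\<Sum>\<alpha>\<in>Z_set p \<A>. bqf_eval (hyperbolic_form p \<alpha>) z 1 powi (- int k)) = FA \<A> z"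
  unfolding Z_set_ZR FA_def fx_def by (subst sum.reindex) (auto simp: inj_on_def)

lemma slash_FA:
  assumes W: "W \<in> G" and z: "lft_denom W z \<noteq> 0"
  shows "slash k (FA \<A>) W z = (\<Sum>x\<in>ZR \<A>. fx (mv (madj W) x) z)"
proof -
  have "slash k (FA \<A>) W z = slash k (\<lambda>z. \<Sum>x\<in>ZR \<A>. fx x z) W z" by (simp add: FA_def[abs_def])
  also have "\<dots> = (\<Sum>x\<in>ZR \<A>. slash k (fx x) W z)" by (rule slash_sum)
  also have "\<dots> = (\<Sum>x\<in>ZR \<A>. fx (mv (madj W) x) z)"
    using fx_slash[OF _ W z] ZR_HR by (intro sum.cong) auto
  finally show ?thesis .
qed

lemma rpf_FA:
  assumes A: "\<A> \<in> hyperbolic_classes p" "uminus ` \<A> = \<A>" shows "rpf (FA \<A>)"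
proof (cases "finite (ZR \<A>)")
  \<comment> \<open>\<open>ZR \<A>\<close> is in fact finite; the junk value 0 of a sum over an infinite set spares the proof.\<close>
  case False
  then have "FA \<A> = (\<lambda>z. 0)" by (simp add: FA_def[abs_def])
  then show ?thesis using rpf_zero by simp
next
  case True
  have c: "fx (cj x) z = - fx x z" if "x \<in> HR" for x z using fx_cj[OF that] .
  have "rational_function (FA \<A>)"
    unfolding FA_def[abs_def] by (rule rational_function_sum) (use fx_rational ZR_HR in blast)
  moreover have "\<forall>\<^sub>F z in cofinite. FA \<A> z + slash k (FA \<A>) Tm z = 0"
    using lft_denom_cofinite[OF det2_Tm]
  proof eventually_elim
    case (elim z)
    have "slash k (FA \<A>) Tm z = (\<Sum>x\<in>ZR \<A>. fx (mv Tm x) z)" using slash_FA[OF G_T elim] by simp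
    also have "\<dots> = - FA \<A> z" unfolding FA_def by (rule ZR_T_sum[OF A]) (rule c)
    finally show ?case by simp
  qed
  moreover have "\<forall>\<^sub>F z in cofinite. (\<Sum>j\<in>{0..<int p}. slash k (FA \<A>) (Um j) z) = 0"
    using Um_denom_cofinite
  proof eventually_elim
    case (elim z)
    have "(\<Sum>j\<in>{0..<int p}. slash k (FA \<A>) (Um j) z) = (\<Sum>j\<in>{0..<int p}. \<Sum>x\<in>ZR \<A>. fx (mv (Um (- j)) x) z)"
      using elim by (intro sum.cong) (auto simp: slash_FA madj_Um)
    also have "\<dots> = 0" by (rule ZR_U_sum[OF A _ True]) (rule c)
    finally show ?case .
  qed
  ultimately show ?thesis by (simp add: rpf_iff)
qed

lemma lft_Um: "lft (Um j) z = lft_denom (Um (j + 1)) z / lft_denom (Um j) z"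
  by (simp add: lft_eq lft_denom_def[of "Um (j + 1)"])

lemma lft_Tm: "lft Tm z = - 1 / z" "lft_denom Tm z = z"
  by (simp_all add: lft_eq lft_denom_def)

lemma rational_power_int: "rational_function (\<lambda>z. z powi (- int n))"
proof -
  have "(\<lambda>z::complex. z powi (- int n)) = (\<lambda>z. poly 1 z / poly ([:0, 1:] ^ n) z)"
    by (rule ext) (simp add: power_int_minus divide_inverse)
  moreover have "rational_function (\<lambda>z. poly 1 z / poly ([:0, 1:] ^ n) z)" by (rule rational_function_poly_div) simp
  ultimately show ?thesis by simp
qed

text \<open>The function is 1 - 1 | T, and slashing it by the j-th power of \<open>U\<close> gives a
  difference of consecutive terms \<open>g j - g (Suc j)\<close>. The sum telescopes to 0 because
  the end denominators 1 and -1 enter with an even exponent.\<close>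

lemma rpf_one_minus: "rpf (\<lambda>z. 1 - z powi (- (2 * int k)))"
proof -
  define E where "E = (\<lambda>z::complex. 1 - z powi (- (2 * int k)))"
  have "E = (\<lambda>z. 1 + (- 1) * z powi (- int (2 * k)))" by (simp add: E_def)
  then have "rational_function E"
    by (simp only:) (intro rational_function_add rational_function_mult rational_function_const rational_power_int)
  moreover have "\<forall>\<^sub>F z in cofinite. E z + slash k E Tm z = 0"
    using lft_denom_cofinite[OF det2_Tm]
  proof eventually_elim
    case (elim z)
    then have z: "z \<noteq> 0" by (simp add: lft_Tm)
    have "(- 1 / z) powi (- (2 * int k)) = z powi (2 * int k)"
      by (simp add: power_int_minus power_int_divide_distrib)
    moreover have "z powi (- (2 * int k)) * z powi (2 * int k) = 1" using z by (simp add: power_int_minus)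
    ultimately show ?case by (simp add: E_def slash_def lft_Tm right_diff_distrib)
  qed
  moreover have "\<forall>\<^sub>F z in cofinite. (\<Sum>j\<in>{0..<int p}. slash k E (Um j) z) = 0"
    using Um_denom_cofinite
  proof eventually_elim
    case (elim z)
    define g where "g j = lft_denom (Um (int j)) z powi (- (2 * int k))" for j
    have "slash k E (Um (int j)) z = g j - g (Suc j)" if "j < p" for j
    proof -
      have nz: "lft_denom (Um (int j)) z \<noteq> 0" using elim that by auto
      have "lft_denom (Um (int j)) z powi (- (2 * int k)) * (lft_denom (Um (int j + 1)) z / lft_denom (Um (int j)) z) powi (- (2 * int k))
          = lft_denom (Um (int j + 1)) z powi (- (2 * int k))"
        using nz by (simp add: power_int_divide_distrib)
      then show ?thesis by (simp add: E_def slash_def lft_Um g_def right_diff_distrib add.commute)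
    qed
    then have "(\<Sum>j\<in>{0..<int p}. slash k E (Um j) z) = (\<Sum>j<p. g j - g (Suc j))"
      unfolding sum_int_interval by (intro sum.cong) auto
    also have "\<dots> = g 0 - g p" by (rule sum_lessThan_telescope')
    also have "\<dots> = 0" by (simp add: g_def)
    finally show ?case .
  qed
  ultimately show ?thesis unfolding E_def[symmetric] by (simp add: rpf_iff)
qed

lemma lft_denom_Um_step: "lft_denom (Um (j + 1)) z * of_real (s j) - lft_denom (Um j) z * of_real (s (j + 1)) = - 1"
proof -
  have "lft_denom (Um (j + 1)) z * of_real (s j) - lft_denom (Um j) z * of_real (s (j + 1))
     = - of_real (s j * s j - s (j - 1) * s (j + 1))" by (simp add: lft_denom_def algebra_simps)
  then show ?thesis unfolding s_det by simp
qed

text \<open>In weight 2 the terms are 1 / (u v) for consecutive denominators u, v. The determinant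
  identity splits them into differences of \<open>g j\<close> = \<open>s j\<close> / u, and the
  telescoped sum vanishes as \<open>s 0 = s p = 0\<close>.\<close>

lemma rpf_inverse: assumes k1: "k = 1" shows "rpf (\<lambda>z. z powi (- 1))"
proof -
  define E where "E = (\<lambda>z::complex. z powi (- 1))"
  have Ei: "E z = inverse z" for z by (simp add: E_def power_int_minus)
  have two: "z powi (- (2 * int k)) = inverse (z * z)" for z :: complex
    by (simp add: k1 power_int_minus power2_eq_square)
  have "rational_function E" using rational_power_int[of 1] by (simp add: E_def)
  moreover have "\<forall>\<^sub>F z in cofinite. E z + slash k E Tm z = 0"
    using lft_denom_cofinite[OF det2_Tm]
  proof eventually_elim
    case (elim z)
    then have z: "z \<noteq> 0" by (simp add: lft_Tm)
    have "slash k E Tm z = inverse (z * z) * inverse (- 1 / z)" by (simp add: slash_def lft_Tm Ei two)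
    also have "\<dots> = - inverse z" using z by (simp add: divide_inverse)
    finally show ?case by (simp add: Ei)
  qed
  moreover have "\<forall>\<^sub>F z in cofinite. (\<Sum>j\<in>{0..<int p}. slash k E (Um j) z) = 0"
    using Um_denom_cofinite
  proof eventually_elim
    case (elim z)
    define g where "g j = of_real (s (int j)) / lft_denom (Um (int j)) z" for j
    have "slash k E (Um (int j)) z = g (Suc j) - g j" if "j < p" for j
    proof -
      define u v where "u = lft_denom (Um (int j)) z" and "v = lft_denom (Um (int j + 1)) z"
      have nz: "u \<noteq> 0" "v \<noteq> 0" using elim that by (auto simp: u_def v_def)
      have "g (Suc j) - g j = (of_real (s (int j + 1)) * u - v * of_real (s (int j))) / (u * v)"
        using nz by (simp add: g_def u_def[symmetric] v_def[symmetric] add.commute[of 1] diff_frac_eq mult.commute)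
      also have "of_real (s (int j + 1)) * u - v * of_real (s (int j)) = 1"
        using lft_denom_Um_step[of "int j" z] by (simp add: u_def v_def algebra_simps)
      finally have "g (Suc j) - g j = 1 / (u * v)" .
      moreover have "slash k E (Um (int j)) z = inverse (u * u) * inverse (v / u)"
        unfolding slash_def Ei two lft_Um u_def v_def ..
      moreover have "inverse (u * u) * inverse (v / u) = 1 / (u * v)" using nz by (simp add: divide_inverse)
      ultimately show ?thesis by simp
    qed
    then have "(\<Sum>j\<in>{0..<int p}. slash k E (Um j) z) = (\<Sum>j<p. g (Suc j) - g j)"
      unfolding sum_int_interval by (intro sum.cong) auto
    also have "\<dots> = g p - g 0" by (rule sum_lessThan_telescope)
    also have "\<dots> = 0" by (simp add: g_def)
    finally show ?case .
  qed
  ultimately show ?thesis unfolding E_def[symmetric] by (simp add: rpf_iff)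
qed

lemma rpf_q_k0: assumes "is_q_k0 k f" shows "rpf f"
proof -
  obtain a b where f: "\<And>z. f z = (if 2 * k \<noteq> 2 then a * (1 - z powi (- (2 * int k))) else a * (1 - z powi (- 2)) + b * z powi (- 1))"
    using assms unfolding is_q_k0_def by (elim exE) simp
  show ?thesis
  proof (cases "k = 1")
    case True
    then have "f = (\<lambda>z. a * (1 - z powi (- (2 * int k))) + b * z powi (- 1))" by (intro ext) (simp add: f)
    then show ?thesis using rpf_add[OF rpf_cmult[OF rpf_one_minus, of a] rpf_cmult[OF rpf_inverse[OF True], of b]] by simp
  next
    case False
    then have "f = (\<lambda>z. a * (1 - z powi (- (2 * int k))))" by (intro ext) (simp add: f)
    then show ?thesis using rpf_cmult[OF rpf_one_minus, of a] by simp
  qed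
qed

lemma explicit_rpf: assumes "explicit_form p k q" shows "rpf q"
proof -
  from assms[unfolded explicit_form_def FA_Z_set]
  obtain L :: nat and \<A> d c0 q0 where *: "(\<forall>l\<in>{1..L}. \<A> l \<in> hyperbolic_classes p \<and> uminus ` \<A> l = \<A> l) \<and>
     is_q_k0 k q0 \<and> (\<forall>\<^sub>F z in cofinite. q z = (\<Sum>l=1..L. d l * FA (\<A> l) z) + c0 * q0 z)"
    by (elim exE)
  have A: "\<And>l. l \<in> {1..L} \<Longrightarrow> \<A> l \<in> hyperbolic_classes p \<and> uminus ` \<A> l = \<A> l"
    and q0: "is_q_k0 k q0" and q: "\<forall>\<^sub>F z in cofinite. q z = (\<Sum>l=1..L. d l * FA (\<A> l) z) + c0 * q0 z"
    using * by blast+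
  have "rpf (\<lambda>z. (\<Sum>l=1..L. d l * FA (\<A> l) z) + c0 * q0 z)"
    by (intro rpf_add rpf_sum rpf_cmult rpf_FA rpf_q_k0 q0) (use A in auto)
  then show ?thesis using q by (rule rpf_cong)
qed

end

context hecke_weight
begin

subsection \<open>Symmetry of irreducible systems of poles\<close>

lemma irreducible_subset: "forced_pole_set p q R \<Longrightarrow> \<alpha> \<in> R \<Longrightarrow> irreducible_poles p q \<alpha> \<subseteq> R"
  by (auto simp: irreducible_poles_def)

lemma irreducible_mem: "\<alpha> \<in> irreducible_poles p q \<alpha>"
  by (auto simp: irreducible_poles_def)

lemma forced_pole_set_real:
  assumes R: "R = of_real ` X" and X: "X \<subseteq> HR"
  shows "forced_pole_set p q R \<longleftrightarrow> R \<subseteq> poles q \<and> (\<forall>b\<in>X. mv Tm b \<in> X) \<and>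
    (\<forall>b\<in>X. \<forall>j\<in>{1..p-1}. of_real (mv (Um (int j)) b) \<in> poles q \<longrightarrow> mv (Um (int j)) b \<in> X)"
proof -
  have d: "lft_denom W (of_real b) \<noteq> 0" if "b \<in> X" "W \<in> G" for b W
    using HR_den that X by (auto simp: lft_denom_real)
  have m: "of_real x \<in> R \<longleftrightarrow> x \<in> X" for x using R by (auto simp: image_iff)
  have ball: "(\<forall>\<beta>\<in>R. Q \<beta>) \<longleftrightarrow> (\<forall>b\<in>X. Q (of_real b))" for Q using R by auto
  show ?thesis
    unfolding forced_pole_set_def ball hecke_T_eq hecke_U_power lft_real m using d by simp
qed

lemma forced_pole_setD:
  assumes "forced_pole_set p q R" "of_real b \<in> R" "b \<in> HR"
  shows "of_real (mv Tm b) \<in> R"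
    "1 \<le> j \<Longrightarrow> j < int p \<Longrightarrow> of_real (mv (Um j) b) \<in> poles q \<Longrightarrow> of_real (mv (Um j) b) \<in> R"
proof -
  have d: "lft_denom W (of_real b) \<noteq> 0" if "W \<in> G" for W
    using HR_den assms that by (simp add: lft_denom_real)
  show "of_real (mv Tm b) \<in> R" using assms by (auto simp: forced_pole_set_def hecke_T_eq lft_real)
  assume j: "1 \<le> j" "j < int p" and P: "of_real (mv (Um j) b) \<in> poles q"
  have "nat j \<in> {1..p-1}" "int (nat j) = j" using j by auto
  then show "of_real (mv (Um j) b) \<in> R"
    using assms P d[of "Um j"] unfolding forced_pole_set_def hecke_U_power by (metis G_Um lft_real)
qed

text \<open>The involution of the simple points of a symmetric class; \<open>T\<close> maps
  \<open>coT x\<close> to the conjugate of x, which is how a forced set reaches conjugates.\<close>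

definition coT :: "real \<Rightarrow> real" where "coT x = mv Tm (cj x)"

lemma coT_ZR:
  assumes A: "\<A> \<in> hyperbolic_classes p" "uminus ` \<A> = \<A>" and x: "x \<in> ZR \<A>"
  shows "coT x \<in> ZR \<A>" "mv Tm (coT x) = cj x" "cj (coT x) = mv Tm x"
proof -
  have xH: "x \<in> HR" "x > 0" "cj x < 0" "hf x \<in> \<A>" using x by (auto simp: ZR_def)
  have c: "cj x \<in> HR" "hf (cj x) \<in> \<A>" using cj_HR[OF xH(1)] class_cj[OF A xH(1)] xH by auto
  show "mv Tm (coT x) = cj x" using mv_T_T[OF c(1)] by (simp add: coT_def)
  show e: "cj (coT x) = mv Tm x" using cj_T[OF c(1)] cj_cj[OF xH(1)] by (simp add: coT_def)
  show "coT x \<in> ZR \<A>" using e HR_T[OF c(1)] class_mv[OF A(1) c(1) G_T] c xH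
    unfolding ZR_def coT_def by (simp add: mv_Tm divide_neg_pos)
qed

text \<open>A step from d to \<open>V i d\<close> is \<open>T\<close> followed by a power of
  \<open>U\<close>, so a forced set containing one simple point of the class contains all of them,
  among them \<open>coT x\<close>, whose image under \<open>T\<close> is the conjugate of x.\<close>

lemma forced_contains_conjugate:
  assumes A: "\<A> \<in> hyperbolic_classes p" "uminus ` \<A> = \<A>"
    and P: "\<And>x. x \<in> ZR \<A> \<Longrightarrow> of_real x \<in> poles q \<and> of_real (cj x) \<in> poles q"
    and R: "forced_pole_set p q R" and x: "x \<in> ZR \<A>"
  shows "of_real x \<in> R \<longleftrightarrow> of_real (cj x) \<in> R"
proof -
  have con: "of_real y \<in> R" if y: "y \<in> ZR \<A>" and z: "z \<in> ZR \<A>" "of_real z \<in> R" for y z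
  proof -
    have "(of_real z \<in> R) = (of_real y \<in> R)"
    proof (rule simple_class_connected[OF _ A(1) z(1) y])
      fix d i assume d: "simple d" "simple (mv (V i) d)" "hf d \<in> \<A>" and i: "1 \<le> i" "i < int p"
      have dH: "d \<in> HR" "d \<in> ZR \<A>" using d by (auto simp: ZR_simple simple_def)
      have v: "mv (V i) d \<in> ZR \<A>" using d class_mv[OF A(1) dH(1) G_V] by (simp add: ZR_simple)
      have T: "mv Tm d \<in> HR" "mv (V i) d = mv (Um i) (mv Tm d)" "mv (V i) d \<in> HR"
        using HR_T dH(1) mv_V ZR_HR[OF v] by auto
      \<comment> \<open>The reverse step: the exponent p - i again lies between 1 and p - 1.\<close>
      have u: "mv (Um (int p - i)) (mv (V i) d) = mv Tm d"
        using mv_Um_Um[OF T(1), of "int p - i" i] T(2) by simp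
      have Tp: "of_real (mv Tm d) \<in> poles q" using P coT_ZR[OF A dH(2)] by metis
      show "(of_real d \<in> R) = (of_real (mv (V i) d) \<in> R)"
      proof
        assume "of_real d \<in> R"
        then have "of_real (mv Tm d) \<in> R" using forced_pole_setD(1)[OF R _ dH(1)] by blast
        then show "of_real (mv (V i) d) \<in> R"
          using forced_pole_setD(2)[OF R _ T(1) i] P[OF v] T(2) by simp
      next
        assume "of_real (mv (V i) d) \<in> R"
        then have "of_real (mv Tm d) \<in> R"
          using forced_pole_setD(2)[OF R _ T(3), of "int p - i"] Tp i u by simp
        then show "of_real d \<in> R" using forced_pole_setD(1)[OF R _ T(1)] mv_T_T[OF dH(1)] by simp
      qed
    qed
    then show ?thesis using z by blast
  qed
  have c: "coT x \<in> ZR \<A>" "mv Tm (coT x) = cj x" using coT_ZR[OF A x] by auto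
  show ?thesis
  proof
    assume "of_real x \<in> R"
    then have "of_real (coT x) \<in> R" using con[OF c(1) x] by blast
    then show "of_real (cj x) \<in> R" using forced_pole_setD(1)[OF R _ ZR_HR[OF c(1)]] c(2) by simp
  next
    assume "of_real (cj x) \<in> R"
    then have "of_real (coT x) \<in> R"
      using forced_pole_setD(1)[OF R _ cj_HR[OF ZR_HR[OF x]]] by (simp add: coT_def)
    then show "of_real x \<in> R" using con[OF x c(1)] by blast
  qed
qed

lemma q_k0_reg: assumes "is_q_k0 k f" "a \<noteq> 0" shows "reg f a"
proof -
  obtain c b where f: "\<And>z. f z = (if 2 * k \<noteq> 2 then c * (1 - z powi (- (2 * int k))) else c * (1 - z powi (- 2)) + b * z powi (- 1))"
    using assms(1) unfolding is_q_k0_def by (elim exE) simp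
  have "isCont f a"
  proof (cases "2 * k \<noteq> 2")
    case True
    then have "f = (\<lambda>z. c * (1 - z powi (- (2 * int k))))" by (intro ext) (simp add: f)
    then show ?thesis using assms(2) by (auto intro!: continuous_intros)
  next
    case False
    then have "f = (\<lambda>z. c * (1 - z powi (- 2)) + b * z powi (- 1))" by (intro ext) (simp add: f)
    then show ?thesis using assms(2) by (auto intro!: continuous_intros)
  qed
  then show ?thesis by (rule reg_continuous)
qed

lemma fx_not_reg: assumes x: "x \<in> HR" shows "\<not> reg (fx x) (of_real x)" "\<not> reg (fx x) (of_real (cj x))"
proof -
  have *: "\<not> reg (fx x) (of_real x)" if "x \<in> HR" for x
    using fx_pole[OF that] pole_order_not_reg(1) k by (metis One_nat_def Suc_leI)
  show "\<not> reg (fx x) (of_real x)" using * x by blast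
  show "\<not> reg (fx x) (of_real (cj x))"
  proof
    assume "reg (fx x) (of_real (cj x))"
    then have "reg (\<lambda>z. - fx x z) (of_real (cj x))" by (rule reg_minus)
    then have "reg (fx (cj x)) (of_real (cj x))" using fx_cj[OF x] by presburger
    then show False using *[OF cj_HR[OF x]] by blast
  qed
qed

text \<open>Singularities of different summands never meet: simple points are positive, their
  conjugates negative, and conjugation is injective. So no pole with nonzero coefficient
  cancels.\<close>

lemma weighted_sum_reg_iff:
  assumes fin: "finite X" and X: "\<And>x. x \<in> X \<Longrightarrow> simple x" and h: "\<And>a. a \<noteq> 0 \<Longrightarrow> reg h a" and a: "a \<noteq> 0"
  shows "reg (\<lambda>z. (\<Sum>x\<in>X. D x * fx x z) + h z) a \<longleftrightarrow> (\<forall>x\<in>X. D x \<noteq> 0 \<longrightarrow> a \<noteq> of_real x \<and> a \<noteq> of_real (cj x))"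
proof
  assume *: "\<forall>x\<in>X. D x \<noteq> 0 \<longrightarrow> a \<noteq> of_real x \<and> a \<noteq> of_real (cj x)"
  have "reg (\<lambda>z. D x * fx x z) a" if "x \<in> X" for x
    using * fx_reg[of x a] X[OF that] that by (cases "D x = 0") (auto simp: simple_def intro: reg_cmult)
  then show "reg (\<lambda>z. (\<Sum>x\<in>X. D x * fx x z) + h z) a" by (intro reg_add reg_sum h a)
next
  assume r: "reg (\<lambda>z. (\<Sum>x\<in>X. D x * fx x z) + h z) a"
  show "\<forall>x\<in>X. D x \<noteq> 0 \<longrightarrow> a \<noteq> of_real x \<and> a \<noteq> of_real (cj x)"
  proof (intro ballI impI, rule ccontr)
    fix x assume x: "x \<in> X" "D x \<noteq> 0" and "\<not> (a \<noteq> of_real x \<and> a \<noteq> of_real (cj x))"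
    then have ax: "a = of_real x \<or> a = of_real (cj x)" by blast
    have xs: "x \<in> HR" "cj x < 0" "x > 0" using X[OF x(1)] by (auto simp: simple_def)
    have "reg (\<lambda>z. D y * fx y z) a" if "y \<in> X - {x}" for y
    proof -
      have y: "y \<in> HR" "cj y < 0" "y > 0" "y \<noteq> x" using X[of y] that by (auto simp: simple_def)
      have "cj y \<noteq> cj x" using cj_cj xs y by metis
      then show ?thesis using ax xs y by (intro reg_cmult fx_reg) auto
    qed
    then have "reg (\<lambda>z. (\<Sum>y\<in>X - {x}. D y * fx y z) + h z) a" by (intro reg_add reg_sum h a)
    from reg_diff[OF r this] have "reg (\<lambda>z. D x * fx x z) a"
      using fin x(1) by (simp add: sum.remove)
    from reg_cmult[OF this, of "1 / D x"] have "reg (fx x) a" using x(2) by simp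
    then show False using fx_not_reg[OF xs(1)] ax by blast
  qed
qed

lemma explicit_symmetric:
  assumes q: "explicit_form p k q" and \<alpha>: "\<alpha> \<in> poles q - {0}"
  shows "hecke_symmetric p (irreducible_poles p q \<alpha>)"
proof -
  from q[unfolded explicit_form_def FA_Z_set]
  obtain L :: nat and \<A> d c0 q0 where *: "(\<forall>l\<in>{1..L}. \<A> l \<in> hyperbolic_classes p \<and> uminus ` \<A> l = \<A> l) \<and>
     is_q_k0 k q0 \<and> (\<forall>\<^sub>F z in cofinite. q z = (\<Sum>l=1..L. d l * FA (\<A> l) z) + c0 * q0 z)"
    by (elim exE)
  have A: "\<A> l \<in> hyperbolic_classes p" "uminus ` \<A> l = \<A> l" if "l \<in> {1..L}" for l using * that by blast+
  have q0: "is_q_k0 k q0" and q: "\<forall>\<^sub>F z in cofinite. q z = (\<Sum>l=1..L. d l * FA (\<A> l) z) + c0 * q0 z"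
    using * by blast+
  \<comment> \<open>Sums over infinite sets are 0 by convention, so the indices outside I contribute
    nothing.\<close>
  define I where "I = {l\<in>{1..L}. finite (ZR (\<A> l))}"
  define X where "X = (\<Union>l\<in>I. ZR (\<A> l))"
  \<comment> \<open>The same class may occur for several l; D collects its coefficients, which may
    add up to 0.\<close>
  define D where "D x = (\<Sum>l\<in>{l\<in>I. x \<in> ZR (\<A> l)}. d l)" for x
  have fI: "finite I" "I \<subseteq> {1..L}" by (auto simp: I_def)
  have fX: "finite X" using fI by (auto simp: X_def I_def)
  have Xs: "simple x" if "x \<in> X" for x using that by (auto simp: X_def ZR_simple)
  have sum_eq: "(\<Sum>l=1..L. d l * FA (\<A> l) z) = (\<Sum>x\<in>X. D x * fx x z)" for z
  proof -
    have "(\<Sum>l=1..L. d l * FA (\<A> l) z) = (\<Sum>l\<in>I. d l * FA (\<A> l) z)"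
      by (rule sum.mono_neutral_right) (auto simp: I_def FA_def)
    also have "\<dots> = (\<Sum>l\<in>I. \<Sum>x | x \<in> X \<and> x \<in> ZR (\<A> l). d l * fx x z)"
    proof (rule sum.cong[OF refl])
      fix l assume "l \<in> I"
      then have "{x. x \<in> X \<and> x \<in> ZR (\<A> l)} = ZR (\<A> l)" by (auto simp: X_def)
      then show "d l * FA (\<A> l) z = (\<Sum>x | x \<in> X \<and> x \<in> ZR (\<A> l). d l * fx x z)" by (simp add: FA_def sum_distrib_left)
    qed
    also have "\<dots> = (\<Sum>x\<in>X. \<Sum>l | l \<in> I \<and> x \<in> ZR (\<A> l). d l * fx x z)"
      by (rule sum.swap_restrict[OF fI(1) fX])
    also have "\<dots> = (\<Sum>x\<in>X. D x * fx x z)" by (simp add: D_def sum_distrib_right)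
    finally show ?thesis .
  qed
  have ratq: "rational_function q" using explicit_rpf[OF assms(1)] rpf_iff by blast
  have h: "reg (\<lambda>z. c0 * q0 z) a" if "a \<noteq> 0" for a using q_k0_reg[OF q0 that] by (rule reg_cmult)
  have poles_iff: "a \<in> poles q \<longleftrightarrow> (\<exists>x\<in>X. D x \<noteq> 0 \<and> (a = of_real x \<or> a = of_real (cj x)))" if "a \<noteq> 0" for a
  proof -
    have "reg q a \<longleftrightarrow> reg (\<lambda>z. (\<Sum>x\<in>X. D x * fx x z) + c0 * q0 z) a"
      by (rule reg_cong) (rule cofinite_at[OF q[unfolded sum_eq]])
    then show ?thesis unfolding poles_def mem_Collect_eq is_pole_iff_not_reg[OF ratq]
      using weighted_sum_reg_iff[OF fX Xs h that, of D] by auto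
  qed
  define Y where "Y = {x. x \<in> X \<and> D x \<noteq> 0} \<union> cj ` {x. x \<in> X \<and> D x \<noteq> 0}"
  have pY: "poles q - {0} = of_real ` Y"
  proof
    show "poles q - {0} \<subseteq> of_real ` Y" using poles_iff by (auto simp: Y_def)
    show "of_real ` Y \<subseteq> poles q - {0}"
    proof
      fix a assume "a \<in> complex_of_real ` Y"
      then obtain x where x: "x \<in> X" "D x \<noteq> 0" "a = of_real x \<or> a = of_real (cj x)" by (auto simp: Y_def)
      then have "a \<noteq> 0" using Xs[OF x(1)] by (auto simp: simple_def)
      then show "a \<in> poles q - {0}" using poles_iff x by blast
    qed
  qed
  \<comment> \<open>Classes are equal or disjoint, so D is constant on the simple points of a
    class.\<close>
  have Yc: "\<exists>l\<in>I. x \<in> ZR (\<A> l) \<and> (\<forall>y\<in>ZR (\<A> l). y \<in> X \<and> D y \<noteq> 0)" if "x \<in> X" "D x \<noteq> 0" for x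
  proof -
    obtain l where l: "l \<in> I" "x \<in> ZR (\<A> l)" using \<open>x \<in> X\<close> by (auto simp: X_def)
    have "D y = D x" if y: "y \<in> ZR (\<A> l)" for y
    proof -
      have "y \<in> ZR (\<A> m) \<longleftrightarrow> x \<in> ZR (\<A> m)" if m: "m \<in> I" for m
      proof -
        have c: "\<A> m \<in> hyperbolic_classes p" "\<A> l \<in> hyperbolic_classes p" using A fI m l by blast+
        have eq: "\<A> m = \<A> l" if "z \<in> ZR (\<A> m)" "z \<in> ZR (\<A> l)" for z
          using class_unique[OF c, of "hf z"] that by (simp add: ZR_simple)
        show ?thesis
        proof
          assume "y \<in> ZR (\<A> m)"
          then have "\<A> m = \<A> l" using y by (rule eq)
          then show "x \<in> ZR (\<A> m)" using l(2) by simp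
        next
          assume "x \<in> ZR (\<A> m)"
          then have "\<A> m = \<A> l" using l(2) by (rule eq)
          then show "y \<in> ZR (\<A> m)" using y by simp
        qed
      qed
      then have "{m\<in>I. y \<in> ZR (\<A> m)} = {m\<in>I. x \<in> ZR (\<A> m)}" by blast
      then show ?thesis by (simp only: D_def)
    qed
    then have "D y \<noteq> 0" if "y \<in> ZR (\<A> l)" for y using \<open>D x \<noteq> 0\<close> that by metis
    moreover have "y \<in> X" if "y \<in> ZR (\<A> l)" for y using l(1) that unfolding X_def by blast
    ultimately show ?thesis using l by blast
  qed
  have poleZ: "of_real y \<in> poles q \<and> of_real (cj y) \<in> poles q" if "y \<in> X" "D y \<noteq> 0" for y
    using pY that by (auto simp: Y_def)
  have YH: "Y \<subseteq> HR" using Xs cj_HR by (auto simp: Y_def simple_def)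
  have cjR: "of_real (cj b) \<in> R" if R: "forced_pole_set p q R" and b: "b \<in> Y" "of_real b \<in> R" for b R
  proof -
    obtain x where x: "x \<in> X" "D x \<noteq> 0" "b = x \<or> b = cj x" using b(1) by (auto simp: Y_def)
    obtain l where l: "l \<in> I" "x \<in> ZR (\<A> l)" "\<And>y. y \<in> ZR (\<A> l) \<Longrightarrow> y \<in> X \<and> D y \<noteq> 0" using Yc[OF x(1,2)] by blast
    have "l \<in> {1..L}" using l fI by blast
    from forced_contains_conjugate[OF A[OF this] _ R l(2)] have "of_real x \<in> R \<longleftrightarrow> of_real (cj x) \<in> R"
      using poleZ l(3) by blast
    then show ?thesis using x(3) b(2) Xs[OF x(1)] by (auto simp: simple_def)
  qed
  \<comment> \<open>The point 0 may be a pole, too. That the nonzero poles alone form a forced set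
    confines every irreducible system to hyperbolic fixed points.\<close>
  have forced: "forced_pole_set p q (of_real ` Y)"
    unfolding forced_pole_set_real[OF refl YH]
  proof (intro conjI ballI impI)
    show "complex_of_real ` Y \<subseteq> poles q" using pY by blast
    fix b assume b: "b \<in> Y"
    show "mv Tm b \<in> Y"
    proof -
      obtain x where x: "x \<in> X" "D x \<noteq> 0" "b = x \<or> b = cj x" using b by (auto simp: Y_def)
      obtain l where l: "l \<in> I" "x \<in> ZR (\<A> l)" "\<And>y. y \<in> ZR (\<A> l) \<Longrightarrow> y \<in> X \<and> D y \<noteq> 0" using Yc[OF x(1,2)] by blast
      have "l \<in> {1..L}" using l fI by blast
      note c = coT_ZR[OF A[OF this] l(2)]
      have "coT x \<in> X \<and> D (coT x) \<noteq> 0" using l(3)[OF c(1)] .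
      moreover have "mv Tm x = cj (coT x)" "mv Tm (cj x) = coT x" using c by (simp_all add: coT_def)
      ultimately show ?thesis using x(3) by (auto simp: Y_def)
    qed
    fix j assume "j \<in> {1..p-1}" and P: "complex_of_real (mv (Um (int j)) b) \<in> poles q"
    have "mv (Um (int j)) b \<noteq> 0" using HR_nonzero HR_mv b YH by blast
    then have "complex_of_real (mv (Um (int j)) b) \<in> poles q - {0}" using P by simp
    then have "complex_of_real (mv (Um (int j)) b) \<in> of_real ` Y" unfolding pY .
    then show "mv (Um (int j)) b \<in> Y" by (auto simp: image_iff)
  qed
  define S where "S = irreducible_poles p q \<alpha>"
  have sub: "S \<subseteq> of_real ` Y" unfolding S_def using irreducible_subset[OF forced] \<alpha> pY by blast
  have conj: "hecke_conjugate p \<beta> \<in> S" "hecke_conjugate p (hecke_conjugate p \<beta>) = \<beta>" if \<beta>: "\<beta> \<in> S" for \<beta>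
  proof -
    obtain b where b: "b \<in> Y" "\<beta> = of_real b" using sub \<beta> by blast
    have bH: "b \<in> HR" using b YH by blast
    show "hecke_conjugate p (hecke_conjugate p \<beta>) = \<beta>"
      unfolding b(2) hecke_conjugate_cj[OF bH] hecke_conjugate_cj[OF cj_HR[OF bH]] cj_cj[OF bH] ..
    have "of_real (cj b) \<in> R" if "forced_pole_set p q R" "\<alpha> \<in> R" for R
      using cjR[OF that(1) b(1)] irreducible_subset[OF that] \<beta> b(2) unfolding S_def by blast
    then show "hecke_conjugate p \<beta> \<in> S" unfolding b(2) hecke_conjugate_cj[OF bH] S_def irreducible_poles_def by blast
  qed
  have "S = hecke_conjugate p ` S"
  proof
    show "S \<subseteq> hecke_conjugate p ` S"
    proof
      fix \<beta> assume "\<beta> \<in> S"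
      from imageI[OF conj(1)[OF this], of "hecke_conjugate p"] show "\<beta> \<in> hecke_conjugate p ` S"
        unfolding conj(2)[OF \<open>\<beta> \<in> S\<close>] .
    qed
    show "hecke_conjugate p ` S \<subseteq> S" using conj(1) by blast
  qed
  moreover have "S \<subseteq> hyperbolic_fixed_points p" using sub YH unfolding hyperbolic_fixed_points_real by blast
  ultimately show ?thesis unfolding hecke_symmetric_def S_def by blast
qed

end

subsection \<open>Positive poles\<close>

lemma lft_diff:
  assumes M: "det2 M = 1" and z: "lft_denom M z \<noteq> 0" "lft_denom M w \<noteq> 0"
  shows "lft M z - lft M w = (z - w) / (lft_denom M z * lft_denom M w)"
proof -
  have "(of_real (M$1$1) * z + of_real (M$1$2)) * lft_denom M w - (of_real (M$1$1) * w + of_real (M$1$2)) * lft_denom M z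
      = of_real (det2 M) * (z - w)"
    by (simp add: lft_denom_def det2_def algebra_simps)
  then show ?thesis using z M by (simp add: lft_eq diff_frac_eq)
qed

lemma power_eq_imp_exponent_eq:
  fixes x :: real assumes "x > 0" "x \<noteq> 1" "x ^ m = x ^ n" shows "m = n"
proof (cases "x > 1")
  case True then show ?thesis using assms power_inject_exp by blast
next
  case False
  then have "1 / x > 1" using assms by simp
  moreover have "(1 / x) ^ m = (1 / x) ^ n" using assms(3) by (simp add: power_divide)
  ultimately show ?thesis using power_inject_exp by blast
qed

lemma has_pole_order_unique: "has_pole_order f a m L \<Longrightarrow> has_pole_order f a m L' \<Longrightarrow> L = L'"
  unfolding has_pole_order_def using tendsto_unique[OF trivial_limit_at] by blast

context hecke_weight
begin

lemma reg_slash_real: "x \<in> HR \<Longrightarrow> W \<in> G \<Longrightarrow> reg (slash k f W) (of_real x) \<longleftrightarrow> reg f (of_real (mv W x))"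
  using reg_slash_iff[of W "of_real x" k f] HR_den by (simp add: lft_denom_real lft_real)

lemma rpf_reg_T:
  assumes f: "rpf f" and x: "x \<in> HR" shows "reg f (of_real (mv Tm x)) \<longleftrightarrow> reg f (of_real x)"
proof -
  have "\<forall>\<^sub>F z in cofinite. f z + slash k f Tm z = 0" using f by (simp add: rpf_iff)
  then have "\<forall>\<^sub>F z in cofinite. slash k f Tm z = - f z" by eventually_elim (simp add: eq_neg_iff_add_eq_0 add.commute)
  from cofinite_at[OF this] have "reg (slash k f Tm) (of_real x) \<longleftrightarrow> reg (\<lambda>z. - f z) (of_real x)" by (rule reg_cong)
  also have "\<dots> \<longleftrightarrow> reg f (of_real x)" using reg_minus[of f] reg_minus[of "\<lambda>z. - f z"] by auto
  finally show ?thesis using reg_slash_real[OF x G_T] by simp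
qed

text \<open>The second relation equates the sum over J with the negative of the remaining terms,
  which are regular at w. It is applied when J collects the singular terms.\<close>

lemma rpf_reg_U_sum:
  assumes f: "rpf f" and w: "w \<in> HR" and J: "J \<subseteq> {0..<int p}"
    and r: "\<And>j. j \<in> {0..<int p} - J \<Longrightarrow> reg f (of_real (mv (Um j) w))"
  shows "reg (\<lambda>z. \<Sum>j\<in>J. slash k f (Um j) z) (of_real w)"
proof -
  have "\<forall>\<^sub>F z in cofinite. (\<Sum>j\<in>{0..<int p}. slash k f (Um j) z) = 0" using f by (simp add: rpf_iff)
  then have "\<forall>\<^sub>F z in cofinite. - (\<Sum>j\<in>{0..<int p} - J. slash k f (Um j) z) = (\<Sum>j\<in>J. slash k f (Um j) z)"
  proof eventually_elim
    case (elim z)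
    have "(\<Sum>j\<in>{0..<int p}. slash k f (Um j) z) = (\<Sum>j\<in>{0..<int p} - J. slash k f (Um j) z) + (\<Sum>j\<in>J. slash k f (Um j) z)"
      by (rule sum.subset_diff[OF J]) simp
    with elim have "(\<Sum>j\<in>{0..<int p} - J. slash k f (Um j) z) + (\<Sum>j\<in>J. slash k f (Um j) z) = 0" by simp
    then show ?case by (rule minus_unique)
  qed
  from reg_cong[OF cofinite_at[OF this]]
  have "reg (\<lambda>z. - (\<Sum>j\<in>{0..<int p} - J. slash k f (Um j) z)) (of_real w) \<longleftrightarrow> reg (\<lambda>z. \<Sum>j\<in>J. slash k f (Um j) z) (of_real w)" .
  moreover have "reg (\<lambda>z. - (\<Sum>j\<in>{0..<int p} - J. slash k f (Um j) z)) (of_real w)"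
    by (intro reg_minus reg_sum) (use r reg_slash_real[OF w G_Um] in blast)
  ultimately show ?thesis by blast
qed

text \<open>With J the factor of W at g, W z - g behaves like (z - g) / J^2, so slashing multiplies
  the leading coefficient by the power 2 m - 2 k of J. It must remain unchanged, and \<bar>J\<bar>
  \<noteq> 1.\<close>

lemma fixed_pole_order:
  assumes g: "g \<in> HR" and W: "W \<in> rst g" "\<bar>den W g\<bar> \<noteq> 1"
    and inv: "reg (\<lambda>z. slash k f W z - f z) (of_real g)" and m: "has_pole_order f (of_real g) m L" "m \<ge> 1" "L \<noteq> 0"
  shows "m = k"
proof -
  define a J where "a = complex_of_real g" and "J = complex_of_real (den W g)"
  have WG: "det2 W = 1" using rst_G[OF W(1)] by simp
  have J: "J \<noteq> 0" "lft_denom W a = J" using rst_den[OF W(1)] by (simp_all add: J_def a_def lft_denom_real)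
  have fa: "lft W a = a" using rst_rfix[OF W(1)] by (simp add: a_def lft_real rfix_def)
  have l: "((\<lambda>z. (z - a) ^ m * f z) \<longlongrightarrow> L) (at a)" using m by (simp add: has_pole_order_def a_def)
  have "filterlim (lft W) (at a) (at a)" using lft_filterlim[OF WG, of a] J fa by simp
  from filterlim_compose[OF l this] have l2: "((\<lambda>z. (lft W z - a) ^ m * f (lft W z)) \<longlongrightarrow> L) (at a)" .
  have dt: "(lft_denom W \<longlongrightarrow> J) (at a)" using isCont_lft_denom[of a W] J(2) by (simp add: isCont_def)
  have "((\<lambda>z. ((lft_denom W z * J) ^ m * lft_denom W z powi (- (2 * int k))) * ((lft W z - a) ^ m * f (lft W z)))
      \<longlongrightarrow> ((J * J) ^ m * J powi (- (2 * int k))) * L) (at a)"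
    using J(1) by (intro tendsto_intros l2 dt) auto
  moreover have "\<forall>\<^sub>F z in at a. ((lft_denom W z * J) ^ m * lft_denom W z powi (- (2 * int k))) * ((lft W z - a) ^ m * f (lft W z))
      = (z - a) ^ m * slash k f W z"
    using cofinite_at[OF lft_denom_cofinite[OF WG]]
  proof eventually_elim
    case (elim z)
    have "(lft W z - a) * (lft_denom W z * J) = z - a"
      using lft_diff[OF WG elim, of a] J fa elim by simp
    then have "(z - a) ^ m = (lft_denom W z * J) ^ m * (lft W z - a) ^ m"
      by (simp only: power_mult_distrib[symmetric] mult.commute)
    then show ?case by (simp add: slash_def)
  qed
  ultimately have l3: "((\<lambda>z. (z - a) ^ m * slash k f W z) \<longlongrightarrow> ((J * J) ^ m * J powi (- (2 * int k))) * L) (at a)"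
    by (simp add: tendsto_cong)
  obtain c where "((\<lambda>z. slash k f W z - f z) \<longlongrightarrow> c) (at a)" using inv by (auto simp: reg_def a_def)
  moreover have "((\<lambda>z. (z - a) ^ m) \<longlongrightarrow> 0) (at a)" using m(2) by (auto intro!: tendsto_eq_intros)
  ultimately have "((\<lambda>z. (z - a) ^ m * (slash k f W z - f z)) \<longlongrightarrow> 0 * c) (at a)" by (intro tendsto_mult)
  then have "((\<lambda>z. (z - a) ^ m * (slash k f W z - f z)) \<longlongrightarrow> 0) (at a)" by simp
  moreover have "((\<lambda>z. (z - a) ^ m * (slash k f W z - f z)) \<longlongrightarrow> ((J * J) ^ m * J powi (- (2 * int k))) * L - L) (at a)"
    using tendsto_diff[OF l3 l] by (simp add: right_diff_distrib)
  ultimately have "((J * J) ^ m * J powi (- (2 * int k))) * L - L = 0" using tendsto_unique[OF trivial_limit_at] by blast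
  then have e1: "(J * J) ^ m * J powi (- (2 * int k)) = 1" using m(3) by simp
  have e2: "J powi (- (2 * int k)) * (J * J) ^ k = 1"
  proof -
    have "J powi (2 * int k) = (J * J) ^ k"
      using power_int_of_nat[of J "2 * k"] by (simp add: power_mult power2_eq_square)
    then show ?thesis using J(1) by (simp add: power_int_minus)
  qed
  have "(J * J) ^ m = (J * J) ^ m * (J powi (- (2 * int k)) * (J * J) ^ k)" unfolding e2 by simp
  also have "\<dots> = (J * J) ^ k" unfolding mult.assoc[symmetric] e1 by simp
  finally have "norm ((J * J) ^ m) = norm ((J * J) ^ k)" by (rule arg_cong)
  then have n: "norm (J * J) ^ m = norm (J * J) ^ k" unfolding norm_power .
  have j: "norm J > 0" "norm J \<noteq> 1" using J(1) W(2) by (simp_all add: J_def)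
  have "norm (J * J) > 0" using J(1) by simp
  moreover have "norm (J * J) \<noteq> 1"
  proof
    assume "norm (J * J) = 1"
    then have "norm J * norm J = 1" by (simp only: norm_mult)
    then show False using power_eq_1_iff[of "norm J" 2] j by (auto simp: power2_eq_square)
  qed
  ultimately show ?thesis using power_eq_imp_exponent_eq n by blast
qed

lemma fx_invariant:
  assumes g: "g \<in> HR" and W: "W \<in> rst g"
  shows "\<forall>\<^sub>F z in cofinite. slash k (fx g) W z = fx g z"
proof -
  have "mv (madj W) g = g" using rst_rfix[OF rst_madj(1)[OF W]] by (simp add: rfix_def)
  moreover have "\<forall>\<^sub>F z in cofinite. lft_denom W z \<noteq> 0" using rst_G[OF W] by (intro lft_denom_cofinite) simp
  ultimately show ?thesis using fx_slash[OF g rst_G[OF W]] by (auto elim: eventually_mono)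
qed

text \<open>Subtract the multiple of \<open>fx g\<close> that removes the term of order k. The
  difference h inherits the invariance, so a pole of h would again have order exactly k, where its
  coefficient is 0.\<close>

lemma coefficient_exists:
  assumes f: "rational_function f" and g: "g \<in> HR" and W: "W \<in> rst g" "\<bar>den W g\<bar> \<noteq> 1"
    and inv: "reg (\<lambda>z. slash k f W z - f z) (of_real g)"
  shows "\<exists>c. reg (\<lambda>z. f z - c * fx g z) (of_real g)"
proof (rule rational_reg_or_pole[OF f, of "of_real g"])
  assume "reg f (of_real g)"
  then show ?thesis by (intro exI[of _ 0]) simp
next
  fix m L assume m: "1 \<le> m" "L \<noteq> 0" "has_pole_order f (of_real g) m L"
  have mk: "m = k" by (rule fixed_pole_order[OF g W inv m(3,1,2)])
  obtain L0 where L0: "L0 \<noteq> 0" "has_pole_order (fx g) (of_real g) k L0" using fx_pole[OF g] .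
  define c where "c = L / L0"
  define h where "h = (\<lambda>z. f z - c * fx g z)"
  have "(\<lambda>z. f z + (- c) * fx g z) = h" by (simp add: h_def)
  then have rat: "rational_function h"
    using rational_function_add[OF f rational_function_mult[OF rational_function_const[of "- c"] fx_rational[OF g]]] by simp
  have "\<forall>\<^sub>F z in cofinite. slash k f W z - f z = slash k h W z - h z"
    using fx_invariant[OF g W(1)]
  proof eventually_elim
    case (elim z)
    have "slash k h W z = slash k f W z - c * slash k (fx g) W z" unfolding h_def by (simp only: slash_linear)
    then show ?case using elim by (simp add: h_def)
  qed
  from reg_cong[OF cofinite_at[OF this]] have inv': "reg (\<lambda>z. slash k h W z - h z) (of_real g)" using inv by blast
  have h0: "has_pole_order h (of_real g) k 0"
  proof -
    have "((\<lambda>z. (z - of_real g) ^ k * f z - c * ((z - of_real g) ^ k * fx g z)) \<longlongrightarrow> L - c * L0) (at (of_real g))"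
      using m(3) L0(2) unfolding has_pole_order_def mk by (intro tendsto_intros)
    moreover have "L - c * L0 = 0" using L0 by (simp add: c_def)
    ultimately show ?thesis unfolding has_pole_order_def h_def by (simp add: right_diff_distrib mult.left_commute)
  qed
  have "reg h (of_real g)"
  proof (rule rational_reg_or_pole[OF rat, of "of_real g"])
    fix m' L' assume m': "1 \<le> m'" "L' \<noteq> 0" "has_pole_order h (of_real g) m' L'"
    have "m' = k" by (rule fixed_pole_order[OF g W inv' m'(3,1,2)])
    then show ?thesis using has_pole_order_unique[OF h0] m' by simp
  qed
  then show ?thesis unfolding h_def by blast
qed

lemma coefficient_unique:
  assumes g: "g \<in> HR" and r: "reg (\<lambda>z. f z - c * fx g z) (of_real g)" "reg (\<lambda>z. f z - c' * fx g z) (of_real g)"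
  shows "c = c'"
proof (rule ccontr)
  assume n: "c \<noteq> c'"
  have "(\<lambda>z. (f z - c' * fx g z) - (f z - c * fx g z)) = (\<lambda>z. (c - c') * fx g z)" by (simp add: algebra_simps)
  then have "reg (\<lambda>z. (c - c') * fx g z) (of_real g)" using reg_diff[OF r(2,1)] by simp
  from reg_cmult[OF this, of "1 / (c - c')"] have "reg (fx g) (of_real g)" using n by simp
  then show False using fx_not_reg[OF g] by blast
qed

end

locale symmetric_rpf = hecke_weight p k for p k +
  fixes q :: "complex \<Rightarrow> complex"
  assumes q: "rational_period_function p k q"
    and sym: "\<And>\<alpha>. \<alpha> \<in> poles q - {0} \<Longrightarrow> hecke_symmetric p (irreducible_poles p q \<alpha>)"
begin

lemma rat_q: "rational_function q"
  using q rpf_iff by blast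

lemma poles_q: "a \<in> poles q \<longleftrightarrow> \<not> reg q a"
  by (simp add: poles_def is_pole_iff_not_reg[OF rat_q])

text \<open>A pole belongs to its own irreducible system, and \<open>hecke_symmetric\<close>
  includes that the system consists of hyperbolic fixed points.\<close>

lemma nonzero_pole_real: assumes "a \<noteq> 0" "\<not> reg q a" obtains b where "b \<in> HR" "a = of_real b"
proof -
  have "a \<in> poles q - {0}" using assms poles_q by simp
  then have "a \<in> hyperbolic_fixed_points p" using sym irreducible_mem unfolding hecke_symmetric_def by blast
  then show ?thesis using that unfolding hyperbolic_fixed_points_real by blast
qed

definition Pp :: "real set" where "Pp = {g \<in> HR. g > 0 \<and> \<not> reg q (of_real g)}"

lemma finite_Pp: "finite Pp"
proof -
  have "of_real ` Pp \<subseteq> poles q" by (auto simp: Pp_def poles_q)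
  then have "finite (complex_of_real ` Pp)" using finite_poles[OF rat_q] finite_subset by blast
  then show ?thesis by (rule finite_imageD) (simp add: inj_on_def)
qed

lemma PpD: "g \<in> Pp \<Longrightarrow> g \<in> HR" "g \<in> Pp \<Longrightarrow> g > 0" "g \<in> Pp \<Longrightarrow> \<not> reg q (of_real g)"
  by (auto simp: Pp_def)

text \<open>\<open>T g\<close> is the negative point of its \<open>U\<close>-orbit, so the other
  points are positive and only the pole condition is left to decide.\<close>

lemma Pp_orbit:
  assumes g: "g \<in> Pp" and j: "1 \<le> j" "j < int p"
  shows "mv (V j) g \<in> Pp \<longleftrightarrow> \<not> reg q (of_real (mv (Um j) (mv Tm g)))"
proof -
  have w: "mv Tm g \<in> HR" "mv (Um 0) (mv Tm g) < 0" using HR_T PpD[OF g] by (auto simp: mv_Tm)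
  have "\<not> mv (Um j) (mv Tm g) < 0" using U_neg_unique[of 0 "mv Tm g" j] w j by auto
  moreover have "mv (Um j) (mv Tm g) \<noteq> 0" "mv (Um j) (mv Tm g) \<in> HR" using HR_mv[OF w(1) G_Um] HR_nonzero by auto
  ultimately show ?thesis using mv_V[OF PpD(1)[OF g]] by (auto simp: Pp_def)
qed

lemma Pp_next: assumes g: "g \<in> Pp" shows "\<exists>i. 1 \<le> i \<and> i < int p \<and> mv (V i) g \<in> Pp"
proof (rule ccontr)
  assume no: "\<not> ?thesis"
  have w: "mv Tm g \<in> HR" using HR_T PpD[OF g] by auto
  have "reg (\<lambda>z. \<Sum>j\<in>{0}. slash k q (Um j) z) (of_real (mv Tm g))"
  proof (rule rpf_reg_U_sum[OF q w])
    fix j assume "j \<in> {0..<int p} - {0}"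
    then have "1 \<le> j" "j < int p" by auto
    then show "reg q (of_real (mv (Um j) (mv Tm g)))" using Pp_orbit[OF g] no by blast
  qed (use p3 in auto)
  then have "reg q (of_real (mv Tm g))" by simp
  then show False using rpf_reg_T[OF q PpD(1)[OF g]] PpD(3)[OF g] by blast
qed

definition ix :: "real \<Rightarrow> int" where "ix g = (SOME i. 1 \<le> i \<and> i < int p \<and> mv (V i) g \<in> Pp)"

definition nx :: "real \<Rightarrow> real" where "nx g = mv (V (ix g)) g"

lemma ix: assumes "g \<in> Pp" shows "1 \<le> ix g" "ix g < int p" "nx g \<in> Pp"
  using someI_ex[OF Pp_next[OF assms]] unfolding ix_def[symmetric] nx_def by auto

lemma nx_inj: "inj_on nx Pp"
proof (rule inj_onI)
  fix x y assume x: "x \<in> Pp" and y: "y \<in> Pp" and e: "nx x = nx y"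
  show "x = y"
    by (rule V_inj(2)[OF PpD(1,2)[OF x] PpD(1,2)[OF y] ix(1,2)[OF x] ix(1,2)[OF y]]) (use e in \<open>simp add: nx_def\<close>)
qed

lemma nx_image: "nx ` Pp = Pp"
  by (rule endo_inj_surj[OF finite_Pp _ nx_inj]) (use ix in auto)

text \<open>Every positive pole is \<open>nx h\<close> for some positive pole h, since an injection
  of a finite set into itself is onto; \<open>V_inj\<close> then identifies g with h and j with the
  index of h.\<close>

lemma ix_unique: assumes g: "g \<in> HR" "g > 0" and j: "1 \<le> j" "j < int p" "mv (V j) g \<in> Pp" shows "g \<in> Pp" "j = ix g"
proof -
  obtain h where h: "h \<in> Pp" "mv (V j) g = mv (V (ix h)) h" using j(3) nx_image by (auto simp: nx_def)
  have "j = ix h" "g = h" using V_inj[OF g PpD(1,2)[OF h(1)] j(1,2) ix(1,2)[OF h(1)] h(2)] by blast+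
  then show "g \<in> Pp" "j = ix g" using h by auto
qed

text \<open>At \<open>T g\<close> only the terms of index 0 and \<open>ix g\<close> of the second
  relation are singular. Slashing their sum by \<open>T\<close> moves it to g, where q | T = -
  q.\<close>

lemma V_invariant: assumes g: "g \<in> Pp" shows "reg (\<lambda>z. slash k q (V (ix g)) z - q z) (of_real g)"
proof -
  have gH: "g \<in> HR" using PpD[OF g] by blast
  have w: "mv Tm g \<in> HR" using HR_T gH by auto
  define i where "i = ix g"
  have i: "1 \<le> i" "i < int p" using ix[OF g] by (auto simp: i_def)
  define F where "F = (\<lambda>z. \<Sum>j\<in>{0, i}. slash k q (Um j) z)"
  have "reg F (of_real (mv Tm g))"
    unfolding F_def
  proof (rule rpf_reg_U_sum[OF q w])
    fix j assume "j \<in> {0..<int p} - {0, i}"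
    then have j: "1 \<le> j" "j < int p" "j \<noteq> i" by auto
    have "mv (V j) g \<notin> Pp" using ix_unique(2)[OF PpD(1,2)[OF g] j(1,2)] j(3) by (auto simp: i_def)
    then show "reg q (of_real (mv (Um j) (mv Tm g)))" using Pp_orbit[OF g j(1,2)] by blast
  qed (use p3 i in auto)
  then have r: "reg (slash k F Tm) (of_real g)" using reg_slash_real[OF gH G_T] by blast
  have F: "F = (\<lambda>z. q z + slash k q (Um i) z)" using i by (auto simp: F_def)
  have qT: "\<forall>\<^sub>F z in cofinite. q z + slash k q Tm z = 0" using q rpf_iff by blast
  have "\<forall>\<^sub>F z in cofinite. slash k F Tm z = slash k q (V i) z - q z"
    using qT slash_slash_cofinite[OF det2_Tm, of k q "Um i"]
  proof eventually_elim
    case (elim z)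
    have "slash k F Tm z = slash k q Tm z + slash k q (Um i ** Tm) z" unfolding F slash_linear using elim by simp
    also have "slash k q (Um i ** Tm) z = slash k q (V i) z" by (simp add: V_Um(1))
    finally show ?case using elim by (simp add: algebra_simps add_eq_0_iff)
  qed
  from reg_cong[OF cofinite_at[OF this]] r show ?thesis by (simp add: i_def)
qed

lemma nx_pow: "g \<in> Pp \<Longrightarrow> (nx ^^ n) g \<in> Pp"
  by (induction n) (use ix in auto)

lemma nx_pow_inj: "x \<in> Pp \<Longrightarrow> y \<in> Pp \<Longrightarrow> (nx ^^ n) x = (nx ^^ n) y \<Longrightarrow> x = y"
proof (induction n)
  case (Suc n)
  then have "(nx ^^ n) x = (nx ^^ n) y" using inj_onD[OF nx_inj] nx_pow by simp
  then show ?case using Suc by blast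
qed simp

lemma nx_cycle: assumes g: "g \<in> Pp" obtains n where "n \<ge> 1" "(nx ^^ n) g = g"
proof -
  have "\<not> inj (\<lambda>n. (nx ^^ n) g)"
  proof
    assume "inj (\<lambda>n. (nx ^^ n) g)"
    then have "infinite (range (\<lambda>n. (nx ^^ n) g))" using range_inj_infinite by blast
    moreover have "range (\<lambda>n. (nx ^^ n) g) \<subseteq> Pp" using nx_pow[OF g] by blast
    ultimately show False using finite_Pp finite_subset by blast
  qed
  then obtain i j where ij: "i < j" "(nx ^^ i) g = (nx ^^ j) g" unfolding inj_def by (metis nat_neq_iff)
  have "(nx ^^ j) g = (nx ^^ i) ((nx ^^ (j - i)) g)" using ij(1) by (metis comp_apply funpow_add le_add_diff_inverse less_imp_le)
  then have "(nx ^^ (j - i)) g = g" using nx_pow_inj[OF nx_pow[OF g] g] ij(2) by metis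
  then show ?thesis using that[of "j - i"] ij(1) by simp
qed

text \<open>The cocycle rule q | V W - q = (q | V - q) | W + (q | W - q) extends the invariance
  along the word.\<close>

lemma nx_word:
  assumes g: "g \<in> Pp"
  shows "\<exists>W\<in>Mon. mv W g = (nx ^^ n) g \<and> (n \<ge> 1 \<longrightarrow> W \<noteq> mat 1 \<and> W \<noteq> - mat 1) \<and> reg (\<lambda>z. slash k q W z - q z) (of_real g)"
proof (induction n)
  case 0
  show ?case by (rule bexI[OF _ Mon_one]) simp
next
  case (Suc n)
  then obtain W where W: "W \<in> Mon" "mv W g = (nx ^^ n) g" "reg (\<lambda>z. slash k q W z - q z) (of_real g)" by blast
  define y where "y = (nx ^^ n) g"
  have y: "y \<in> Pp" using nx_pow[OF g] by (simp add: y_def)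
  have gH: "g \<in> HR" using PpD[OF g] by blast
  have WG: "W \<in> G" using W by blast
  define W' where "W' = V (ix y) ** W"
  have "mv W' g = nx y" unfolding W'_def HR_mv_mult[OF gH WG] W(2) by (simp add: nx_def y_def)
  moreover have "W' \<noteq> mat 1" "W' \<noteq> - mat 1" "W' \<in> Mon"
    using Mon_step_nontrivial[OF W(1) ix(1,2)[OF y]] Mon_step[OF W(1) ix(1,2)[OF y]] by (simp_all add: W'_def)
  moreover have "reg (\<lambda>z. slash k q W' z - q z) (of_real g)"
  proof -
    define F where "F = (\<lambda>z. slash k q (V (ix y)) z - q z)"
    have "reg F (of_real (mv W g))" using V_invariant[OF y] W(2) by (simp add: F_def y_def)
    then have "reg (slash k F W) (of_real g)" using reg_slash_real[OF gH WG] by blast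
    from reg_add[OF this W(3)] have r: "reg (\<lambda>z. slash k F W z + (slash k q W z - q z)) (of_real g)" .
    have "\<forall>\<^sub>F z in cofinite. slash k F W z + (slash k q W z - q z) = slash k q W' z - q z"
      using slash_slash_cofinite[of W k q "V (ix y)"] G_det[OF WG]
      by (auto simp: F_def slash_linear W'_def elim: eventually_mono)
    from reg_cong[OF cofinite_at[OF this]] r show ?thesis by blast
  qed
  ultimately show ?case by (intro bexI[of _ W']) (auto simp: y_def)
qed

lemma Pp_fixed:
  assumes g: "g \<in> Pp"
  shows "simple g" "\<exists>c. reg (\<lambda>z. q z - c * fx g z) (of_real g)"
proof -
  obtain n where n: "n \<ge> 1" "(nx ^^ n) g = g" using nx_cycle[OF g] .
  obtain W where W: "W \<in> Mon" "mv W g = g" "W \<noteq> mat 1" "W \<noteq> - mat 1" "reg (\<lambda>z. slash k q W z - q z) (of_real g)"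
    using nx_word[OF g, of n] n by auto
  have gH: "g \<in> HR" "g > 0" using PpD[OF g] by auto
  show "simple g" using Mon_fixed_simple(1)[OF gH W(1,3,4,2)] .
  have "W \<in> rst g" using W HR_den[OF gH(1)] by (auto simp: rst_def rfix_def)
  then show "\<exists>c. reg (\<lambda>z. q z - c * fx g z) (of_real g)"
    using coefficient_exists[OF rat_q gH(1) _ Mon_fixed_simple(2)[OF gH W(1,3,4,2)] W(5)] by blast
qed

definition co :: "real \<Rightarrow> complex" where "co g = (SOME c. reg (\<lambda>z. q z - c * fx g z) (of_real g))"

lemma co_reg: assumes g: "simple g" shows "reg (\<lambda>z. q z - co g * fx g z) (of_real g)"
proof -
  have "\<exists>c. reg (\<lambda>z. q z - c * fx g z) (of_real g)"
  proof (cases "g \<in> Pp")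
    case True then show ?thesis using Pp_fixed by blast
  next
    case False
    then have "reg q (of_real g)" using g by (auto simp: Pp_def simple_def)
    then show ?thesis by (intro exI[of _ 0]) simp
  qed
  from someI_ex[OF this] show ?thesis unfolding co_def .
qed

lemma co_zero_iff: assumes g: "simple g" shows "co g = 0 \<longleftrightarrow> g \<notin> Pp"
proof
  assume "co g = 0" then show "g \<notin> Pp" using co_reg[OF g] by (simp add: Pp_def)
next
  assume "g \<notin> Pp"
  then have "reg (\<lambda>z. q z - 0 * fx g z) (of_real g)" using g by (auto simp: Pp_def simple_def)
  then show "co g = 0" using coefficient_unique[OF _ co_reg[OF g]] g by (simp add: simple_def)
qed

text \<open>If d is a pole, i is its pole index, so slashing by \<open>V i\<close> carries the
  expansion at \<open>V i d\<close> to d and \<open>fx\<close> of the image point to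
  \<open>fx d\<close>. If d is no pole, neither is \<open>V i d\<close>, and both coefficients are
  0.\<close>

lemma co_step:
  assumes d: "simple d" "simple (mv (V i) d)" and i: "1 \<le> i" "i < int p"
  shows "co d = co (mv (V i) d)"
proof -
  have dH: "d \<in> HR" "d > 0" using d by (auto simp: simple_def)
  define y where "y = mv (V i) d"
  have y: "y \<in> HR" "mv (madj (V i)) y = d" using HR_mv[OF dH(1) G_V] HR_mv_madj(1)[OF dH(1) G_V] by (auto simp: y_def)
  show ?thesis
  proof (cases "d \<in> Pp")
    case True
    have "i = ix d"
      by (rule simple_V_index[OF d i]) (use Pp_fixed(1)[OF ix(3)[OF True]] ix[OF True] in \<open>simp_all add: nx_def\<close>)
    then have inv: "reg (\<lambda>z. slash k q (V i) z - q z) (of_real d)" using V_invariant[OF True] by simp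
    define F where "F = (\<lambda>z. q z - co y * fx y z)"
    have "reg F (of_real (mv (V i) d))" using co_reg[OF d(2)] by (simp add: F_def y_def)
    then have "reg (slash k F (V i)) (of_real d)" using reg_slash_real[OF dH(1) G_V] by blast
    from reg_diff[OF this inv] have r: "reg (\<lambda>z. slash k F (V i) z - (slash k q (V i) z - q z)) (of_real d)" .
    have "\<forall>\<^sub>F z in cofinite. slash k F (V i) z - (slash k q (V i) z - q z) = q z - co y * fx d z"
      using lft_denom_cofinite[OF det2_V[of i]]
      by eventually_elim (simp add: F_def slash_linear fx_slash[OF y(1) G_V] y(2))
    from reg_cong[OF cofinite_at[OF this]] r have "reg (\<lambda>z. q z - co y * fx d z) (of_real d)" by blast
    then show ?thesis using coefficient_unique[OF dH(1) co_reg[OF d(1)]] by (simp add: y_def)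
  next
    case False
    then have "mv (V i) d \<notin> Pp" using ix_unique(1)[OF dH i] by blast
    then show ?thesis using False co_zero_iff[OF d(1)] co_zero_iff[OF d(2)] by simp
  qed
qed

lemma co_class: assumes A: "\<A> \<in> hyperbolic_classes p" and x: "x \<in> ZR \<A>" and y: "y \<in> ZR \<A>" shows "co x = co y"
proof -
  have "(co x = co y) = (co y = co y)"
    by (rule simple_class_connected[OF _ A x y]) (simp add: co_step)
  then show ?thesis by simp
qed

text \<open>The poles lying in the class of g form a forced set, so the irreducible system of g
  stays inside the class. By symmetry it contains the conjugate of g.\<close>

lemma Pp_class_symmetric:
  assumes g: "g \<in> Pp" and A: "\<A> \<in> hyperbolic_classes p" "hf g \<in> \<A>" shows "uminus ` \<A> = \<A>"
proof -
  have gH: "g \<in> HR" using PpD[OF g] by blast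
  define X where "X = {b \<in> HR. \<not> reg q (of_real b) \<and> hf b \<in> \<A>}"
  have XH: "X \<subseteq> HR" by (auto simp: X_def)
  have mX: "mv W b \<in> X" if "b \<in> X" "W \<in> G" "\<not> reg q (of_real (mv W b))" for b W
    using that HR_mv class_mv[OF A(1)] by (auto simp: X_def)
  have "forced_pole_set p q (of_real ` X)"
    unfolding forced_pole_set_real[OF refl XH]
  proof (intro conjI ballI impI)
    show "complex_of_real ` X \<subseteq> poles q" by (auto simp: X_def poles_q)
    show "mv Tm b \<in> X" if b: "b \<in> X" for b
      using mX[OF b G_T] rpf_reg_T[OF q, of b] b by (auto simp: X_def)
    show "mv (Um (int j)) b \<in> X" if "b \<in> X" "complex_of_real (mv (Um (int j)) b) \<in> poles q" for b j
      using mX[OF that(1) G_Um] that(2) by (simp add: poles_q)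
  qed
  then have "irreducible_poles p q (of_real g) \<subseteq> of_real ` X"
    by (rule irreducible_subset) (use g A in \<open>auto simp: X_def Pp_def\<close>)
  moreover have "hecke_symmetric p (irreducible_poles p q (of_real g))"
    using PpD[OF g] by (intro sym) (auto simp: poles_q)
  then have "hecke_conjugate p (of_real g) \<in> irreducible_poles p q (of_real g)"
    using irreducible_mem[of "of_real g" q] unfolding hecke_symmetric_def by blast
  ultimately have "complex_of_real (cj g) \<in> of_real ` X" unfolding hecke_conjugate_cj[OF gH] by blast
  then have "hf (cj g) \<in> \<A>" by (auto simp: X_def)
  then show ?thesis using class_symmetric[OF A(1) gH A(2)] by blast
qed

lemma decomposition:
  obtains L :: nat and \<A> d r where "\<And>l. l \<in> {1..L} \<Longrightarrow> \<A> l \<in> hyperbolic_classes p \<and> uminus ` \<A> l = \<A> l"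
    "\<And>z. q z = (\<Sum>l=1..L. d l * FA (\<A> l) z) + r z" "rpf r" "\<And>a. a \<noteq> 0 \<Longrightarrow> reg r a"
proof -
  define cl where "cl g = hecke_equiv p `` {hf g}" for g
  define C where "C = cl ` Pp"
  have finC: "finite C" using finite_Pp by (simp add: C_def)
  have C: "\<A> \<in> hyperbolic_classes p" "uminus ` \<A> = \<A>" "\<exists>g\<in>Pp. g \<in> ZR \<A>" if "\<A> \<in> C" for \<A>
  proof -
    obtain g where g: "g \<in> Pp" "\<A> = cl g" using \<open>\<A> \<in> C\<close> by (auto simp: C_def)
    show A: "\<A> \<in> hyperbolic_classes p" using class_exists(1) PpD[OF g(1)] g(2) by (simp add: cl_def)
    have h: "hf g \<in> \<A>" using class_exists(2) PpD[OF g(1)] g(2) by (simp add: cl_def)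
    show "uminus ` \<A> = \<A>" using Pp_class_symmetric[OF g(1) A h] .
    show "\<exists>g\<in>Pp. g \<in> ZR \<A>" using g(1) h Pp_fixed(1)[OF g(1)] by (auto simp: ZR_simple)
  qed
  \<comment> \<open>The coefficient is constant on the class and nonzero at one point, so all simple
    points of the class are poles.\<close>
  have sub: "ZR \<A> \<subseteq> Pp" if A: "\<A> \<in> C" for \<A>
  proof
    fix x assume x: "x \<in> ZR \<A>"
    obtain g where g: "g \<in> Pp" "g \<in> ZR \<A>" using C(3)[OF A] by blast
    have "co x = co g" using co_class[OF C(1)[OF A] x g(2)] .
    then show "x \<in> Pp" using co_zero_iff[of x] co_zero_iff[of g] x g by (auto simp: ZR_simple)
  qed
  have Un: "Pp = (\<Union>\<A>\<in>C. ZR \<A>)"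
  proof
    show "Pp \<subseteq> (\<Union>\<A>\<in>C. ZR \<A>)"
    proof
      fix g assume g: "g \<in> Pp"
      then have "g \<in> ZR (cl g)" using class_exists(2) PpD(1)[OF g] Pp_fixed(1)[OF g] unfolding ZR_simple cl_def by blast
      then show "g \<in> (\<Union>\<A>\<in>C. ZR \<A>)" using g by (auto simp: C_def)
    qed
  qed (use sub in blast)
  have disj: "ZR \<A> \<inter> ZR \<B> = {}" if "\<A> \<in> C" "\<B> \<in> C" "\<A> \<noteq> \<B>" for \<A> \<B>
    unfolding disjoint_iff ZR_simple using class_unique[OF C(1)[OF that(1)] C(1)[OF that(2)]] that(3) by blast
  define cA where "cA \<A> = co (SOME g. g \<in> ZR \<A>)" for \<A>
  have cA: "cA \<A> = co x" if "\<A> \<in> C" "x \<in> ZR \<A>" for \<A> x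
    unfolding cA_def using co_class[OF C(1)[OF that(1)] someI[of "\<lambda>g. g \<in> ZR \<A>", OF that(2)] that(2)] .
  have fin: "finite (ZR \<A>)" if "\<A> \<in> C" for \<A> using sub[OF that] finite_Pp finite_subset by blast
  have sum_eq: "(\<Sum>\<A>\<in>C. cA \<A> * FA \<A> z) = (\<Sum>x\<in>Pp. co x * fx x z)" for z
  proof -
    have "(\<Sum>x\<in>Pp. co x * fx x z) = (\<Sum>\<A>\<in>C. \<Sum>x\<in>ZR \<A>. co x * fx x z)"
      unfolding Un by (rule sum.UNION_disjoint) (use finC fin disj in auto)
    also have "\<dots> = (\<Sum>\<A>\<in>C. cA \<A> * FA \<A> z)"
      by (rule sum.cong) (auto simp: FA_def sum_distrib_left cA)
    finally show ?thesis by simp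
  qed
  define r where "r z = q z - (\<Sum>x\<in>Pp. co x * fx x z)" for z
  have r_eq: "r = (\<lambda>z. q z + (- 1) * (\<Sum>\<A>\<in>C. cA \<A> * FA \<A> z))" by (rule ext) (simp add: r_def sum_eq)
  have rpf_r: "rpf r" unfolding r_eq by (intro rpf_add rpf_cmult rpf_sum rpf_FA q) (use C in auto)
  have reg_pos: "reg r (of_real b)" if b: "b \<in> HR" "b > 0" for b
  proof (cases "b \<in> Pp")
    case True
    have "reg (\<lambda>z. \<Sum>x\<in>Pp - {b}. co x * fx x z) (of_real b)"
    proof (intro reg_sum reg_cmult fx_reg)
      fix x assume x: "x \<in> Pp - {b}"
      then show "x \<in> HR" using PpD by blast
      show "complex_of_real b \<noteq> of_real x" using x by auto
      have "cj x < 0" using Pp_fixed(1)[of x] x by (auto simp: simple_def)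
      then show "complex_of_real b \<noteq> of_real (cj x)" using b by auto
    qed
    from reg_diff[OF co_reg[OF Pp_fixed(1)[OF True]] this]
    have "reg (\<lambda>z. (q z - co b * fx b z) - (\<Sum>x\<in>Pp - {b}. co x * fx x z)) (of_real b)" .
    moreover have "(\<lambda>z. (q z - co b * fx b z) - (\<Sum>x\<in>Pp - {b}. co x * fx x z)) = r"
      by (rule ext) (simp add: r_def sum.remove[OF finite_Pp True])
    ultimately show ?thesis by simp
  next
    case False
    have "reg (\<lambda>z. \<Sum>x\<in>Pp. co x * fx x z) (of_real b)"
    proof (intro reg_sum reg_cmult fx_reg)
      fix x assume x: "x \<in> Pp"
      then show "x \<in> HR" using PpD by blast
      show "complex_of_real b \<noteq> of_real x" using x False by auto
      have "cj x < 0" using Pp_fixed(1)[of x] x by (auto simp: simple_def)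
      then show "complex_of_real b \<noteq> of_real (cj x)" using b by auto
    qed
    moreover have "reg q (of_real b)" using False b by (auto simp: Pp_def)
    ultimately show ?thesis unfolding r_def[abs_def] by (intro reg_diff)
  qed
  \<comment> \<open>Negative points reduce to positive ones by \<open>T\<close>, because r satisfies
    the first relation; away from the hyperbolic fixed points neither q nor any \<open>fx x\<close>
    is singular.\<close>
  have reg_r: "reg r a" if "a \<noteq> 0" for a
  proof (cases "\<exists>b\<in>HR. a = of_real b")
    case True
    then obtain b where b: "b \<in> HR" "a = of_real b" by blast
    show ?thesis
    proof (cases "b > 0")
      case True then show ?thesis using reg_pos b by simp
    next
      case False
      then have "b < 0" using b that by auto
      then have "mv Tm b > 0" by (simp add: mv_Tm)
      then have "reg r (of_real (mv Tm b))" using reg_pos HR_T[OF b(1)] by blast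
      then show ?thesis using rpf_reg_T[OF rpf_r b(1)] b(2) by blast
    qed
  next
    case False
    have "reg q a" using nonzero_pole_real[OF that] False by blast
    moreover have "reg (\<lambda>z. \<Sum>x\<in>Pp. co x * fx x z) a"
      by (intro reg_sum reg_cmult fx_reg) (use PpD cj_HR False in blast)+
    ultimately show ?thesis unfolding r_def[abs_def] by (intro reg_diff)
  qed
  obtain h where h: "bij_betw h {1..card C} C" using ex_bij_betw_nat_finite_1[OF finC] by blast
  have "(\<Sum>l=1..card C. cA (h l) * FA (h l) z) = (\<Sum>\<A>\<in>C. cA \<A> * FA \<A> z)" for z
    by (rule sum.reindex_bij_betw[OF h])
  then have qz: "q z = (\<Sum>l=1..card C. cA (h l) * FA (h l) z) + r z" for z by (simp add: r_def sum_eq)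
  have hC: "h l \<in> hyperbolic_classes p \<and> uminus ` h l = h l" if "l \<in> {1..card C}" for l
    using C bij_betwE[OF h] that by blast
  show ?thesis by (rule that[OF hC qz rpf_r reg_r])
qed

end

subsection \<open>Rational period functions with no pole except 0\<close>

lemma poly_cofinite_eq:
  fixes P Q :: "complex poly" assumes "\<forall>\<^sub>F z in cofinite. poly P z = poly Q z" shows "P = Q"
proof (rule ccontr)
  assume "P \<noteq> Q"
  then have "finite {z. poly (P - Q) z = 0}" by (intro poly_roots_finite) simp
  moreover have "finite {z. poly P z \<noteq> poly Q z}" using assms by (simp add: eventually_cofinite)
  moreover have "{z. poly (P - Q) z = 0} \<union> {z. poly P z \<noteq> poly Q z} = UNIV" by auto
  ultimately have "finite (UNIV :: complex set)" by (metis finite_UnI)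
  then show False using infinite_UNIV_char_0 by blast
qed

lemma powi_tendsto_0: "n > 0 \<Longrightarrow> ((\<lambda>z::complex. z powi n) \<longlongrightarrow> 0) (at 0)"
  by (auto simp: power_int_def intro!: tendsto_eq_intros)

text \<open>At a root b \<noteq> 0 of the denominator the finite limit forces the numerator to
  vanish as well, so the factor cancels. When only 0 is left as a root, the fundamental theorem of
  algebra makes the denominator a monomial.\<close>

lemma reg_off_zero_Laurent:
  assumes f: "rational_function f" and r: "\<And>a. a \<noteq> 0 \<Longrightarrow> reg f a" and nz: "\<not> (\<forall>\<^sub>F z in cofinite. f z = 0)"
  obtains e :: int and P where "poly P 0 \<noteq> 0" "\<forall>\<^sub>F z in cofinite. f z = z powi e * poly P z"
proof -
  obtain P Q where PQ: "Q \<noteq> 0" "\<forall>\<^sub>F z in cofinite. f z = poly P z / poly Q z" using rational_functionD[OF f] .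
  have "\<exists>j A. \<forall>\<^sub>F z in cofinite. f z = poly A z / z ^ j"
    using PQ
  proof (induction "degree Q" arbitrary: P Q rule: less_induct)
    case less
    show ?case
    proof (cases "\<exists>b. b \<noteq> 0 \<and> poly Q b = 0")
      case True
      then obtain b where b: "b \<noteq> 0" "poly Q b = 0" by blast
      obtain L where "(f \<longlongrightarrow> L) (at b)" using r[OF b(1)] by (auto simp: reg_def)
      moreover have "(poly Q \<longlongrightarrow> 0) (at b)" using b(2) by (auto intro!: tendsto_eq_intros)
      ultimately have l: "((\<lambda>z. poly Q z * f z) \<longlongrightarrow> 0 * L) (at b)" by (intro tendsto_mult)
      have "\<forall>\<^sub>F z in cofinite. poly Q z * f z = poly P z"
        using less.prems(2) poly_nonzero_cofinite[OF less.prems(1)] by eventually_elim simp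
      from tendsto_cong[OF cofinite_at[OF this]] l have "(poly P \<longlongrightarrow> 0) (at b)" by simp
      moreover have "(poly P \<longlongrightarrow> poly P b) (at b)" by (auto intro!: tendsto_intros)
      ultimately have "poly P b = 0" using tendsto_unique[OF trivial_limit_at] by blast
      then obtain P' where P': "P = [:- b, 1:] * P'" by (auto simp: poly_eq_0_iff_dvd elim: dvdE)
      obtain Q' where Q': "Q = [:- b, 1:] * Q'" using b(2) by (auto simp: poly_eq_0_iff_dvd elim: dvdE)
      have Q'0: "Q' \<noteq> 0" using less.prems(1) Q' by auto
      have deg: "degree Q' < degree Q" using degree_mult_eq[of "[:- b, 1:]" Q'] Q' Q'0 by simp
      have "\<forall>\<^sub>F z in cofinite. poly [:- b, 1:] z \<noteq> 0" by (rule poly_nonzero_cofinite) simp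
      with less.prems(2) have "\<forall>\<^sub>F z in cofinite. f z = poly P' z / poly Q' z"
      proof eventually_elim
        case (elim z)
        have "f z = (poly [:- b, 1:] z * poly P' z) / (poly [:- b, 1:] z * poly Q' z)"
          using elim(1) by (simp only: P' Q' poly_mult)
        also have "\<dots> = poly P' z / poly Q' z" using elim(2) by (rule mult_divide_mult_cancel_left)
        finally show ?case .
      qed
      from less.hyps[OF deg Q'0 this] show ?thesis .
    next
      case False
      obtain j Q2 where Q2: "Q = [:- 0, 1:] ^ j * Q2" "poly Q2 0 \<noteq> 0" using poly_factor_at[OF less.prems(1)] by blast
      have "\<not> poly Q2 z = 0" for z
      proof
        assume z: "poly Q2 z = 0"
        then have "poly Q z = 0" unfolding Q2(1) poly_mult by simp
        then have "z = 0" using False by blast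
        then show False using z Q2(2) by blast
      qed
      then have nr: "\<not> (\<Sum>i\<le>degree Q2. Polynomial.coeff Q2 i * z ^ i) = 0" for z unfolding poly_altdef .
      have "degree Q2 = 0"
      proof (rule ccontr)
        assume "degree Q2 \<noteq> 0"
        moreover then have "Q2 \<noteq> 0" by auto
        ultimately have "Polynomial.coeff Q2 0 = 0 \<or> (\<exists>i\<in>{1..degree Q2}. Polynomial.coeff Q2 i \<noteq> 0)"
          by (intro disjI2 bexI[of _ "degree Q2"]) auto
        then show False using fundamental_theorem_of_algebra[of "Polynomial.coeff Q2" "degree Q2"] nr by blast
      qed
      then obtain c2 where "Q2 = [:c2:]" by (rule degree_eq_zeroE)
      then have c: "poly Q2 z = poly Q2 0" for z by simp
      have "\<forall>\<^sub>F z in cofinite. f z = poly (Polynomial.smult (1 / poly Q2 0) P) z / z ^ j"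
        using less.prems(2)
      proof eventually_elim
        case (elim z)
        have "poly Q z = z ^ j * poly Q2 0" unfolding Q2(1) poly_mult c[of z] by simp
        then show ?case using elim by simp
      qed
      then show ?thesis by blast
    qed
  qed
  then obtain j A where A: "\<forall>\<^sub>F z in cofinite. f z = poly A z / z ^ j" by blast
  have "A \<noteq> 0"
  proof
    assume "A = 0"
    then have "\<forall>\<^sub>F z in cofinite. f z = 0" using A by simp
    then show False using nz by contradiction
  qed
  then obtain i B where B: "A = [:- 0, 1:] ^ i * B" "poly B 0 \<noteq> 0" using poly_factor_at by blast
  have "\<forall>\<^sub>F z in cofinite. poly [:0, 1:] z \<noteq> (0::complex)" by (rule poly_nonzero_cofinite) simp
  with A have "\<forall>\<^sub>F z in cofinite. f z = z powi (int i - int j) * poly B z"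
    by eventually_elim (simp add: B(1) power_int_diff)
  then show ?thesis using that B(2) by blast
qed

context hecke_weight
begin

text \<open>The first relation turns P into its reflection R and the exponent e into -2 k - e - d,
  where d is the degree. P and R are both nonzero at 0, so the exponents agree.\<close>

lemma Laurent_degree:
  assumes f: "rpf f" and P: "poly P 0 \<noteq> 0" "\<forall>\<^sub>F z in cofinite. f z = z powi e * poly P z"
  shows "int (degree P) = - 2 * int k - 2 * e"
proof -
  define R where "R = reflect_poly P"
  define d where "d = int (degree P)"
  define n where "n = 2 * int k + 2 * e + d"
  define \<epsilon> where "\<epsilon> = (- 1 :: complex) powi (e + d)"
  have P0: "P \<noteq> 0" using P by auto
  have R0: "poly R 0 \<noteq> 0" using P0 by (simp add: R_def)
  have eps: "\<epsilon> \<noteq> 0" by (simp add: \<epsilon>_def)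
  have "\<forall>\<^sub>F z in cofinite. f z + slash k f Tm z = 0" using f by (simp add: rpf_iff)
  with P(2) lft_cofinite[OF det2_Tm P(2)] lft_denom_cofinite[OF det2_Tm]
  have "\<forall>\<^sub>F z in cofinite. z powi n * poly P z = - (\<epsilon> * poly R (- z))"
  proof eventually_elim
    case (elim z)
    have z: "z \<noteq> 0" using elim(3) by (simp add: lft_Tm)
    have Rz: "poly R (- z) = (- z) ^ degree P * poly P (- 1 / z)"
      using poly_reflect_poly_nz[of "- z" P] z by (simp add: R_def inverse_eq_divide)
    have add: "z powi m * z powi m' = z powi (m + m')" for m m' by (rule power_int_add[symmetric]) (use z in simp)
    have 1: "z powi e * poly P z = - (z powi (- (2 * int k)) * ((- 1 / z) powi e * poly P (- 1 / z)))"
      using elim(1,2,4) by (simp add: slash_def lft_Tm eq_neg_iff_add_eq_0)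
    have "- 1 / z = (- 1) * inverse z" by (simp add: divide_inverse)
    then have 2: "(- 1 / z) powi e = (- 1) powi e * z powi (- e)"
      by (simp only: power_int_mult_distrib power_int_inverse power_int_minus)
    have "(- 1) powi d * z powi (- d) * (- z) ^ degree P = ((- 1) ^ degree P * (- z) ^ degree P) * inverse (z ^ degree P)"
      unfolding d_def power_int_minus power_int_of_nat by (simp only: mult_ac)
    also have "\<dots> = 1" using z by (simp flip: power_mult_distrib)
    finally have "(- 1) powi d * z powi (- d) * (- z) ^ degree P * poly P (- 1 / z) = poly P (- 1 / z)" by (simp only: mult_1)
    then have 3: "poly P (- 1 / z) = (- 1) powi d * z powi (- d) * poly R (- z)" unfolding Rz by (simp only: mult.assoc)
    define u where "u = z powi (- (2 * int k)) * z powi (- e) * z powi (- d)"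
    have 4: "z powi e * poly P z = - (\<epsilon> * u * poly R (- z))"
      unfolding 1 2 3 \<epsilon>_def u_def by (subst power_int_add) (simp, simp only: mult_ac)
    have 5: "z powi (2 * int k + e + d) * z powi e = z powi n" unfolding add by (simp add: n_def algebra_simps)
    have 6: "z powi (2 * int k + e + d) * u = 1" unfolding u_def add by simp
    have "x * a = - (c * b)" if "v * y = x" "v * u = 1" "y * a = - (c * u * b)" for x y u v a b c :: complex
    proof -
      have "x * a = v * (y * a)" unfolding that(1)[symmetric] by (rule mult.assoc)
      also have "\<dots> = - (c * (v * u) * b)" unfolding that(3) by (simp only: mult_minus_right mult_ac)
      finally show ?thesis unfolding that(2) by (simp only: mult_1_right)
    qed
    from this[OF 5 6 4] show ?case .
  qed
  from cofinite_at[OF this, of 0]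
  have ev: "\<forall>\<^sub>F z in at 0. z powi n * poly P z = - (\<epsilon> * poly R (- z))" .
  have lR: "((\<lambda>z. - (\<epsilon> * poly R (- z))) \<longlongrightarrow> - (\<epsilon> * poly R 0)) (at 0)" by (auto intro!: tendsto_eq_intros)
  have lP: "(poly P \<longlongrightarrow> poly P 0) (at 0)" by (auto intro!: tendsto_intros)
  have "n = 0"
  proof (rule ccontr)
    assume "n \<noteq> 0"
    then consider "n > 0" | "- n > 0" by linarith
    then show False
    proof cases
      case 1
      have "((\<lambda>z. z powi n * poly P z) \<longlongrightarrow> 0 * poly P 0) (at 0)" by (intro tendsto_mult powi_tendsto_0 1 lP)
      then have "((\<lambda>z. - (\<epsilon> * poly R (- z))) \<longlongrightarrow> 0) (at 0)" using tendsto_cong[OF ev] by simp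
      then have "- (\<epsilon> * poly R 0) = 0" using lR tendsto_unique[OF trivial_limit_at] by blast
      then show False using eps R0 by simp
    next
      case 2
      have "((\<lambda>z. z powi (- n) * - (\<epsilon> * poly R (- z))) \<longlongrightarrow> 0 * - (\<epsilon> * poly R 0)) (at 0)"
        by (intro tendsto_mult powi_tendsto_0 2 lR)
      moreover have "\<forall>\<^sub>F z in at 0. z powi (- n) * - (\<epsilon> * poly R (- z)) = poly P z"
        using ev at_neq
      proof eventually_elim
        case (elim z)
        have "z powi (- n) * (z powi n * poly P z) = poly P z" using elim(2) by (simp add: power_int_minus)
        then show ?case unfolding elim(1) .
      qed
      ultimately have "(poly P \<longlongrightarrow> 0) (at 0)" by (simp add: tendsto_cong)
      then show False using lP P(1) tendsto_unique[OF trivial_limit_at] by blast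
    qed
  qed
  then show ?thesis by (simp add: n_def d_def)
qed

text \<open>Conjugating the second relation by \<open>T\<close>, all terms but those of \<open>V 0 = - T\<close> and of the
  parabolic matrix \<open>V (p - 1)\<close> fixing 0 are regular at 0.\<close>

lemma reg_parabolic_difference:
  assumes f: "rpf f" and r: "\<And>a. a \<noteq> 0 \<Longrightarrow> reg f a"
  shows "reg (\<lambda>w. slash k f (V (int p - 1)) w - f w) 0"
proof -
  have fT: "\<forall>\<^sub>F z in cofinite. f z + slash k f Tm z = 0"
    and fU: "\<forall>\<^sub>F z in cofinite. (\<Sum>j\<in>{0..<int p}. slash k f (Um j) z) = 0" using f by (simp_all add: rpf_iff)
  define J where "J = {1..int p - 2}"
  have J: "{0..<int p} = insert 0 (insert (int p - 1) J)" "0 \<notin> insert (int p - 1) J" "int p - 1 \<notin> J" "finite J"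
    using p3 by (auto simp: J_def)
  have "\<forall>\<^sub>F z in cofinite. \<forall>j\<in>{0..<int p}. slash k (slash k f (Um j)) Tm z = slash k f (V j) z"
    by (rule eventually_ball_finite) (use slash_slash_cofinite[OF det2_Tm, of k f] in \<open>auto simp: V_Um(1)\<close>)
  with lft_cofinite[OF det2_Tm fU] fT
  have "\<forall>\<^sub>F w in cofinite. - (\<Sum>j\<in>J. slash k f (V j) w) = slash k f (V (int p - 1)) w - f w"
  proof eventually_elim
    case (elim w)
    have "(\<Sum>j\<in>{0..<int p}. slash k f (V j) w) = (\<Sum>j\<in>{0..<int p}. slash k (slash k f (Um j)) Tm w)"
      using elim(3) by (intro sum.cong) auto
    also have "\<dots> = lft_denom Tm w powi (- (2 * int k)) * (\<Sum>j\<in>{0..<int p}. slash k f (Um j) (lft Tm w))"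
      by (simp add: slash_def[of k _ Tm] sum_distrib_left)
    also have "\<dots> = 0" using elim(1) by simp
    finally have "slash k f (V 0) w + (slash k f (V (int p - 1)) w + (\<Sum>j\<in>J. slash k f (V j) w)) = 0"
      unfolding J(1) using J(2-4) by simp
    moreover have "slash k f (V 0) w = slash k f Tm w" by (simp add: V_Um(1))
    ultimately show ?case using elim(2) by (simp add: algebra_simps add_eq_0_iff)
  qed
  from reg_cong[OF cofinite_at[OF this]]
  have "reg (\<lambda>w. - (\<Sum>j\<in>J. slash k f (V j) w)) 0 \<longleftrightarrow> reg (\<lambda>w. slash k f (V (int p - 1)) w - f w) 0" .
  moreover have "reg (\<lambda>w. - (\<Sum>j\<in>J. slash k f (V j) w)) 0"
  proof (intro reg_minus reg_sum)
    \<comment> \<open>For these indices \<open>V j\<close> maps 0 to \<open>s (j + 1) / s j\<close>,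
      which is nonzero.\<close>
    fix j assume j: "j \<in> J"
    then have s: "s j \<ge> 1" "s (j + 1) \<ge> 1" using s_ge_one[of j] s_ge_one[of "j + 1"] by (auto simp: J_def)
    show "reg (slash k f (V j)) 0"
      by (rule reg_slash) (use s in \<open>auto simp: lft_denom_def lft_eq intro!: r\<close>)
  qed
  ultimately show ?thesis by blast
qed

text \<open>The parabolic map is w / (1 + l w). The terms of order e cancel in the difference, as do
  the contributions of the derivative of P at order e + 1, which leaves n l P(0) with n = -2 k - e.
  Regularity thus needs e + 1 \<ge> 0 unless n = 0.\<close>

lemma Laurent_order:
  assumes f: "rpf f" and r: "\<And>a. a \<noteq> 0 \<Longrightarrow> reg f a"
    and P: "poly P 0 \<noteq> 0" "\<forall>\<^sub>F z in cofinite. f z = z powi e * poly P z" and e: "e \<noteq> - 2 * int k"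
  shows "e \<ge> - 1"
proof (rule ccontr)
  assume "\<not> e \<ge> - 1"
  then have e1: "- (e + 1) > 0" by simp
  define l where "l = complex_of_real (s 2)"
  have l0: "l \<noteq> 0" using s_ge_one[of 2] p3 by (auto simp: l_def)
  define n where "n = - 2 * int k - e"
  define \<Phi> where "\<Phi> w = (1 + l * w) powi n * poly P (w / (1 + l * w)) - poly P w" for w
  have D: "(\<Phi> has_field_derivative of_int n * l * poly P 0) (at 0)"
    unfolding \<Phi>_def[abs_def]
    by (rule derivative_eq_intros poly_DERIV | simp)+
  have \<Phi>0: "\<Phi> 0 = 0" by (simp add: \<Phi>_def)
  have lim: "((\<lambda>w. \<Phi> w / w) \<longlongrightarrow> of_int n * l * poly P 0) (at 0)"
    using D by (simp add: DERIV_def \<Phi>0)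
  define W where "W = V (int p - 1)"
  have W: "W$1$1 = 1" "W$1$2 = 0" "W$2$1 = s 2" "W$2$2 = 1"
    using s_diff_p[of 1] s_diff_p[of 2] by (simp_all add: W_def)
  have dW: "det2 W = 1" by (simp add: W_def)
  have lW: "lft_denom W w = 1 + l * w" "lft W w = w / (1 + l * w)" for w
    by (simp_all add: lft_eq lft_denom_def W l_def)
  have "\<forall>\<^sub>F w in cofinite. slash k f W w - f w = w powi e * \<Phi> w"
    using P(2) lft_cofinite[OF dW P(2)] lft_denom_cofinite[OF dW]
  proof eventually_elim
    case (elim w)
    have nz: "1 + l * w \<noteq> 0" using elim(3) lW by simp
    have "slash k f W w = (1 + l * w) powi (- (2 * int k)) * ((w / (1 + l * w)) powi e * poly P (w / (1 + l * w)))"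
      using elim(2) by (simp add: slash_def lW)
    also have "(w / (1 + l * w)) powi e = w powi e * (1 + l * w) powi (- e)"
      by (simp only: divide_inverse power_int_mult_distrib power_int_inverse power_int_minus)
    also have "(1 + l * w) powi (- (2 * int k)) * (w powi e * (1 + l * w) powi (- e) * poly P (w / (1 + l * w)))
        = w powi e * (((1 + l * w) powi (- (2 * int k)) * (1 + l * w) powi (- e)) * poly P (w / (1 + l * w)))" by simp
    also have "(1 + l * w) powi (- (2 * int k)) * (1 + l * w) powi (- e) = (1 + l * w) powi n"
      using nz by (simp add: n_def flip: power_int_add)
    finally show ?case using elim(1) by (simp add: \<Phi>_def right_diff_distrib)
  qed
  from reg_cong[OF cofinite_at[OF this]] reg_parabolic_difference[OF f r]
  have "reg (\<lambda>w. w powi e * \<Phi> w) 0" by (simp add: W_def)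
  then obtain c where "((\<lambda>w. w powi e * \<Phi> w) \<longlongrightarrow> c) (at 0)" by (auto simp: reg_def)
  then have "((\<lambda>w. w powi (- (e + 1)) * (w powi e * \<Phi> w)) \<longlongrightarrow> 0 * c) (at 0)"
    by (intro tendsto_mult powi_tendsto_0 e1)
  moreover have "\<forall>\<^sub>F w in at 0. w powi (- (e + 1)) * (w powi e * \<Phi> w) = \<Phi> w / w"
    using at_neq
  proof eventually_elim
    case (elim w)
    have "w powi (- (e + 1)) * w powi e = w powi (- 1)" using elim by (simp flip: power_int_add)
    also have "\<dots> = inverse w" by (simp add: power_int_minus)
    finally show ?case by (simp only: mult.assoc[symmetric] divide_inverse) simp
  qed
  ultimately have "((\<lambda>w. \<Phi> w / w) \<longlongrightarrow> 0) (at 0)" by (simp add: tendsto_cong)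
  then have "of_int n * l * poly P 0 = 0" using lim tendsto_unique[OF trivial_limit_at] by blast
  moreover have "n \<noteq> 0" using e by (simp add: n_def)
  ultimately show False using P(1) l0 by simp
qed

text \<open>If e \<noteq> -2 k, then e \<ge> -1, while the degree -2 k - 2 e \<ge> 0 gives e \<le> -
  k. This leaves only k = 1, e = -1 and a constant P.\<close>

lemma Laurent_cases:
  assumes f: "rpf f" and r: "\<And>a. a \<noteq> 0 \<Longrightarrow> reg f a"
  obtains "\<forall>\<^sub>F z in cofinite. f z = 0" | c where "k = 1" "\<forall>\<^sub>F z in cofinite. f z = c * z powi (- 1)"
    | P where "degree P = 2 * k" "\<forall>\<^sub>F z in cofinite. f z = z powi (- (2 * int k)) * poly P z"
proof (cases "\<forall>\<^sub>F z in cofinite. f z = 0")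
  case False
  have "rational_function f" using f rpf_iff by blast
  then obtain e :: int and P where P: "poly P 0 \<noteq> 0" "\<forall>\<^sub>F z in cofinite. f z = z powi e * poly P z"
    using reg_off_zero_Laurent r False by metis
  have d: "int (degree P) = - 2 * int k - 2 * e" using Laurent_degree[OF f P] .
  show ?thesis
  proof (cases "e = - 2 * int k")
    case True
    then have "degree P = 2 * k" using d by simp
    then show ?thesis using that(3) P(2) True by simp
  next
    case False
    then have "e \<ge> - 1" using Laurent_order[OF f r P] by blast
    then have ke: "k = 1" "e = - 1" "degree P = 0" using d k by linarith+
    then obtain c where "P = [:c:]" using degree_eq_zeroE by blast
    then show ?thesis using that(2)[of c] ke P(2) by (simp add: mult.commute)
  qed
qed (use that(1) in blast)

lemma rpf_regular_off_zero:
  assumes f: "rpf f" and r: "\<And>a. a \<noteq> 0 \<Longrightarrow> reg f a"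
  obtains f0 where "is_q_k0 k f0" "\<forall>\<^sub>F z in cofinite. f z = f0 z"
proof -
  have key: "\<exists>f0. is_q_k0 k f0 \<and> (\<forall>\<^sub>F z in cofinite. g z + a * (1 - z powi (- (2 * int k))) = f0 z)"
    if "(\<forall>\<^sub>F z in cofinite. g z = 0) \<or> (k = 1 \<and> (\<exists>c. \<forall>\<^sub>F z in cofinite. g z = c * z powi (- 1)))" for g a
    using that
  proof
    assume g: "\<forall>\<^sub>F z in cofinite. g z = 0"
    have "is_q_k0 k (\<lambda>z. a * (1 - z powi (- (2 * int k))))"
      unfolding is_q_k0_def by (rule exI[of _ a], rule exI[of _ 0]) auto
    then show ?thesis using g by (intro exI[of _ "\<lambda>z. a * (1 - z powi (- (2 * int k)))"]) (auto elim: eventually_mono)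
  next
    assume "k = 1 \<and> (\<exists>c. \<forall>\<^sub>F z in cofinite. g z = c * z powi (- 1))"
    then obtain c where c: "k = 1" "\<forall>\<^sub>F z in cofinite. g z = c * z powi (- 1)" by blast
    have "is_q_k0 k (\<lambda>z. a * (1 - z powi (- (2 * int k))) + c * z powi (- 1))"
      unfolding is_q_k0_def by (rule exI[of _ a], rule exI[of _ c]) (simp add: c(1))
    then show ?thesis using c(2)
      by (intro exI[of _ "\<lambda>z. a * (1 - z powi (- (2 * int k))) + c * z powi (- 1)"]) (auto elim: eventually_mono)
  qed
  have "\<exists>f0. is_q_k0 k f0 \<and> (\<forall>\<^sub>F z in cofinite. f z = f0 z)"
  proof (rule Laurent_cases[OF f r])
    fix P assume P: "degree P = 2 * k" "\<forall>\<^sub>F z in cofinite. f z = z powi (- (2 * int k)) * poly P z"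
    define a where "a = lead_coeff P"
    define g where "g = (\<lambda>z. f z + (- a) * (1 - z powi (- (2 * int k))))"
    have g: "rpf g" unfolding g_def by (intro rpf_add f rpf_cmult rpf_one_minus)
    have "is_q_k0 k (\<lambda>z. 1 * (1 - z powi (- (2 * int k))))"
      unfolding is_q_k0_def by (rule exI[of _ 1], rule exI[of _ 0]) auto
    then have gr: "reg g b" if "b \<noteq> 0" for b
      unfolding g_def using r[OF that] q_k0_reg[OF _ that] by (intro reg_add reg_cmult) auto
    \<comment> \<open>Subtracting a (1 - z^(-2k)) with a the leading coefficient removes the top
      term. The numerator then has degree below 2 k, so a second case distinction excludes the full
      degree and leaves 0 or a multiple of 1/z.\<close>
    define P' where "P' = P - Polynomial.smult a (Polynomial.monom 1 (2 * k) - 1)"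
    have P': "\<forall>\<^sub>F z in cofinite. g z = z powi (- (2 * int k)) * poly P' z"
      using P(2) lft_denom_cofinite[OF det2_Tm]
    proof eventually_elim
      case (elim z)
      then have z: "z \<noteq> 0" by (simp add: lft_Tm)
      have "z powi (- (2 * int k)) * z ^ (2 * k) = 1"
        using z power_int_of_nat[of z "2 * k"] by (simp add: power_int_minus)
      then show ?case using elim(1) by (simp add: g_def P'_def poly_monom algebra_simps)
    qed
    have "Polynomial.coeff P' (2 * k) = 0" using P(1) k by (simp add: P'_def a_def coeff_1)
    moreover have "degree P' \<le> 2 * k"
      unfolding P'_def using P(1)
      by (intro degree_diff_le order_trans[OF degree_smult_le] degree_monom_le) (auto intro: degree_monom_le)
    ultimately have deg: "degree P' \<noteq> 2 * k" using k by (metis degree_0 leading_coeff_0_iff mult_is_0 neq0_conv zero_neq_numeral)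
    have "(\<forall>\<^sub>F z in cofinite. g z = 0) \<or> (k = 1 \<and> (\<exists>c. \<forall>\<^sub>F z in cofinite. g z = c * z powi (- 1)))"
    proof (rule Laurent_cases[OF g gr])
      fix P2 assume P2: "degree P2 = 2 * k" "\<forall>\<^sub>F z in cofinite. g z = z powi (- (2 * int k)) * poly P2 z"
      have "\<forall>\<^sub>F z in cofinite. poly P' z = poly P2 z"
        using P' P2(2) lft_denom_cofinite[OF det2_Tm] by eventually_elim (simp add: lft_Tm)
      then show ?thesis using poly_cofinite_eq P2(1) deg by blast
    qed auto
    from key[OF this, of a] show ?thesis by (simp add: g_def)
  next
    assume "\<forall>\<^sub>F z in cofinite. f z = 0"
    from key[OF disjI1[OF this], of 0] show ?thesis by simp
  next
    fix c assume "k = 1" "\<forall>\<^sub>F z in cofinite. f z = c * z powi (- 1)"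
    then have "k = 1 \<and> (\<exists>c. \<forall>\<^sub>F z in cofinite. f z = c * z powi (- 1))" by blast
    from key[OF disjI2[OF this], of 0] show ?thesis by simp
  qed
  then show ?thesis using that by blast
qed

end

lemma (in symmetric_rpf) explicit: "explicit_form p k q"
proof -
  obtain L :: nat and \<A> d r where A: "\<And>l. l \<in> {1..L} \<Longrightarrow> \<A> l \<in> hyperbolic_classes p \<and> uminus ` \<A> l = \<A> l"
    and qz: "\<And>z. q z = (\<Sum>l=1..L. d l * FA (\<A> l) z) + r z" and r: "rpf r" "\<And>a. a \<noteq> 0 \<Longrightarrow> reg r a"
    using decomposition by blast
  obtain f0 where f0: "is_q_k0 k f0" "\<forall>\<^sub>F z in cofinite. r z = f0 z" using rpf_regular_off_zero[OF r] .
  have "\<forall>\<^sub>F z in cofinite. q z = (\<Sum>l=1..L. d l * FA (\<A> l) z) + 1 * f0 z"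
    using f0(2) by eventually_elim (simp add: qz)
  then have "(\<forall>l\<in>{1..L}. \<A> l \<in> hyperbolic_classes p \<and> uminus ` \<A> l = \<A> l) \<and> is_q_k0 k f0 \<and>
      (\<forall>\<^sub>F z in cofinite. q z = (\<Sum>l=1..L. d l * FA (\<A> l) z) + 1 * f0 z)" using A f0(1) by blast
  then show ?thesis unfolding explicit_form_def FA_Z_set by (intro exI)
qed

theorem theorem2:
  fixes p k :: nat
  assumes "p \<ge> 3" and "k > 0" and "odd k"
  shows
    "(\<forall>q. rational_period_function p k q \<and>
          (\<forall>\<alpha> \<in> poles q - {0}. hecke_symmetric p (irreducible_poles p q \<alpha>))
          \<longrightarrow> explicit_form p k q) \<and>
     (\<forall>q. explicit_form p k q
          \<longrightarrow> rational_period_function p k q \<and>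
              (\<forall>\<alpha> \<in> poles q - {0}. hecke_symmetric p (irreducible_poles p q \<alpha>)))"
proof -
  interpret hecke_weight p k using assms by unfold_locales auto
  have "explicit_form p k q" if q: "rational_period_function p k q"
    "\<forall>\<alpha> \<in> poles q - {0}. hecke_symmetric p (irreducible_poles p q \<alpha>)" for q
  proof -
    interpret symmetric_rpf p k q by unfold_locales (use q in blast)+
    show ?thesis by (rule explicit)
  qed
  moreover have "rational_period_function p k q \<and>
      (\<forall>\<alpha> \<in> poles q - {0}. hecke_symmetric p (irreducible_poles p q \<alpha>))" if "explicit_form p k q" for q
    using explicit_rpf[OF that] explicit_symmetric[OF that] by blast
  ultimately show ?thesis by blast
qed

end
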